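(* Let $d\geq 2$, let $K_d=\lfloor\frac d2\rfloor+1$, let $(X_n)_{n\in\mathbb{N}}$ be a sequence of $\mathbb{Z}^d$-valued random variables with laws $\mu_n$, mod-$\phi$ convergent with parameters $\lambda_n\to+\infty$, and let $(\nu_n)_{n\in\mathbb{N}}$ be a general approximation scheme, with $\widehat{\mu_n}=e^{\lambda_n\phi}\psi_n$, $\widehat{\nu_n}=e^{\lambda_n\phi}\chi_n$, $\psi_n\to\psi$, $\chi_n\to\chi$. Let $r\geq\lfloor\frac d2\rfloor$ be an integer. Assume that $\psi_n,\psi,\chi_n,\chi$ are of class $\mathscr{C}^{K_d}$ on $\mathbb{T}^d$, that $\partial^\delta(\psi_n-\chi_n)(0)=\partial^\delta(\psi-\chi)(0)=0$ for every multi-index $\delta$ with $|\delta|<K_d$, and that there exist families of coefficients $(\beta_n^\alpha)_{|\alpha|=r+1}$, $(\gamma_n^\alpha)_{|\alpha|=r+2}$, $(\beta^\alpha)_{|\alpha|=r+1}$, $(\gamma^\alpha)_{|\alpha|=r+2}$ with $\beta_n^\alpha\to\beta^\alpha$, $\gamma_n^\alpha\to\gamma^\alpha$, such that for every multi-index $\delta$ with $|\delta|=K_d$, $$\partial^\delta(\psi_n-\chi_n)(\xi)=i^{|\delta|}\left(\sum_{|\rho|=r+1-|\delta|}\beta_n^{\rho+\delta}\frac{(\rho+\delta)!}{\rho!}(i\xi)^\rho+\sum_{|\rho|=r+2-|\delta|}\gamma_n^{\rho+\delta}\frac{(\rho+\delta)!}{\rho!}(i\xi)^\rho(1+o_\xi(1))\right)$$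 for all $n\in\mathbb{N}$, and $$\partial^\delta(\psi-\chi)(\xi)=i^{|\delta|}\left(\sum_{|\rho|=r+1-|\delta|}\beta^{\rho+\delta}\frac{(\rho+\delta)!}{\rho!}(i\xi)^\rho+\sum_{|\rho|=r+2-|\delta|}\gamma^{\rho+\delta}\frac{(\rho+\delta)!}{\rho!}(i\xi)^\rho(1+o_\xi(1))\right),$$ where the $o_\xi(1)$ tend to $0$ as $\xi\to0$, uniformly in $n$. Then, as $n\to\infty$, $$d_{\mathrm{TV}}(\mu_n,\nu_n)=\frac{1}{(2\pi)^{\frac d2}(\lambda_n)^{\frac{r+1}{2}}}\left(\int_{\mathbb{R}^d}e^{-\frac{\|x\|^2}{2}}\left|\sum_{|\alpha|=r+1}\frac{\beta^\alpha H_\alpha(x)}{\sigma^\alpha}\right|dx\right)+o\!\left(\frac{1}{(\lambda_n)^{\frac{r+1}{2}}}\right).$$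
   Context: Fourier transforms: for a (finite signed) measure $\mu$ on $\mathbb{Z}^d$, $\widehat\mu(\xi)=\sum_{k\in\mathbb{Z}^d}\mu(\{k\})e^{i\sum_j k_j\xi_j}$, a function on $\mathbb{T}^d=(\mathbb{R}/2\pi\mathbb{Z})^d$. Reference law: $\phi(\xi)=\sum_{j=1}^d\phi_j(\xi_j)$, where each $\phi_j$ is the ($2\pi$-periodic, continuous, $\phi_j(0)=0$) exponent of an infinitely divisible probability law on $\mathbb{Z}$ with Fourier transform $e^{\phi_j}$, having moments at least up to order $K_d$ (note $K_d\ge 2$) and not supported on any proper sublattice of $\mathbb{Z}$. Near $0$, $\phi_j(\theta)=im_j\theta-\frac{\sigma_j^2\theta^2}{2}+o(\theta^2)$ with $\sigma_j>0$. General approximation scheme: $\mu_n$ is the law of $X_n$, $\nu_n$ is a signed measure on $\mathbb{Z}^d$, and $\widehat{\mu_n}=e^{\lambda_n\phi}\psi_n$, $\widehat{\nu_n}=e^{\lambda_n\phi}\chi_n$ with $\lambda_n\to+\infty$, $\psi_n\to\psi$ and $\chi_n\to\chi$ (at least) uniformly on $\mathbb{T}^d$. The residues $\psi_n,\psi,\chi_n,\chi$ are functions on $\mathbb{T}^d$ with absolutely convergent Fourier series, and $\chi_n(0)=\chi(0)=1$. Mod-$\phi$ convergence of $(X_n)$ with parameters $\lambda_n$ and limit $\psi$ means precisely this property of $\widehat{\mu_n}$. Total variation distance (with this normalization): $d_{\mathrm{TV}}(\mu,\nu)=\sum_{k\in\mathbb{Z}^d}|\mu(\{k\})-\nu(\{k\})|$.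 Notation: multi-indices lie in $\mathbb{N}^d$ (with $0\in\mathbb{N}$), $|\alpha|=\sum_i\alpha_i$, $\alpha!=\prod_i\alpha_i!$, $(i\xi)^\alpha=\prod_j(i\xi_j)^{\alpha_j}$, $\partial^\alpha=\partial^{|\alpha|}/\partial\xi_1^{\alpha_1}\cdots\partial\xi_d^{\alpha_d}$, $\|x\|^2=\sum_i x_i^2$, $\sigma^\alpha=\prod_i\sigma_i^{\alpha_i}$, $H_\alpha(x)=\prod_{i=1}^dH_{\alpha_i}(x_i)$, where $H_r(x)=(-1)^re^{x^2/2}\frac{d^r}{dx^r}e^{-x^2/2}$ is the $r$-th Hermite polynomial.
   Formalization: The error terms o_ξ(1) are assumed not only to tend to 0 as ξ→0 uniformly in n, but also to be bounded on the whole torus T^d by a constant independent of n; without control away from 0 the claim fails. *)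

theory Defs
  imports "HOL-Probability.Probability" "HOL-Library.Landau_Symbols"
begin

text \<open>
  The dimension \<open>d\<close> is \<open>CARD('d)\<close>; the lattice is \<open>int ^ 'd\<close>, multi-indices are \<open>nat ^ 'd\<close>.
  Functions on the torus are functions on \<open>real ^ 'd\<close> that are \<open>2 * pi\<close>-periodic in each
  coordinate; uniform convergence on the torus is uniform convergence on \<open>UNIV\<close>.
\<close>

definition lattice_char :: "int ^ 'd \<Rightarrow> real ^ 'd \<Rightarrow> complex" where
  "lattice_char k \<xi> = exp (\<i> * of_real (\<Sum>j\<in>UNIV. of_int (k $ j) * \<xi> $ j))"

text \<open>A finite signed measure is a real-valued countably additive set function.\<close>

definition signed_measure :: "((int ^ 'd) set \<Rightarrow> real) \<Rightarrow> bool" where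
  "signed_measure \<nu> \<longleftrightarrow>
     (\<forall>A::nat \<Rightarrow> (int ^ 'd) set. disjoint_family A \<longrightarrow> (\<lambda>i. \<nu> (A i)) sums \<nu> (\<Union>i. A i))"

definition fourier :: "((int ^ 'd) set \<Rightarrow> real) \<Rightarrow> real ^ 'd \<Rightarrow> complex" where
  "fourier \<nu> \<xi> = (\<Sum>\<^sub>\<infinity>k. of_real (\<nu> {k}) * lattice_char k \<xi>)"

text \<open>No factor \<open>1/2\<close> in this normalization.\<close>

definition d_TV :: "((int ^ 'd) set \<Rightarrow> real) \<Rightarrow> ((int ^ 'd) set \<Rightarrow> real) \<Rightarrow> real" where
  "d_TV \<mu> \<nu> = (\<Sum>\<^sub>\<infinity>k. \<bar>\<mu> {k} - \<nu> {k}\<bar>)"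

definition abs_conv_fourier_series :: "(real ^ 'd \<Rightarrow> complex) \<Rightarrow> bool" where
  "abs_conv_fourier_series f \<longleftrightarrow>
     (\<exists>c. (\<lambda>k. norm (c k)) summable_on UNIV \<and>
          (\<forall>\<xi>. f \<xi> = (\<Sum>\<^sub>\<infinity>k. c k * lattice_char k \<xi>)))"

text \<open>
  The convolution roots are required to live on \<open>\<int>\<close>.  For a law with a continuous
  \<open>2 * pi\<close>-periodic exponent vanishing at \<open>0\<close> this is the same as infinite divisibility on \<open>\<real>\<close>,
  since the \<open>n\<close>-th root then has a \<open>2 * pi\<close>-periodic Fourier transform.
\<close>

definition infinitely_divisible :: "int pmf \<Rightarrow> bool" where
  "infinitely_divisible p \<longleftrightarrow> (\<forall>n>0. \<exists>q. p = map_pmf sum_list (replicate_pmf n q))"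

definition reference_exponent :: "nat \<Rightarrow> (real \<Rightarrow> complex) \<Rightarrow> real \<Rightarrow> real \<Rightarrow> bool" where
  "reference_exponent K \<phi> m \<sigma> \<longleftrightarrow>
     (\<forall>\<theta>. \<phi> (\<theta> + 2 * pi) = \<phi> \<theta>) \<and> continuous_on UNIV \<phi> \<and> \<phi> 0 = 0 \<and>
     (\<exists>p. infinitely_divisible p \<and>
          (\<forall>\<theta>. measure_pmf.expectation p (\<lambda>k. exp (\<i> * of_real (of_int k * \<theta>))) = exp (\<phi> \<theta>)) \<and>
          integrable (measure_pmf p) (\<lambda>k. \<bar>real_of_int k\<bar> ^ K) \<and>
          (\<forall>a::int. set_pmf p \<subseteq> {k. a dvd k} \<longrightarrow> \<bar>a\<bar> = 1)) \<and>
     \<sigma> > 0 \<and>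
     (\<lambda>\<theta>. \<phi> \<theta> - (\<i> * of_real (m * \<theta>) - of_real (\<sigma>\<^sup>2 * \<theta>\<^sup>2 / 2))) \<in> o[at 0](\<lambda>\<theta>. of_real (\<theta>\<^sup>2))"

text \<open>
  For laws \<open>m\<close> of random variables this is mod-\<open>\<phi>\<close> convergence with parameters \<open>lam\<close>, residues
  \<open>\<psi>\<close> and limit \<open>\<psi>'\<close>; for signed measures it is the corresponding property of an approximation
  scheme.
\<close>

definition mod_convergent ::
  "(real ^ 'd \<Rightarrow> complex) \<Rightarrow> (nat \<Rightarrow> real) \<Rightarrow> (nat \<Rightarrow> (int ^ 'd) set \<Rightarrow> real)
    \<Rightarrow> (nat \<Rightarrow> real ^ 'd \<Rightarrow> complex) \<Rightarrow> (real ^ 'd \<Rightarrow> complex) \<Rightarrow> bool" where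
  "mod_convergent \<phi> lam m \<psi> \<psi>' \<longleftrightarrow>
     filterlim lam at_top sequentially \<and>
     (\<forall>n \<xi>. fourier (m n) \<xi> = exp (of_real (lam n) * \<phi> \<xi>) * \<psi> n \<xi>) \<and>
     (\<forall>n. abs_conv_fourier_series (\<psi> n)) \<and> abs_conv_fourier_series \<psi>' \<and>
     uniform_limit UNIV \<psi> \<psi>' sequentially"

definition mi_abs :: "nat ^ 'd \<Rightarrow> nat" where
  "mi_abs \<alpha> = (\<Sum>j\<in>UNIV. \<alpha> $ j)"

definition mi_fact :: "nat ^ 'd \<Rightarrow> complex" where
  "mi_fact \<alpha> = (\<Prod>j\<in>UNIV. fact (\<alpha> $ j))"

definition i_monom :: "real ^ 'd \<Rightarrow> nat ^ 'd \<Rightarrow> complex" where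
  "i_monom \<xi> \<alpha> = (\<Prod>j\<in>UNIV. (\<i> * of_real (\<xi> $ j)) ^ (\<alpha> $ j))"

definition mi_power :: "real ^ 'd \<Rightarrow> nat ^ 'd \<Rightarrow> real" where
  "mi_power x \<alpha> = (\<Prod>j\<in>UNIV. (x $ j) ^ (\<alpha> $ j))"

definition hermite :: "nat \<Rightarrow> real \<Rightarrow> real" where
  "hermite r x = (-1) ^ r * exp (x\<^sup>2 / 2) * (deriv ^^ r) (\<lambda>y. exp (- (y\<^sup>2) / 2)) x"

definition mi_hermite :: "nat ^ 'd \<Rightarrow> real ^ 'd \<Rightarrow> real" where
  "mi_hermite \<alpha> x = (\<Prod>j\<in>UNIV. hermite (\<alpha> $ j) (x $ j))"

definition partial :: "'d \<Rightarrow> (real ^ 'd \<Rightarrow> complex) \<Rightarrow> real ^ 'd \<Rightarrow> complex" where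
  "partial j f x = vector_derivative (\<lambda>t. f (x + t *\<^sub>R axis j 1)) (at 0)"

text \<open>
  An arbitrary enumeration of the coordinates fixes the order of differentiation, which does not
  matter for functions of class \<open>C^|\<alpha>|\<close>.
\<close>

definition mi_partial :: "nat ^ 'd \<Rightarrow> (real ^ 'd \<Rightarrow> complex) \<Rightarrow> real ^ 'd \<Rightarrow> complex" where
  "mi_partial \<alpha> f =
     foldr (\<lambda>j. partial j ^^ (\<alpha> $ j)) (SOME js. distinct js \<and> set js = (UNIV :: 'd set)) f"

primrec class_C :: "nat \<Rightarrow> (real ^ 'd \<Rightarrow> complex) \<Rightarrow> bool" where
  "class_C 0 f \<longleftrightarrow> continuous_on UNIV f"
| "class_C (Suc k) f \<longleftrightarrow> continuous_on UNIV f \<and>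
     (\<forall>j. (\<forall>x. (\<lambda>t. f (x + t *\<^sub>R axis j 1)) differentiable at 0) \<and> class_C k (partial j f))"

text \<open>
  The fundamental domain of the torus, as a set of representatives (boundary points are
  represented several times).
\<close>

definition torus :: "(real ^ 'd) set" where
  "torus = {\<xi>. \<forall>j. \<bar>\<xi> $ j\<bar> \<le> pi}"

text \<open>
  Remainder functions on the torus that are \<open>o(1)\<close> as \<open>\<xi> \<rightarrow> 0\<close>, uniformly in the index \<open>n\<close>.
  Away from the origin uniformity in \<open>n\<close> means that they are bounded by a constant not depending
  on \<open>n\<close>.
\<close>

definition uniform_o1 :: "('n \<Rightarrow> real ^ 'd \<Rightarrow> complex) \<Rightarrow> bool" where
  "uniform_o1 \<epsilon> \<longleftrightarrow>
     uniform_limit UNIV (\<lambda>\<xi> n. \<epsilon> n \<xi>) (\<lambda>_. 0) (at 0) \<and>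
     (\<exists>C. \<forall>n. \<forall>\<xi>\<in>torus. norm (\<epsilon> n \<xi>) \<le> C)"

text \<open>
  \<open>\<gamma> (1 + o(1))\<close> is written \<open>\<gamma> + o(1)\<close>.  As the coefficients \<open>\<gamma> n \<alpha>\<close> are bounded in \<open>n\<close> wherever
  this is used, the former is a special case of the latter, which differs from it only if some
  coefficient vanishes (the former would then forbid any remainder in the corresponding term).
\<close>

definition deriv_expansion ::
  "nat \<Rightarrow> nat \<Rightarrow> ('n \<Rightarrow> real ^ 'd \<Rightarrow> complex) \<Rightarrow> ('n \<Rightarrow> nat ^ 'd \<Rightarrow> complex)
    \<Rightarrow> ('n \<Rightarrow> nat ^ 'd \<Rightarrow> complex) \<Rightarrow> bool" where
  "deriv_expansion K r f \<beta> \<gamma> \<longleftrightarrow>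
     (\<forall>\<delta>. mi_abs \<delta> = K \<longrightarrow>
       (\<exists>\<epsilon>. (\<forall>\<rho>. uniform_o1 (\<epsilon> \<rho>)) \<and>
         (\<forall>n. \<forall>\<xi>\<in>torus. mi_partial \<delta> (f n) \<xi> =
           \<i> ^ mi_abs \<delta> *
           ((\<Sum>\<rho> | mi_abs \<rho> = r + 1 - mi_abs \<delta>.
               \<beta> n (\<rho> + \<delta>) * (mi_fact (\<rho> + \<delta>) / mi_fact \<rho>) * i_monom \<xi> \<rho>) +
            (\<Sum>\<rho> | mi_abs \<rho> = r + 2 - mi_abs \<delta>.
               (\<gamma> n (\<rho> + \<delta>) + \<epsilon> \<rho> n \<xi>) * (mi_fact (\<rho> + \<delta>) / mi_fact \<rho>) * i_monom \<xi> \<rho>)))))"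

end

theory Submission
  imports Defs
begin

text \<open>
  Let \<open>s\<^sub>n = sqrt \<lambda>\<^sub>n\<close> and \<open>a\<^sub>n(k) = \<mu>\<^sub>n{k} - \<nu>\<^sub>n{k}\<close>, and spread \<open>a\<^sub>n\<close> out to the function
  \<open>A\<^sub>n(x) = s\<^sub>n\<^bsup>d+r+1\<^esup> (\<Prod>\<sigma>\<^sub>j) a\<^sub>n(\<lfloor>\<lambda>\<^sub>n m + s\<^sub>n \<sigma> x\<rfloor>)\<close> on \<open>\<real>\<^sup>d\<close>, so that
  \<open>\<integral>\<bar>A\<^sub>n\<bar> = \<lambda>\<^sub>n\<^bsup>(r+1)/2\<^esup> d\<^sub>T\<^sub>V(\<mu>\<^sub>n,\<nu>\<^sub>n)\<close>. Writing \<open>a\<^sub>n(k)\<close> as an integral of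
  \<open>e\<^bsup>\<lambda>\<^sub>n\<phi>\<^esup>(\<psi>\<^sub>n - \<chi>\<^sub>n)\<close> over the torus and rescaling by \<open>s\<^sub>n\<close>, dominated convergence gives the pointwise
  limit of \<open>A\<^sub>n\<close>, a Gaussian density times the Hermite sum. Convergence in \<open>L\<^sup>1\<close> then only
  needs a uniform bound on \<open>\<integral> W \<bar>A\<^sub>n\<bar>\<^sup>2\<close> for a weight \<open>W\<close> with \<open>1/W\<close> integrable. With
  \<open>W(x) = 1 + \<Sum>\<^sub>j \<bar>x\<^sub>j\<bar>\<^bsup>2K\<^esup>\<close>, for which \<open>2K > d\<close> is needed, Parseval's identity reduces this bound to
  \<open>L\<^sup>2\<close> estimates of the pure derivatives \<open>\<partial>\<^sub>j\<^sup>K\<close> of the recentred \<open>e\<^bsup>\<lambda>\<^sub>n\<phi>\<^esup>(\<psi>\<^sub>n - \<chi>\<^sub>n)\<close>.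
\<close>

section \<open>Functions of class \<open>C\<^sup>k\<close> and mixed partial derivatives\<close>

text \<open>Pointwise convergence of \<open>A\<^sub>n\<close> alone does not give convergence of the
  norms: the \<open>a\<^sub>n\<close> are signed, no total mass is conserved, and mass could escape
  to infinity. The weight prevents this. Its exponent explains the value of K: d div 2 + 1 is the
  least integer with 2 K > d. As the weight is a sum over the coordinates, pure derivatives suffice.
  Two obstacles shape the estimates. The drift i m makes the first derivative of \<lambda> \<phi> of
  size \<lambda>, too large by a factor sqrt \<lambda>; subtracting the linear phase of the lattice
  point floor(\<lambda> m) leaves a bounded error and keeps the Fourier coefficients on the lattice.
  Moreover the bound Re \<phi>(\<theta>) \<le> - c \<theta>^2 is needed up to |\<theta>| = pi,
  whereas the sublattice hypothesis only excludes supports in a proper subgroup and not in a coset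
  of one: the uniform law on {-1, 1} satisfies it, yet its characteristic function has modulus 1 at
  pi. Infinite divisibility closes this gap.\<close>

lemma class_C_continuous: "class_C k f \<Longrightarrow> continuous_on UNIV f"
  by (cases k) auto

lemma class_C_SucD:
  assumes "class_C (Suc k) f"
  shows "class_C k f"
  using assms
proof (induction k arbitrary: f)
  case 0
  then show ?case by simp
next
  case (Suc k)
  then show ?case by (metis class_C.simps(2))
qed

lemma class_C_mono:
  assumes "class_C k f" "l \<le> k"
  shows "class_C l f"
  using assms(2,1) by (induction rule: dec_induct) (use class_C_SucD in auto)

lemma partial_eqI:
  "((\<lambda>t. f (x + t *\<^sub>R axis j 1)) has_vector_derivative D) (at 0) \<Longrightarrow> partial j f x = D"
  unfolding partial_def by (rule vector_derivative_at)

lemma class_C_has_partial: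
  assumes "class_C (Suc k) f"
  shows "((\<lambda>t. f (x + t *\<^sub>R axis j 1)) has_vector_derivative partial j f x) (at 0)"
  using assms unfolding partial_def by (simp flip: vector_derivative_works)

lemma class_C_has_vector_derivative_line:
  assumes "class_C (Suc k) f"
  shows "((\<lambda>t. f (x + t *\<^sub>R axis j 1)) has_vector_derivative partial j f (x + s *\<^sub>R axis j 1)) (at s within S)"
proof -
  have 1: "((\<lambda>t. f (x + s *\<^sub>R axis j 1 + t *\<^sub>R axis j 1)) has_vector_derivative
      partial j f (x + s *\<^sub>R axis j 1)) (at (s - s))"
    using class_C_has_partial[OF assms] by simp
  have 2: "((\<lambda>t. t - s) has_vector_derivative 1) (at s)"
    by (auto intro!: derivative_eq_intros)
  have "((\<lambda>t. f (x + t *\<^sub>R axis j 1)) has_vector_derivative partial j f (x + s *\<^sub>R axis j 1)) (at s)"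
    using vector_diff_chain_at[OF 2 1] by (simp add: o_def algebra_simps flip: scaleR_add_left)
  then show ?thesis by (rule has_vector_derivative_at_within)
qed

text \<open>The candidate derivatives \<open>f'\<close> are supplied from outside, so the closure
  lemmas can give an explicit formula and need not compute \<open>partial\<close>
  beforehand.\<close>

lemma class_C_SucI:
  assumes "continuous_on UNIV f"
    and "\<And>j x. ((\<lambda>t. f (x + t *\<^sub>R axis j 1)) has_vector_derivative f' j x) (at 0)"
    and "\<And>j. class_C k (f' j)"
  shows "class_C (Suc k) f"
proof -
  have "partial j f = f' j" for j
    using partial_eqI[OF assms(2)] by auto
  then show ?thesis
    using assms by (auto intro: differentiableI_vector)
qed

section \<open>Closure of \<open>class_C\<close> under sums, products and exponentials\<close>

lemma class_C_const: "class_C k (\<lambda>_. c)"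
proof (induction k arbitrary: c)
  case (Suc k)
  have "((\<lambda>t::real. c) has_vector_derivative 0) (at 0)"
    by auto
  with Suc show ?case by (intro class_C_SucI[where f' = "\<lambda>_ _. 0"]) auto
qed auto

lemma partial_add:
  assumes "class_C (Suc k) f" "class_C (Suc k) g"
  shows "partial j (\<lambda>x. f x + g x) = (\<lambda>x. partial j f x + partial j g x)"
  by (rule ext, rule partial_eqI)
     (intro has_vector_derivative_add class_C_has_partial[OF assms(1)] class_C_has_partial[OF assms(2)])

lemma class_C_add: "class_C k f \<Longrightarrow> class_C k g \<Longrightarrow> class_C k (\<lambda>x. f x + g x)"
proof (induction k arbitrary: f g)
  case (Suc k)
  have "class_C k (partial j f)" "class_C k (partial j g)" for j
    using Suc.prems by auto
  then show ?case
    by (intro class_C_SucI[where f' = "\<lambda>j x. partial j f x + partial j g x"] Suc.IH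
          has_vector_derivative_add class_C_has_partial[OF Suc.prems(1)] class_C_has_partial[OF Suc.prems(2)])
       (use Suc.prems in \<open>auto intro!: continuous_intros\<close>)
qed (auto intro!: continuous_intros)

lemma has_vector_derivative_mult_partial:
  assumes "class_C (Suc k) f" "class_C (Suc l) g"
  shows "((\<lambda>t. f (x + t *\<^sub>R axis j 1) * g (x + t *\<^sub>R axis j 1)) has_vector_derivative
    partial j f x * g x + f x * partial j g x) (at 0)"
  using has_vector_derivative_mult[OF class_C_has_partial[OF assms(1), where x=x and j=j] class_C_has_partial[OF assms(2), where x=x and j=j]]
  by (simp add: add.commute)

lemma partial_mult:
  assumes "class_C (Suc k) f" "class_C (Suc l) g"
  shows "partial j (\<lambda>x. f x * g x) = (\<lambda>x. partial j f x * g x + f x * partial j g x)"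
  by (rule ext, rule partial_eqI, rule has_vector_derivative_mult_partial[OF assms])

lemma class_C_mult: "class_C k f \<Longrightarrow> class_C k g \<Longrightarrow> class_C k (\<lambda>x. f x * g x)"
proof (induction k arbitrary: f g)
  case (Suc k)
  have "class_C k f" "class_C k g"
    using Suc.prems class_C_SucD by blast+
  moreover have "class_C k (partial j f)" "class_C k (partial j g)" for j
    using Suc.prems by auto
  ultimately show ?case
    by (intro class_C_SucI[where f' = "\<lambda>j x. partial j f x * g x + f x * partial j g x"]
          has_vector_derivative_mult_partial[OF Suc.prems] class_C_add Suc.IH)
       (use Suc.prems in \<open>auto intro!: continuous_intros\<close>)
qed (auto intro!: continuous_intros)

lemma class_C_cmult: "class_C k f \<Longrightarrow> class_C k (\<lambda>x. c * f x)"
  by (intro class_C_mult class_C_const)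

lemma partial_cmult: "class_C (Suc k) f \<Longrightarrow> partial j (\<lambda>x. c * f x) = (\<lambda>x. c * partial j f x)"
proof -
  assume f: "class_C (Suc k) f"
  have "partial j (\<lambda>x. c) = (\<lambda>x. 0)"
    by (rule ext, rule partial_eqI) auto
  then show ?thesis
    using partial_mult[OF class_C_const f, of j c] by simp
qed

lemma class_C_diff: "class_C k f \<Longrightarrow> class_C k g \<Longrightarrow> class_C k (\<lambda>x. f x - g x)"
  using class_C_add[of k f "\<lambda>x. (-1) * g x"] class_C_cmult[of k g "-1"] by simp

lemma class_C_sum: "(\<And>i. i \<in> I \<Longrightarrow> class_C k (f i)) \<Longrightarrow> class_C k (\<lambda>x. \<Sum>i\<in>I. f i x)"
  by (induction I rule: infinite_finite_induct) (auto intro: class_C_add class_C_const)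

lemma has_vector_derivative_exp_partial:
  assumes "class_C (Suc k) f"
  shows "((\<lambda>t. exp (f (x + t *\<^sub>R axis j 1))) has_vector_derivative partial j f x * exp (f x)) (at 0)"
  using field_vector_diff_chain_at[OF class_C_has_partial[OF assms, of x j] DERIV_exp]
  by (simp add: o_def)

lemma partial_exp:
  "class_C (Suc k) f \<Longrightarrow> partial j (\<lambda>x. exp (f x)) = (\<lambda>x. partial j f x * exp (f x))"
  by (rule ext, rule partial_eqI, rule has_vector_derivative_exp_partial)

lemma class_C_exp: "class_C k f \<Longrightarrow> class_C k (\<lambda>x. exp (f x))"
proof (induction k arbitrary: f)
  case (Suc k)
  have "class_C k (\<lambda>x. exp (f x))"
    using Suc class_C_SucD by blast
  moreover have "class_C k (partial j f)" for j
    using Suc.prems by auto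
  ultimately show ?case
    by (intro class_C_SucI[where f' = "\<lambda>j x. partial j f x * exp (f x)"]
          has_vector_derivative_exp_partial[OF Suc.prems] class_C_mult)
       (use Suc.prems in \<open>auto intro!: continuous_intros\<close>)
qed (auto intro!: continuous_intros)

section \<open>Iterated derivatives along words of coordinates and their symmetry\<close>

lemma class_C_foldr_partial:
  "class_C (length w + k) f \<Longrightarrow> class_C k (foldr partial w f)"
proof (induction w arbitrary: k)
  case (Cons a w)
  have "class_C (Suc k) (foldr partial w f)"
    using Cons by (simp del: class_C.simps)
  then show ?case by simp
qed simp

lemma funpow_partial_eq_foldr: "partial j ^^ l = foldr partial (replicate l j)"
  by (induction l) auto

text \<open>Mean value inequality for f(x + t e_j) - t c. The free slope \<open>c\<close> serves two
  purposes: c close to the derivative measures how well a difference approximates it, and c = 0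
  gives plain growth bounds.\<close>

lemma norm_line_diff_le:
  assumes f: "class_C (Suc k) f" and "h \<ge> 0"
    and B: "\<And>t. 0 \<le> t \<Longrightarrow> t \<le> h \<Longrightarrow> norm (partial j f (x + t *\<^sub>R axis j 1) - c) \<le> B"
  shows "norm (f (x + h *\<^sub>R axis j 1) - f x - h *\<^sub>R c) \<le> h * B"
proof -
  let ?g = "\<lambda>t. f (x + t *\<^sub>R axis j 1) - t *\<^sub>R c"
  have d: "(?g has_derivative (\<lambda>s. s *\<^sub>R (partial j f (x + t *\<^sub>R axis j 1) - c))) (at t within {0..h})" for t
    using has_vector_derivative_diff[OF class_C_has_vector_derivative_line[OF f, of x j t "{0..h}"]
      has_vector_derivative_scaleR[OF DERIV_ident has_vector_derivative_const[of c]]]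
    by (simp add: has_vector_derivative_def scaleR_diff_right)
  have "norm (?g h - ?g 0) \<le> B * norm (h - 0)"
  proof (rule differentiable_bound[OF convex_real_interval(5) d])
    fix t assume "t \<in> {0..h}"
    then show "onorm (\<lambda>s. s *\<^sub>R (partial j f (x + t *\<^sub>R axis j 1) - c)) \<le> B"
      using B[of t] by (intro onorm_le) (auto simp: mult.commute[of B] mult_left_mono)
  qed (use \<open>h \<ge> 0\<close> in auto)
  then show ?thesis using \<open>h \<ge> 0\<close> by (simp add: algebra_simps)
qed

text \<open>The mixed difference is symmetric in \<open>i\<close> and \<open>j\<close>, hence so is its limit.\<close>

lemma mixed_difference_tendsto:
  assumes f: "class_C 2 f"
  shows "((\<lambda>h. (f (x + h *\<^sub>R axis i 1 + h *\<^sub>R axis j 1) - f (x + h *\<^sub>R axis j 1)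
      - f (x + h *\<^sub>R axis i 1) + f x) /\<^sub>R h\<^sup>2) \<longlongrightarrow> partial i (partial j f) x) (at_right 0)"
proof (rule tendstoI)
  fix e :: real assume "e > 0"
  define c where "c = partial i (partial j f) x"
  have f1: "class_C (Suc (Suc 0)) f" using f by (simp add: numeral_2_eq_2)
  then have fj: "class_C (Suc 0) (partial j f)" by simp
  then have "continuous_on UNIV (partial i (partial j f))" by simp
  then have "isCont (partial i (partial j f)) x"
    by (simp add: continuous_on_eq_continuous_at)
  then obtain d where "d > 0" and d: "\<And>y. dist y x < d \<Longrightarrow> dist (partial i (partial j f) y) c < e/2"
    unfolding c_def using \<open>e > 0\<close> by (metis continuous_at_eps_delta half_gt_zero)
  \<comment> \<open>Every point x + t e_j + s e_i with 0 \<le> s, t \<le> h must stay within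
    distance t + s < d of x.\<close>
  have "\<forall>\<^sub>F h in at_right 0. h \<in> {0<..<d/2}"
    using \<open>d > 0\<close> by (intro eventually_at_right_real) auto
  then show "\<forall>\<^sub>F h in at_right 0. dist ((f (x + h *\<^sub>R axis i 1 + h *\<^sub>R axis j 1) - f (x + h *\<^sub>R axis j 1)
      - f (x + h *\<^sub>R axis i 1) + f x) /\<^sub>R h\<^sup>2) c < e"
  proof eventually_elim
    case (elim h)
    have in1: "norm ((partial j f (x + t *\<^sub>R axis j 1 + h *\<^sub>R axis i 1) - partial j f (x + t *\<^sub>R axis j 1)) - h *\<^sub>R c)
       \<le> h * (e/2)" if "0 \<le> t" "t \<le> h" for t
    proof (rule norm_line_diff_le[OF fj])
      fix s assume "0 \<le> s" "s \<le> h"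
      have "norm (t *\<^sub>R axis j (1::real) + s *\<^sub>R axis i 1) \<le> t + s"
        by (rule order.trans[OF norm_triangle_ineq]) (use that \<open>0 \<le> s\<close> in \<open>simp add: norm_axis_1\<close>)
      then have "dist (x + t *\<^sub>R axis j 1 + s *\<^sub>R axis i 1) x < d"
        using that \<open>s \<le> h\<close> elim by (simp add: dist_norm add.assoc)
      from d[OF this] show "norm (partial i (partial j f) (x + t *\<^sub>R axis j 1 + s *\<^sub>R axis i 1) - c) \<le> e/2"
        by (simp add: dist_norm)
    qed (use elim in auto)
    \<comment> \<open>The mixed difference is the increment of \<open>g\<close> in direction j. The
      slope of \<open>g\<close> in that direction is an increment of \<open>partial j f\<close> in
      direction i, which \<open>in1\<close> compares with h c.\<close>
    define g where "g = (\<lambda>y. f (y + h *\<^sub>R axis i 1) - f y)"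
    have pg: "((\<lambda>t. g (y + t *\<^sub>R axis k 1)) has_vector_derivative
        partial k f (y + h *\<^sub>R axis i 1) - partial k f y) (at 0)" for y k
      unfolding g_def
      using has_vector_derivative_diff[OF class_C_has_partial[OF f1, of "y + h *\<^sub>R axis i 1" k] class_C_has_partial[OF f1, of y k]]
      by (simp add: algebra_simps)
    have "class_C (Suc 0) g"
    proof (rule class_C_SucI[OF _ pg])
      have shift: "continuous_on UNIV (\<lambda>y. u (y + z))" if "continuous_on UNIV u" for u :: "real^'a \<Rightarrow> complex" and z
        by (rule continuous_on_compose2[OF that]) (auto intro!: continuous_intros)
      have f: "continuous_on UNIV f" and pf: "continuous_on UNIV (partial k f)" for k
        using f1 by auto
      show "continuous_on UNIV g"
        unfolding g_def by (intro continuous_on_diff shift f)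
      show "class_C 0 (\<lambda>y. partial k f (y + h *\<^sub>R axis i 1) - partial k f y)" for k
        by (simp, intro continuous_on_diff shift pf)
    qed
    then have "norm (g (x + h *\<^sub>R axis j 1) - g x - h *\<^sub>R (h *\<^sub>R c)) \<le> h * (h * (e/2))"
      by (rule norm_line_diff_le) (use elim in1 in \<open>simp_all only: partial_eqI[OF pg] greaterThanLessThan_iff\<close>, simp)
    then have *: "norm (g (x + h *\<^sub>R axis j 1) - g x - h\<^sup>2 *\<^sub>R c) \<le> h\<^sup>2 * (e/2)"
      by (simp add: power2_eq_square)
    have "g (x + h *\<^sub>R axis j 1) - g x = f (x + h *\<^sub>R axis i 1 + h *\<^sub>R axis j 1) - f (x + h *\<^sub>R axis j 1)
      - f (x + h *\<^sub>R axis i 1) + f x" (is "_ = ?D")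
      unfolding g_def by (simp add: algebra_simps)
    then have "?D /\<^sub>R h\<^sup>2 - c = (g (x + h *\<^sub>R axis j 1) - g x - h\<^sup>2 *\<^sub>R c) /\<^sub>R h\<^sup>2"
      using elim by (simp add: scaleR_diff_right)
    then have "norm (?D /\<^sub>R h\<^sup>2 - c) \<le> e/2"
      using * elim by (simp add: divide_simps mult.commute)
    then show ?case using \<open>e > 0\<close> by (simp add: dist_norm)
  qed
qed

lemma partial_commute:
  assumes "class_C 2 f"
  shows "partial i (partial j f) = partial j (partial i f)"
proof
  fix x
  have "((\<lambda>h. (f (x + h *\<^sub>R axis i 1 + h *\<^sub>R axis j 1) - f (x + h *\<^sub>R axis j 1)
      - f (x + h *\<^sub>R axis i 1) + f x) /\<^sub>R h\<^sup>2) \<longlongrightarrow> partial j (partial i f) x) (at_right 0)"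
    using mixed_difference_tendsto[OF assms, of x j i] by (simp add: algebra_simps)
  from tendsto_unique[OF _ mixed_difference_tendsto[OF assms] this]
  show "partial i (partial j f) x = partial j (partial i f) x"
    by simp
qed

lemma foldr_partial_move:
  assumes "class_C (Suc (length v)) f"
  shows "foldr partial v (partial a f) = partial a (foldr partial v f)"
  using assms
proof (induction v)
  case (Cons b v)
  have "class_C 2 (foldr partial v f)"
    using Cons.prems by (intro class_C_foldr_partial) (simp add: numeral_2_eq_2)
  then show ?case
    using Cons class_C_SucD[OF Cons.prems] by (simp add: partial_commute)
qed simp

text \<open>The first letter of \<open>w\<close> also occurs in \<open>w'\<close>; it is commuted to
  the front there, and the remaining words have equal multisets.\<close>

lemma foldr_partial_mset_eq:
  assumes "class_C (length w) f" "mset w = mset w'"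
  shows "foldr partial w f = foldr partial w' f"
  using assms
proof (induction w arbitrary: w')
  case (Cons a u)
  then have "a \<in> set w'"
    by (metis list.set_intros(1) set_mset_mset)
  then obtain v v' where w': "w' = v @ a # v'"
    by (meson split_list)
  with Cons.prems have m: "mset u = mset (v @ v')" by simp
  then have len: "length u = length v + length v'"
    by (metis mset_eq_length length_append)
  have "class_C (Suc (length v)) (foldr partial v' f)"
    using Cons.prems len by (intro class_C_foldr_partial) (simp add: add.commute)
  then have "foldr partial w' f = partial a (foldr partial (v @ v') f)"
    unfolding w' by (simp add: foldr_partial_move)
  also have "foldr partial (v @ v') f = foldr partial u f"
    using Cons.IH[OF _ m] Cons.prems(1) class_C_SucD by (metis length_Cons)
  finally show ?case by simp
qed simp

text \<open>Inductions run over words of coordinates rather than over multi-indices, since one more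
  derivative is one more letter. This map sends a word to its multi-index and so leads back to
  \<open>mi_partial\<close>.\<close>

definition mi_count :: "'d list \<Rightarrow> nat ^ 'd" where
  "mi_count w = (\<chi> j. count_list w j)"

lemma foldr_funpow_partial:
  "foldr (\<lambda>j. partial j ^^ (n j)) js f = foldr partial (concat (map (\<lambda>j. replicate (n j) j) js)) f"
proof (induction js)
  case (Cons a js)
  have "(partial a ^^ k) g = foldr partial (replicate k a) g" for k g
    by (induction k) auto
  with Cons show ?case by simp
qed simp

lemma mi_abs_mi_count: "mi_abs (mi_count w) = length w"
proof -
  have "(\<Sum>j\<in>UNIV. count_list w j) = (\<Sum>j\<in>set w. count_list w j)"
    by (rule sum.mono_neutral_right) (auto simp: count_list_0_iff)
  then show ?thesis
    by (simp add: mi_abs_def mi_count_def sum_count_set)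
qed

text \<open>By symmetry of mixed derivatives the enumeration chosen inside \<open>mi_partial\<close>
  is immaterial: its word and \<open>w\<close> have the same multiset.\<close>

lemma mi_partial_mi_count:
  assumes "class_C (length w) f"
  shows "mi_partial (mi_count w) f = foldr partial w f"
proof -
  define js where "js = (SOME js. distinct js \<and> set js = (UNIV :: 'a set))"
  have "\<exists>js. distinct js \<and> set js = (UNIV :: 'a set)"
    using finite_distinct_list[of "UNIV :: 'a set"] by auto
  then have js: "distinct js" "set js = UNIV"
    unfolding js_def by (metis (mono_tags, lifting) someI_ex)+
  define v where "v = concat (map (\<lambda>j. replicate (count_list w j) j) js)"
  have "count (mset (concat (map (\<lambda>j. replicate (c j) j) js))) a = (if a \<in> set js then c a else 0)" for a c
    using js(1) by (induction js) auto
  then have "mset w = mset v"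
    unfolding v_def by (intro multiset_eqI) (simp add: js count_mset)
  then have "foldr partial w f = foldr partial v f"
    by (rule foldr_partial_mset_eq[OF assms])
  then show ?thesis
    unfolding mi_partial_def js_def[symmetric] foldr_funpow_partial v_def mi_count_def by simp
qed

section \<open>Taylor bounds on the torus\<close>

lemma norm_line_diff_abs_le:
  assumes f: "class_C (Suc k) f"
    and B: "\<And>t. \<bar>t\<bar> \<le> \<bar>h\<bar> \<Longrightarrow> t * h \<ge> 0 \<Longrightarrow> norm (partial j f (x + t *\<^sub>R axis j 1)) \<le> B"
  shows "norm (f (x + h *\<^sub>R axis j 1) - f x) \<le> \<bar>h\<bar> * B"
proof (cases "h \<ge> 0")
  case True
  show ?thesis
    using norm_line_diff_le[OF f True, of j x 0 B] B True by simp
next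
  case False
  have "norm (f (x + h *\<^sub>R axis j 1 + (- h) *\<^sub>R axis j 1) - f (x + h *\<^sub>R axis j 1) - (- h) *\<^sub>R 0) \<le> (- h) * B"
  proof (rule norm_line_diff_le[OF f])
    fix t assume "0 \<le> t" "t \<le> - h"
    then show "norm (partial j f (x + h *\<^sub>R axis j 1 + t *\<^sub>R axis j 1) - 0) \<le> B"
      using B[of "h + t"] False by (simp add: scaleR_add_left add.assoc mult_nonpos_nonpos)
  qed (use False in simp)
  then show ?thesis using False by (simp add: norm_minus_commute)
qed

text \<open>The origin is joined to \<xi> by switching on one coordinate at a time. The path stays
  in the box spanned by |\<xi>_i|, hence in the torus whenever \<xi> does.\<close>

lemma norm_diff_origin_le:
  assumes f: "class_C (Suc k) f"
    and B: "\<And>j y. (\<And>i. \<bar>y $ i\<bar> \<le> \<bar>\<xi> $ i\<bar>) \<Longrightarrow> norm (partial j f y) \<le> B"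
  shows "norm (f \<xi> - f 0) \<le> B * (\<Sum>j\<in>UNIV. \<bar>\<xi> $ j\<bar>)"
proof -
  have "norm (f (\<chi> i. if i \<in> S then \<xi> $ i else 0) - f 0) \<le> B * (\<Sum>j\<in>S. \<bar>\<xi> $ j\<bar>)" if "finite S" for S
    using that
  proof (induction S)
    case empty
    then show ?case by (simp flip: zero_vec_def)
  next
    case (insert j S)
    define x where "x = (\<chi> i. if i \<in> S then \<xi> $ i else 0)"
    have x': "(\<chi> i. if i \<in> insert j S then \<xi> $ i else 0) = x + (\<xi> $ j) *\<^sub>R axis j 1"
      using insert(2) by (auto simp: x_def vec_eq_iff axis_def)
    have "norm (f (x + (\<xi> $ j) *\<^sub>R axis j 1) - f x) \<le> \<bar>\<xi> $ j\<bar> * B"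
    proof (rule norm_line_diff_abs_le[OF f])
      fix t assume "\<bar>t\<bar> \<le> \<bar>\<xi> $ j\<bar>"
      then show "norm (partial j f (x + t *\<^sub>R axis j 1)) \<le> B"
        using insert(2) by (intro B) (auto simp: x_def axis_def)
    qed
    moreover have "norm (f x - f 0) \<le> B * (\<Sum>j\<in>S. \<bar>\<xi> $ j\<bar>)"
      using insert x_def by simp
    ultimately have "norm (f (x + (\<xi> $ j) *\<^sub>R axis j 1) - f 0) \<le> \<bar>\<xi> $ j\<bar> * B + B * (\<Sum>j\<in>S. \<bar>\<xi> $ j\<bar>)"
      using norm_triangle_ineq[of "f (x + (\<xi> $ j) *\<^sub>R axis j 1) - f x" "f x - f 0"] by simp
    then show ?case
      unfolding x' using insert by (simp add: algebra_simps)
  qed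
  from this[of UNIV] show ?thesis by simp
qed

lemma norm_le_of_abs_le:
  fixes x y :: "real ^ 'd"
  shows "(\<And>i. \<bar>y $ i\<bar> \<le> \<bar>x $ i\<bar>) \<Longrightarrow> norm y \<le> norm x"
  by (rule norm_le_componentwise_cart) simp

text \<open>Downward induction on the order of the derivative. A derivative that vanishes at 0 is
  controlled by its own partial derivatives along the path from 0 to \<xi>; this costs a factor
  \<open>CARD('d)\<close> and gains one power of |\<xi>|.\<close>

lemma foldr_partial_taylor_bound:
  fixes h :: "real ^ 'd \<Rightarrow> complex"
  assumes h: "class_C K h" and "C \<ge> 0"
    and top: "\<And>w \<xi>. length w = K \<Longrightarrow> \<xi> \<in> torus \<Longrightarrow> norm (foldr partial w h \<xi>) \<le> C * norm \<xi> ^ s"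
    and low: "\<And>w. length w < K \<Longrightarrow> foldr partial w h 0 = 0"
    and "length w \<le> K" "\<xi> \<in> torus"
  shows "norm (foldr partial w h \<xi>) \<le> C * real CARD('d) ^ (K - length w) * norm \<xi> ^ (s + (K - length w))"
proof -
  have "\<forall>w \<xi>. length w = l \<longrightarrow> \<xi> \<in> torus \<longrightarrow> norm (foldr partial w h \<xi>)
      \<le> C * real CARD('d) ^ (K - l) * norm \<xi> ^ (s + (K - l))" if "l \<le> K" for l
    using that
  proof (induction rule: inc_induct)
    case base
    then show ?case using top by simp
  next
    case (step l)
    define m where "m = K - Suc l"
    have Kl: "K - l = Suc m" using step by (simp add: m_def)
    show ?case
    proof (intro allI impI)
      fix w :: "'d list" and \<xi> :: "real ^ 'd"
      assume w: "length w = l" and \<xi>: "\<xi> \<in> torus"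
      have g: "class_C (Suc m) (foldr partial w h)"
        using h step w Kl by (intro class_C_foldr_partial) (metis add.commute le_add_diff_inverse2 less_imp_le)
      have "norm (foldr partial w h \<xi> - foldr partial w h 0)
          \<le> C * real CARD('d) ^ m * norm \<xi> ^ (s + m) * (\<Sum>j\<in>UNIV. \<bar>\<xi> $ j\<bar>)"
      proof (rule norm_diff_origin_le[OF g])
        fix j and y :: "real ^ 'd" assume y: "\<And>i. \<bar>y $ i\<bar> \<le> \<bar>\<xi> $ i\<bar>"
        then have "y \<in> torus" using \<xi> unfolding torus_def by (auto intro: order.trans)
        then have "norm (partial j (foldr partial w h) y) \<le> C * real CARD('d) ^ m * norm y ^ (s + m)"
          using step.IH[rule_format, of "j # w" y] w by (simp add: m_def)
        also have "\<dots> \<le> C * real CARD('d) ^ m * norm \<xi> ^ (s + m)"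
          using norm_le_of_abs_le[OF y] \<open>C \<ge> 0\<close> by (intro mult_left_mono power_mono) auto
        finally show "norm (partial j (foldr partial w h) y) \<le> \<dots>" .
      qed
      also have "\<dots> \<le> C * real CARD('d) ^ m * norm \<xi> ^ (s + m) * (real CARD('d) * norm \<xi>)"
      proof (rule mult_left_mono)
        show "(\<Sum>j\<in>UNIV. \<bar>\<xi> $ j\<bar>) \<le> real CARD('d) * norm \<xi>"
          using sum_bounded_above[of UNIV "\<lambda>j. \<bar>\<xi> $ j\<bar>" "norm \<xi>"] component_le_norm_cart by auto
      qed (use \<open>C \<ge> 0\<close> in auto)
      also have "foldr partial w h 0 = 0" using low w step by simp
      finally show "norm (foldr partial w h \<xi>) \<le> C * real CARD('d) ^ (K - l) * norm \<xi> ^ (s + (K - l))"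
        by (simp add: Kl algebra_simps)
    qed
  qed
  then show ?thesis using assms by blast
qed

section \<open>Linearity of iterated derivatives; monomials and homogeneous polynomials\<close>

lemma foldr_partial_add:
  "class_C (length w + k) f \<Longrightarrow> class_C (length w + k) g \<Longrightarrow>
    foldr partial w (\<lambda>x. f x + g x) = (\<lambda>x. foldr partial w f x + foldr partial w g x)"
proof (induction w arbitrary: k)
  case (Cons a w)
  have "class_C (Suc k) (foldr partial w f)" "class_C (Suc k) (foldr partial w g)"
    using Cons.prems by (auto intro!: class_C_foldr_partial simp del: class_C.simps)
  from partial_add[OF this, of a] show ?case
    using Cons.IH[of "Suc k"] Cons.prems by (simp del: class_C.simps)
qed simp

lemma foldr_partial_cmult:
  "class_C (length w + k) f \<Longrightarrow> foldr partial w (\<lambda>x. c * f x) = (\<lambda>x. c * foldr partial w f x)"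
proof (induction w arbitrary: k)
  case (Cons a w)
  have "class_C (Suc k) (foldr partial w f)"
    using Cons.prems by (auto intro!: class_C_foldr_partial simp del: class_C.simps)
  from partial_cmult[OF this, of a] show ?case
    using Cons.IH[of "Suc k"] Cons.prems by (simp del: class_C.simps)
qed simp

lemma foldr_partial_diff:
  assumes "class_C (length w) f" "class_C (length w) g"
  shows "foldr partial w (\<lambda>x. f x - g x) = (\<lambda>x. foldr partial w f x - foldr partial w g x)"
  using foldr_partial_add[of w 0 f "\<lambda>x. (-1) * g x"] foldr_partial_cmult[of w 0 g "-1"]
    class_C_cmult[of "length w" g "-1"] assms by simp

lemma foldr_partial_sum:
  assumes "\<And>i. i \<in> I \<Longrightarrow> class_C (length w) (f i)"
  shows "foldr partial w (\<lambda>x. \<Sum>i\<in>I. f i x) = (\<lambda>x. \<Sum>i\<in>I. foldr partial w (f i) x)"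
  using assms
proof (induction I rule: infinite_finite_induct)
  case (insert i I)
  then show ?case
    using foldr_partial_add[of w 0 "f i" "\<lambda>x. \<Sum>i\<in>I. f i x"] by (simp add: class_C_sum)
qed (use foldr_partial_cmult[of w 0 "\<lambda>_. 0" 0] class_C_const in auto)

text \<open>The subtraction of multi-indices is truncated. If \<alpha>_j = 0 it leaves \<alpha>
  unchanged, but then the factor \<open>of_nat (\<alpha> $ j)\<close> is 0.\<close>

lemma has_vector_derivative_i_monom:
  "((\<lambda>t. i_monom (\<xi> + t *\<^sub>R axis j 1) \<alpha>) has_vector_derivative
     \<i> * of_nat (\<alpha> $ j) * i_monom \<xi> (\<alpha> - axis j 1)) (at 0)"
proof -
  define c where "c = (\<Prod>i\<in>UNIV - {j}. (\<i> * of_real (\<xi> $ i)) ^ (\<alpha> $ i))"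
  have 1: "i_monom (\<xi> + t *\<^sub>R axis j 1) \<alpha> = (\<i> * of_real (\<xi> $ j + t)) ^ (\<alpha> $ j) * c" for t
    unfolding i_monom_def c_def by (subst prod.remove[of _ j]) (auto simp: axis_def intro!: prod.cong)
  have 2: "i_monom \<xi> (\<alpha> - axis j 1) = (\<i> * of_real (\<xi> $ j)) ^ (\<alpha> $ j - 1) * c"
    unfolding i_monom_def c_def by (subst prod.remove[of _ j]) (auto simp: axis_def intro!: prod.cong)
  have lin: "((\<lambda>t. \<i> * of_real (\<xi> $ j + t)) has_vector_derivative \<i>) (at 0)"
    by (auto intro!: derivative_eq_intros)
  have pow: "((\<lambda>z. z ^ (\<alpha> $ j)) has_field_derivative
      of_nat (\<alpha> $ j) * (\<i> * of_real (\<xi> $ j + 0)) ^ (\<alpha> $ j - 1)) (at (\<i> * of_real (\<xi> $ j + 0)))"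
    by (auto intro!: derivative_eq_intros)
  have "((\<lambda>t. (\<i> * of_real (\<xi> $ j + t)) ^ (\<alpha> $ j) * c) has_vector_derivative
      \<i> * (of_nat (\<alpha> $ j) * (\<i> * of_real (\<xi> $ j + 0)) ^ (\<alpha> $ j - 1)) * c) (at 0)"
    using has_vector_derivative_mult_left[OF field_vector_diff_chain_at[OF lin pow], of c]
    by (simp add: o_def)
  then show ?thesis unfolding 1 2 by (simp add: mult.assoc)
qed

lemma partial_i_monom:
  "partial j (\<lambda>\<xi>. i_monom \<xi> \<alpha>) = (\<lambda>\<xi>. \<i> * of_nat (\<alpha> $ j) * i_monom \<xi> (\<alpha> - axis j 1))"
  by (rule ext, rule partial_eqI, rule has_vector_derivative_i_monom)

lemma continuous_on_i_monom: "continuous_on UNIV (\<lambda>\<xi>. i_monom \<xi> \<alpha>)"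
  unfolding i_monom_def by (intro continuous_intros)

lemma class_C_i_monom: "class_C k (\<lambda>\<xi>. i_monom \<xi> \<alpha>)"
proof (induction k arbitrary: \<alpha>)
  case 0
  then show ?case by (simp add: continuous_on_i_monom)
next
  case (Suc k)
  show ?case
    by (rule class_C_SucI[OF continuous_on_i_monom has_vector_derivative_i_monom])
       (intro class_C_mult class_C_const Suc)
qed

lemma mi_fact_nonzero [simp]: "mi_fact \<alpha> \<noteq> 0"
  by (simp add: mi_fact_def)

lemma mi_fact_add_axis: "mi_fact (\<rho> + axis j 1) = of_nat (Suc (\<rho> $ j)) * mi_fact \<rho>"
proof -
  define c where "c = (\<Prod>i\<in>UNIV - {j}. fact (\<rho> $ i) :: complex)"
  have "mi_fact (\<rho> + axis j 1) = fact (\<rho> $ j + 1) * c"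
    unfolding mi_fact_def c_def by (subst prod.remove[of _ j]) (auto simp: axis_def intro!: prod.cong)
  moreover have "mi_fact \<rho> = fact (\<rho> $ j) * c"
    unfolding mi_fact_def c_def by (subst prod.remove[of _ j]) auto
  ultimately show ?thesis by simp
qed

lemma mi_count_Nil [simp]: "mi_count [] = 0"
  by (simp add: mi_count_def vec_eq_iff)

lemma mi_count_Cons: "mi_count (a # w) = axis a 1 + mi_count w"
  by (auto simp: mi_count_def axis_def vec_eq_iff)

text \<open>Writing the exponent as \<open>\<rho> + mi_count w\<close> keeps truncated subtraction
  out of the result and produces the quotient of factorials that occurs in
  \<open>deriv_expansion\<close>.\<close>

lemma foldr_partial_i_monom:
  "foldr partial w (\<lambda>\<xi>. i_monom \<xi> (\<rho> + mi_count w)) =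
    (\<lambda>\<xi>. \<i> ^ length w * (mi_fact (\<rho> + mi_count w) / mi_fact \<rho>) * i_monom \<xi> \<rho>)"
proof (induction w arbitrary: \<rho>)
  case Nil
  show ?case by simp
next
  case (Cons a w)
  define c where "c = \<i> ^ length w * (mi_fact (\<rho> + axis a 1 + mi_count w) / mi_fact (\<rho> + axis a 1))"
  have r: "\<rho> + mi_count (a # w) = \<rho> + axis a 1 + mi_count w"
    by (simp add: mi_count_Cons add.assoc)
  have m: "\<rho> + axis a 1 - axis a 1 = \<rho>"
    by (simp add: vec_eq_iff)
  have ra: "(\<rho> + axis a 1) $ a = Suc (\<rho> $ a)"
    by (simp add: axis_def)
  have "foldr partial (a # w) (\<lambda>\<xi>. i_monom \<xi> (\<rho> + mi_count (a # w)))
      = partial a (\<lambda>\<xi>. c * i_monom \<xi> (\<rho> + axis a 1))"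
    unfolding r c_def by (simp add: Cons.IH)
  also have "\<dots> = (\<lambda>\<xi>. c * (\<i> * of_nat (Suc (\<rho> $ a)) * i_monom \<xi> \<rho>))"
    by (subst partial_cmult[OF class_C_i_monom]) (simp only: partial_i_monom m ra)
  also have "\<dots> = (\<lambda>\<xi>. \<i> ^ length (a # w) * (mi_fact (\<rho> + mi_count (a # w)) / mi_fact \<rho>) * i_monom \<xi> \<rho>)"
    unfolding r c_def mi_fact_add_axis by (auto simp: field_simps simp del: of_nat_Suc)
  finally show ?case .
qed

text \<open>Some letter occurs in \<open>w\<close> more often than \<alpha> allows, so one of the
  derivatives meets an exponent that has already dropped to 0.\<close>

lemma foldr_partial_i_monom_eq_0:
  assumes "\<nexists>\<rho>. \<alpha> = \<rho> + mi_count w"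
  shows "foldr partial w (\<lambda>\<xi>. i_monom \<xi> \<alpha>) = (\<lambda>_. 0)"
  using assms
proof (induction w)
  case Nil
  then show ?case by (metis add.right_neutral mi_count_Nil)
next
  case (Cons a w)
  show ?case
  proof (cases "\<exists>\<rho>. \<alpha> = \<rho> + mi_count w")
    case False
    have "partial a (\<lambda>_::real^'a. 0) = (\<lambda>_. 0)"
      by (rule ext, rule partial_eqI) auto
    with Cons False show ?thesis by simp
  next
    case True
    then obtain \<rho> where \<rho>: "\<alpha> = \<rho> + mi_count w" by blast
    have "\<rho> $ a = 0"
    proof (rule ccontr)
      assume "\<rho> $ a \<noteq> 0"
      then have "\<rho> = \<rho> - axis a 1 + axis a 1"
        by (auto simp: vec_eq_iff axis_def)
      then have "\<alpha> = \<rho> - axis a 1 + mi_count (a # w)"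
        unfolding mi_count_Cons \<rho> by (metis add.assoc)
      with Cons.prems show False by blast
    qed
    then have "partial a (\<lambda>\<xi>. c * i_monom \<xi> \<rho>) = (\<lambda>_. 0)" for c
      by (simp add: partial_cmult[OF class_C_i_monom] partial_i_monom)
    then show ?thesis
      unfolding \<rho> by (simp only: foldr_Cons o_apply foldr_partial_i_monom)
  qed
qed

lemma finite_mi_abs_eq: "finite {\<alpha> :: nat ^ 'd. mi_abs \<alpha> = c}"
proof (rule finite_subset)
  show "{\<alpha> :: nat ^ 'd. mi_abs \<alpha> = c} \<subseteq> vec_lambda ` (UNIV \<rightarrow>\<^sub>E {..c})"
  proof
    fix \<alpha> :: "nat ^ 'd" assume "\<alpha> \<in> {\<alpha>. mi_abs \<alpha> = c}"
    then have "\<alpha> $ j \<le> c" for j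
      unfolding mi_abs_def by (metis (mono_tags, lifting) UNIV_I finite_class.finite_UNIV mem_Collect_eq member_le_sum zero_le)
    then have "vec_nth \<alpha> \<in> UNIV \<rightarrow>\<^sub>E {..c}" by auto
    then show "\<alpha> \<in> vec_lambda ` (UNIV \<rightarrow>\<^sub>E {..c})"
      by (metis image_eqI vec_nth_inverse)
  qed
qed (intro finite_imageI finite_PiE, auto)

lemma mi_abs_add: "mi_abs (\<alpha> + \<beta>) = mi_abs \<alpha> + mi_abs \<beta>"
  by (simp add: mi_abs_def sum.distrib)

lemma norm_i_monom_le: "norm (i_monom \<xi> \<rho>) \<le> norm \<xi> ^ mi_abs \<rho>"
proof -
  have "norm (i_monom \<xi> \<rho>) = (\<Prod>j\<in>UNIV. \<bar>\<xi> $ j\<bar> ^ (\<rho> $ j))"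
    by (simp add: i_monom_def norm_mult norm_power flip: prod_norm)
  also have "\<dots> \<le> (\<Prod>j\<in>UNIV. norm \<xi> ^ (\<rho> $ j))"
    by (intro prod_mono conjI power_mono component_le_norm_cart) auto
  finally show ?thesis
    by (simp add: mi_abs_def power_sum)
qed

text \<open>Homogeneous of degree q in i \<xi>. With q = r + 1 and the coefficients
  \<open>\<beta>\<^sub>n n\<close> it is the leading term at 0 of the difference of the
  residues.\<close>

definition i_poly :: "nat \<Rightarrow> (nat ^ 'd \<Rightarrow> complex) \<Rightarrow> real ^ 'd \<Rightarrow> complex" where
  "i_poly q b \<xi> = (\<Sum>\<alpha> | mi_abs \<alpha> = q. b \<alpha> * i_monom \<xi> \<alpha>)"

lemma class_C_i_poly: "class_C k (i_poly q b)"
  unfolding i_poly_def[abs_def] by (intro class_C_sum class_C_cmult class_C_i_monom)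

lemma norm_i_poly_le:
  "norm (i_poly q b \<xi>) \<le> (\<Sum>\<alpha> | mi_abs \<alpha> = q. norm (b \<alpha>)) * norm \<xi> ^ q"
proof -
  have "norm (i_poly q b \<xi>) \<le> (\<Sum>\<alpha> | mi_abs \<alpha> = q. norm (b \<alpha> * i_monom \<xi> \<alpha>))"
    unfolding i_poly_def by (rule norm_sum)
  also have "\<dots> \<le> (\<Sum>\<alpha> | mi_abs \<alpha> = q. norm (b \<alpha>) * norm \<xi> ^ q)"
    using norm_i_monom_le by (intro sum_mono) (auto simp: norm_mult intro!: mult_left_mono)
  finally show ?thesis by (simp add: sum_distrib_right)
qed

text \<open>Only the monomials whose exponent contains \<open>mi_count w\<close> survive, and
  reindexing them by the remaining exponent \<rho> gives the sums of
  \<open>deriv_expansion\<close>.\<close>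

lemma foldr_partial_i_poly:
  fixes b :: "nat ^ 'd \<Rightarrow> complex"
  assumes "length w \<le> q"
  shows "foldr partial w (i_poly q b) =
    i_poly (q - length w) (\<lambda>\<rho>. \<i> ^ length w * (b (\<rho> + mi_count w) * (mi_fact (\<rho> + mi_count w) / mi_fact \<rho>)))"
proof
  fix \<xi> :: "real ^ 'd"
  let ?\<delta> = "mi_count w"
  let ?g = "\<lambda>\<alpha>. foldr partial w (\<lambda>\<xi>. i_monom \<xi> \<alpha>) \<xi>"
  have "foldr partial w (i_poly q b) \<xi> = (\<Sum>\<alpha> | mi_abs \<alpha> = q. b \<alpha> * ?g \<alpha>)"
    unfolding i_poly_def[abs_def]
    by (subst foldr_partial_sum)
       (auto intro!: class_C_cmult class_C_i_monom simp: foldr_partial_cmult[where k = 0] class_C_i_monom)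
  also have "\<dots> = (\<Sum>\<alpha>\<in>(\<lambda>\<rho>. \<rho> + ?\<delta>) ` {\<rho>. mi_abs \<rho> = q - length w}. b \<alpha> * ?g \<alpha>)"
  proof (rule sum.mono_neutral_right[OF finite_mi_abs_eq])
    show "(\<lambda>\<rho>. \<rho> + ?\<delta>) ` {\<rho>. mi_abs \<rho> = q - length w} \<subseteq> {\<alpha>. mi_abs \<alpha> = q}"
      using assms by (auto simp: mi_abs_add mi_abs_mi_count)
    show "\<forall>\<alpha>\<in>{\<alpha>. mi_abs \<alpha> = q} - (\<lambda>\<rho>. \<rho> + ?\<delta>) ` {\<rho>. mi_abs \<rho> = q - length w}. b \<alpha> * ?g \<alpha> = 0"
    proof
      fix \<alpha> assume \<alpha>: "\<alpha> \<in> {\<alpha>. mi_abs \<alpha> = q} - (\<lambda>\<rho>. \<rho> + ?\<delta>) ` {\<rho>. mi_abs \<rho> = q - length w}"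
      have "\<nexists>\<rho>. \<alpha> = \<rho> + ?\<delta>"
      proof
        assume "\<exists>\<rho>. \<alpha> = \<rho> + ?\<delta>"
        then obtain \<rho> where "\<alpha> = \<rho> + ?\<delta>" by blast
        moreover from this \<alpha> have "mi_abs \<rho> = q - length w"
          by (auto simp: mi_abs_add mi_abs_mi_count)
        ultimately show False using \<alpha> by auto
      qed
      then show "b \<alpha> * ?g \<alpha> = 0" by (simp add: foldr_partial_i_monom_eq_0)
    qed
  qed
  also have "\<dots> = (\<Sum>\<rho> | mi_abs \<rho> = q - length w. b (\<rho> + ?\<delta>) * ?g (\<rho> + ?\<delta>))"
    by (subst sum.reindex) (auto simp: inj_on_def)
  finally show "foldr partial w (i_poly q b) \<xi> =
    i_poly (q - length w) (\<lambda>\<rho>. \<i> ^ length w * (b (\<rho> + ?\<delta>) * (mi_fact (\<rho> + ?\<delta>) / mi_fact \<rho>))) \<xi>"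
    by (simp add: foldr_partial_i_monom i_poly_def mult_ac)
qed

lemma foldr_partial_i_poly_0:
  assumes "length w < q"
  shows "foldr partial w (i_poly q b) 0 = 0"
  using norm_i_poly_le[of "q - length w" _ 0] assms
  by (simp add: foldr_partial_i_poly power_0_left)

section \<open>Uniform Taylor bounds from the expansion of the top derivatives\<close>

lemma norm_torus_le: "\<xi> \<in> torus \<Longrightarrow> norm (\<xi> :: real ^ 'd) \<le> pi * real CARD('d)"
  using norm_le_l1_cart[of \<xi>] sum_bounded_above[of UNIV "\<lambda>j. \<bar>\<xi> $ j\<bar>" pi]
  unfolding torus_def by (auto simp: mult.commute)

text \<open>The first sum in \<open>deriv_expansion\<close> is a derivative of
  \<open>i_poly (r + 1) (\<beta> n)\<close>, so subtracting this polynomial leaves derivatives of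
  order K of size |\<xi>|^(r + 2 - K). The lower derivatives vanish at 0 both before and after the
  subtraction, and ascending from order K gives the two estimates. Bounded coefficients and
  remainder functions make \<open>C\<close> independent of n.\<close>

lemma deriv_expansion_bounds:
  fixes f :: "nat \<Rightarrow> real ^ 'd \<Rightarrow> complex"
  assumes K: "K \<le> r + 1" and f: "\<And>n. class_C K (f n)"
    and van: "\<And>n \<delta>. mi_abs \<delta> < K \<Longrightarrow> mi_partial \<delta> (f n) 0 = 0"
    and ex: "deriv_expansion K r f \<beta> \<gamma>"
    and \<beta>: "\<And>\<alpha>. mi_abs \<alpha> = r + 1 \<Longrightarrow> Bseq (\<lambda>n. \<beta> n \<alpha>)"
    and \<gamma>: "\<And>\<alpha>. mi_abs \<alpha> = r + 2 \<Longrightarrow> Bseq (\<lambda>n. \<gamma> n \<alpha>)"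
  obtains C where "C \<ge> 0"
    and "\<And>n w \<xi>. length w \<le> K \<Longrightarrow> \<xi> \<in> torus \<Longrightarrow>
      norm (foldr partial w (f n) \<xi>) \<le> C * norm \<xi> ^ (r + 1 - length w)"
    and "\<And>n \<xi>. \<xi> \<in> torus \<Longrightarrow> norm (f n \<xi> - i_poly (r + 1) (\<beta> n) \<xi>) \<le> C * norm \<xi> ^ (r + 2)"
proof -
  let ?D = "{\<delta> :: nat ^ 'd. mi_abs \<delta> = K}"
  \<comment> \<open>The derivative with multi-index \<delta> of the leading polynomial, in the form
    given by \<open>foldr_partial_i_poly\<close>.\<close>
  define P where "P = (\<lambda>n \<delta>. i_poly (r + 1 - K)
    (\<lambda>\<rho>. \<i> ^ K * (\<beta> n (\<rho> + \<delta>) * (mi_fact (\<rho> + \<delta>) / mi_fact \<rho>))))"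
  have "\<exists>C\<ge>0. \<forall>n. \<forall>\<xi>\<in>torus. norm (mi_partial \<delta> (f n) \<xi> - P n \<delta> \<xi>) \<le> C * norm \<xi> ^ (r + 2 - K)
      \<and> norm (P n \<delta> \<xi>) \<le> C * norm \<xi> ^ (r + 1 - K)" if \<delta>: "\<delta> \<in> ?D" for \<delta>
  proof -
    obtain \<epsilon> where \<epsilon>: "\<And>\<rho>. uniform_o1 (\<epsilon> \<rho>)" and eq: "\<And>n \<xi>. \<xi> \<in> torus \<Longrightarrow> mi_partial \<delta> (f n) \<xi> =
           \<i> ^ K * ((\<Sum>\<rho> | mi_abs \<rho> = r + 1 - K.
               \<beta> n (\<rho> + \<delta>) * (mi_fact (\<rho> + \<delta>) / mi_fact \<rho>) * i_monom \<xi> \<rho>) +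
            (\<Sum>\<rho> | mi_abs \<rho> = r + 2 - K.
               (\<gamma> n (\<rho> + \<delta>) + \<epsilon> \<rho> n \<xi>) * (mi_fact (\<rho> + \<delta>) / mi_fact \<rho>) * i_monom \<xi> \<rho>))"
      using ex[unfolded deriv_expansion_def, rule_format, of \<delta>] \<delta> by blast
    \<comment> \<open>These coefficients depend on \<xi> through the remainder functions.
      \<open>norm_i_poly_le\<close> is applied at each \<xi> separately, so this does no
      harm.\<close>
    define Q where "Q = (\<lambda>n \<xi>. \<lambda>\<rho>. \<i> ^ K * ((\<gamma> n (\<rho> + \<delta>) + \<epsilon> \<rho> n \<xi>) * (mi_fact (\<rho> + \<delta>) / mi_fact \<rho>)))"
    have eq': "mi_partial \<delta> (f n) \<xi> - P n \<delta> \<xi> = i_poly (r + 2 - K) (Q n \<xi>) \<xi>" if "\<xi> \<in> torus" for n \<xi>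
      unfolding eq[OF that] P_def Q_def i_poly_def
      by (simp add: distrib_left sum_distrib_left mult_ac)
    have "\<exists>B. \<forall>\<rho>. mi_abs \<rho> = r + 1 - K \<longrightarrow> (\<forall>n. norm (\<beta> n (\<rho> + \<delta>)) \<le> B \<rho>)"
    proof (intro choice allI)
      fix \<rho> :: "nat ^ 'd"
      show "\<exists>y. mi_abs \<rho> = r + 1 - K \<longrightarrow> (\<forall>n. norm (\<beta> n (\<rho> + \<delta>)) \<le> y)"
        using \<beta>[of "\<rho> + \<delta>"] K \<delta> by (cases "mi_abs \<rho> = r + 1 - K") (auto simp: Bseq_def mi_abs_add)
    qed
    then obtain B where B: "\<And>\<rho> n. mi_abs \<rho> = r + 1 - K \<Longrightarrow> norm (\<beta> n (\<rho> + \<delta>)) \<le> B \<rho>" by blast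
    have "\<exists>G. \<forall>\<rho>. mi_abs \<rho> = r + 2 - K \<longrightarrow> (\<forall>n. norm (\<gamma> n (\<rho> + \<delta>)) \<le> G \<rho>)"
    proof (intro choice allI)
      fix \<rho> :: "nat ^ 'd"
      show "\<exists>y. mi_abs \<rho> = r + 2 - K \<longrightarrow> (\<forall>n. norm (\<gamma> n (\<rho> + \<delta>)) \<le> y)"
        using \<gamma>[of "\<rho> + \<delta>"] K \<delta> by (cases "mi_abs \<rho> = r + 2 - K") (auto simp: Bseq_def mi_abs_add)
    qed
    then obtain G where G: "\<And>\<rho> n. mi_abs \<rho> = r + 2 - K \<Longrightarrow> norm (\<gamma> n (\<rho> + \<delta>)) \<le> G \<rho>" by blast
    have "\<exists>E. \<forall>\<rho> n. \<forall>\<xi>\<in>torus. norm (\<epsilon> \<rho> n \<xi>) \<le> E \<rho>"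
      using \<epsilon> by (intro choice allI) (auto simp: uniform_o1_def)
    then obtain E where E: "\<And>\<rho> n \<xi>. \<xi> \<in> torus \<Longrightarrow> norm (\<epsilon> \<rho> n \<xi>) \<le> E \<rho>" by blast
    define C1 where "C1 = (\<Sum>\<rho> | mi_abs \<rho> = r + 1 - K. B \<rho> * norm (mi_fact (\<rho> + \<delta>) / mi_fact \<rho>))"
    define C2 where "C2 = (\<Sum>\<rho> | mi_abs \<rho> = r + 2 - K. (G \<rho> + E \<rho>) * norm (mi_fact (\<rho> + \<delta>) / mi_fact \<rho>))"
    have b1: "norm (P n \<delta> \<xi>) \<le> C1 * norm \<xi> ^ (r + 1 - K)" for n \<xi>
      unfolding P_def C1_def
      by (rule order.trans[OF norm_i_poly_le], intro mult_right_mono sum_mono)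
         (auto simp: norm_mult norm_divide norm_power intro!: mult_right_mono divide_right_mono B)
    have GE: "norm (\<gamma> n (\<rho> + \<delta>) + \<epsilon> \<rho> n \<xi>) \<le> G \<rho> + E \<rho>"
      if "mi_abs \<rho> = r + 2 - K" "\<xi> \<in> torus" for n \<rho> \<xi>
      by (rule order.trans[OF norm_triangle_ineq add_mono[OF G[OF that(1)] E[OF that(2)]]])
    have b2: "norm (mi_partial \<delta> (f n) \<xi> - P n \<delta> \<xi>) \<le> C2 * norm \<xi> ^ (r + 2 - K)" if "\<xi> \<in> torus" for n \<xi>
      unfolding eq'[OF that] C2_def Q_def
      by (rule order.trans[OF norm_i_poly_le], intro mult_right_mono sum_mono)
         (auto simp: norm_mult norm_divide norm_power intro!: mult_right_mono divide_right_mono GE that)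
    show ?thesis
    proof (intro exI[of _ "max 0 (max C1 C2)"] conjI allI ballI)
      fix n and \<xi> :: "real ^ 'd" assume \<xi>: "\<xi> \<in> torus"
      show "norm (mi_partial \<delta> (f n) \<xi> - P n \<delta> \<xi>) \<le> max 0 (max C1 C2) * norm \<xi> ^ (r + 2 - K)"
        by (rule order.trans[OF b2[OF \<xi>]]) (auto intro!: mult_right_mono)
      show "norm (P n \<delta> \<xi>) \<le> max 0 (max C1 C2) * norm \<xi> ^ (r + 1 - K)"
        by (rule order.trans[OF b1]) (auto intro!: mult_right_mono)
    qed auto
  qed
  then obtain c where c: "\<And>\<delta>. \<delta> \<in> ?D \<Longrightarrow> c \<delta> \<ge> 0"
    "\<And>\<delta> n \<xi>. \<delta> \<in> ?D \<Longrightarrow> \<xi> \<in> torus \<Longrightarrow> norm (mi_partial \<delta> (f n) \<xi> - P n \<delta> \<xi>) \<le> c \<delta> * norm \<xi> ^ (r + 2 - K)"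
    "\<And>\<delta> n \<xi>. \<delta> \<in> ?D \<Longrightarrow> \<xi> \<in> torus \<Longrightarrow> norm (P n \<delta> \<xi>) \<le> c \<delta> * norm \<xi> ^ (r + 1 - K)"
    by metis
  define C0 where "C0 = sum c ?D"
  have C0: "C0 \<ge> 0" "\<And>\<delta>. \<delta> \<in> ?D \<Longrightarrow> c \<delta> \<le> C0"
    unfolding C0_def using c(1) by (auto intro!: sum_nonneg member_le_sum finite_mi_abs_eq)
  \<comment> \<open>A bound for the norm on the torus; it turns the one surplus power of |\<xi>| in
    the remainder into a constant.\<close>
  define R where "R = pi * real CARD('d)"
  have R: "R \<ge> 1"
    using mult_mono[of 1 pi 1 "real CARD('d)"] pi_gt3 by (simp add: R_def)
  let ?N = "real CARD('d)"
  have d1: "1 \<le> ?N" by simp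
  define C1 where "C1 = C0 * R + C0"
  have "C1 \<ge> 0" using C0 R by (simp add: C1_def)
  have w_in: "mi_count w \<in> ?D" if "length w = K" for w
    using that by (simp add: mi_abs_mi_count)
  have top1: "norm (foldr partial w (f n) \<xi>) \<le> C1 * norm \<xi> ^ (r + 1 - K)"
    if w: "length w = K" and \<xi>: "\<xi> \<in> torus" for n w \<xi>
  proof -
    let ?\<delta> = "mi_count w"
    have "foldr partial w (f n) = mi_partial ?\<delta> (f n)"
      using f w by (simp add: mi_partial_mi_count)
    then have "norm (foldr partial w (f n) \<xi>) \<le> norm (mi_partial ?\<delta> (f n) \<xi> - P n ?\<delta> \<xi>) + norm (P n ?\<delta> \<xi>)"
      using norm_triangle_ineq[of "mi_partial ?\<delta> (f n) \<xi> - P n ?\<delta> \<xi>" "P n ?\<delta> \<xi>"] by simp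
    also have "\<dots> \<le> C0 * norm \<xi> ^ (r + 2 - K) + C0 * norm \<xi> ^ (r + 1 - K)"
      using C0(2)[OF w_in[OF w]] c(2,3)[OF w_in[OF w] \<xi>]
      by (intro add_mono) (meson mult_right_mono norm_ge_zero order.trans zero_le_power)+
    also have "r + 2 - K = Suc (r + 1 - K)" using K by simp
    also have "C0 * norm \<xi> ^ Suc (r + 1 - K) \<le> C0 * (R * norm \<xi> ^ (r + 1 - K))"
      using C0 norm_torus_le[OF \<xi>] by (auto intro!: mult_left_mono mult_right_mono simp: R_def)
    finally show ?thesis by (simp add: C1_def algebra_simps)
  qed
  have low1: "foldr partial w (f n) 0 = 0" if "length w < K" for w n
  proof -
    have "class_C (length w) (f n)" using class_C_mono[OF f] that by simp
    then show ?thesis using van[of "mi_count w" n] that by (simp add: mi_partial_mi_count mi_abs_mi_count)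
  qed
  have g: "class_C K (\<lambda>\<xi>. f n \<xi> - i_poly (r + 1) (\<beta> n) \<xi>)" for n
    by (intro class_C_diff f class_C_i_poly)
  have gw: "foldr partial w (\<lambda>\<xi>. f n \<xi> - i_poly (r + 1) (\<beta> n) \<xi>)
     = (\<lambda>\<xi>. foldr partial w (f n) \<xi> - foldr partial w (i_poly (r + 1) (\<beta> n)) \<xi>)" if "length w \<le> K" for w n
    using class_C_mono[OF f that] by (intro foldr_partial_diff class_C_i_poly)
  have top2: "norm (foldr partial w (\<lambda>\<xi>. f n \<xi> - i_poly (r + 1) (\<beta> n) \<xi>) \<xi>) \<le> C0 * norm \<xi> ^ (r + 2 - K)"
    if w: "length w = K" and \<xi>: "\<xi> \<in> torus" for n w \<xi>
  proof -
    let ?\<delta> = "mi_count w"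
    have "foldr partial w (f n) = mi_partial ?\<delta> (f n)"
      using f w by (simp add: mi_partial_mi_count)
    then have "norm (foldr partial w (\<lambda>\<xi>. f n \<xi> - i_poly (r + 1) (\<beta> n) \<xi>) \<xi>) = norm (mi_partial ?\<delta> (f n) \<xi> - P n ?\<delta> \<xi>)"
      using w K gw[of w n] by (simp add: foldr_partial_i_poly P_def)
    also have "\<dots> \<le> C0 * norm \<xi> ^ (r + 2 - K)"
      using C0(2)[OF w_in[OF w]] c(2)[OF w_in[OF w] \<xi>] by (meson mult_right_mono norm_ge_zero order.trans zero_le_power)
    finally show ?thesis .
  qed
  \<comment> \<open>Here K \<le> r + 1 matters: derivatives of order below K do not exhaust the
    degree of the polynomial and hence vanish at 0.\<close>
  have low2: "foldr partial w (\<lambda>\<xi>. f n \<xi> - i_poly (r + 1) (\<beta> n) \<xi>) 0 = 0" if "length w < K" for w n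
    using that low1[OF that] K gw[of w n] by (simp add: foldr_partial_i_poly_0)
  define C where "C = (C1 + C0) * ?N ^ K"
  have le: "C1 * ?N ^ k \<le> C" "C0 * ?N ^ k \<le> C" if "k \<le> K" for k
    unfolding C_def using C0 \<open>C1 \<ge> 0\<close> power_increasing[OF that d1] by (auto intro!: mult_mono)
  show ?thesis
  proof
    show "C \<ge> 0" using C0 \<open>C1 \<ge> 0\<close> by (simp add: C_def)
    fix n and \<xi> :: "real ^ 'd" assume \<xi>: "\<xi> \<in> torus"
    { fix w :: "'d list" assume w: "length w \<le> K"
      have "norm (foldr partial w (f n) \<xi>) \<le> C1 * ?N ^ (K - length w) * norm \<xi> ^ (r + 1 - K + (K - length w))"
        by (rule foldr_partial_taylor_bound[OF f \<open>C1 \<ge> 0\<close> top1 low1 w \<xi>])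
      also have "\<dots> \<le> C * norm \<xi> ^ (r + 1 - K + (K - length w))"
        by (intro mult_right_mono le) auto
      also have "r + 1 - K + (K - length w) = r + 1 - length w" using w K by simp
      finally show "norm (foldr partial w (f n) \<xi>) \<le> C * norm \<xi> ^ (r + 1 - length w)" . }
    have "norm (f n \<xi> - i_poly (r + 1) (\<beta> n) \<xi>) \<le> C0 * ?N ^ K * norm \<xi> ^ (r + 2)"
      using foldr_partial_taylor_bound[OF g C0(1) top2 low2 _ \<xi>, of "[]" n] K by simp
    also have "\<dots> \<le> C * norm \<xi> ^ (r + 2)"
      by (intro mult_right_mono le) auto
    finally show "norm (f n \<xi> - i_poly (r + 1) (\<beta> n) \<xi>) \<le> C * norm \<xi> ^ (r + 2)" .
  qed
qed

section \<open>The reference exponent\<close>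

lemma has_vector_derivative_iff_quotient:
  fixes f :: "real \<Rightarrow> 'a::real_normed_vector"
  shows "(f has_vector_derivative D) (at x) \<longleftrightarrow> ((\<lambda>y. (f y - f x) /\<^sub>R (y - x)) \<longlongrightarrow> D) (at x)"
proof -
  have "norm (f y - f x - (y - x) *\<^sub>R D) / norm (y - x) = norm ((f y - f x) /\<^sub>R (y - x) - D)" if "y \<noteq> x" for y
  proof -
    have "(f y - f x) /\<^sub>R (y - x) - D = (f y - f x - (y - x) *\<^sub>R D) /\<^sub>R (y - x)"
      using that by (simp add: scaleR_diff_right)
    then show ?thesis by (simp add: divide_inverse mult.commute)
  qed
  then have "((\<lambda>y. norm (f y - f x - (y - x) *\<^sub>R D) / norm (y - x)) \<longlongrightarrow> 0) (at x)
      \<longleftrightarrow> ((\<lambda>y. norm ((f y - f x) /\<^sub>R (y - x) - D)) \<longlongrightarrow> 0) (at x)"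
    by (intro Lim_cong_within) auto
  then show ?thesis
    unfolding has_vector_derivative_def has_derivative_iff_norm
    by (simp add: bounded_linear_scaleR_left tendsto_norm_zero_iff LIM_zero_iff)
qed

lemmas has_vector_derivative_quotientI = has_vector_derivative_iff_quotient[THEN iffD2]
lemmas has_vector_derivative_quotientD = has_vector_derivative_iff_quotient[THEN iffD1]

lemma norm_iexp_diff_le: "norm (exp (\<i> * of_real a) - exp (\<i> * of_real b)) \<le> \<bar>a - b\<bar>"
proof -
  have "exp (\<i> * of_real a) - exp (\<i> * of_real b) = exp (\<i> * of_real b) * (exp (\<i> * of_real (a - b)) - 1)"
    by (simp add: algebra_simps flip: exp_add)
  then have "norm (exp (\<i> * of_real a) - exp (\<i> * of_real b)) = norm (exp (\<i> * of_real (a - b)) - 1)"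
    by (simp add: norm_mult)
  also have "\<dots> \<le> \<bar>a - b\<bar>"
    using iexp_approx1[of "a - b" 0] by simp
  finally show ?thesis .
qed

lemma integrable_mult_iexp:
  fixes g :: "'a \<Rightarrow> complex"
  assumes "integrable M g" "v \<in> borel_measurable M"
  shows "integrable M (\<lambda>x. g x * exp (\<i> * of_real (v x * t)))"
  using assms(1)
proof (rule Bochner_Integration.integrable_bound)
  show "(\<lambda>x. g x * exp (\<i> * of_real (v x * t))) \<in> borel_measurable M"
    using assms by measurable
qed (simp add: norm_mult)

lemma continuous_integral_iexp:
  fixes g :: "'a \<Rightarrow> complex"
  assumes g: "integrable M g" and [measurable]: "v \<in> borel_measurable M"
  shows "continuous_on UNIV (\<lambda>t. LINT x|M. g x * exp (\<i> * of_real (v x * t)))"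
proof (rule continuous_on_sequentiallyI)
  fix u and t :: real assume u: "u \<longlonglongrightarrow> t"
  have [measurable]: "g \<in> borel_measurable M" using g by simp
  show "(\<lambda>n. LINT x|M. g x * exp (\<i> * of_real (v x * u n))) \<longlonglongrightarrow> (LINT x|M. g x * exp (\<i> * of_real (v x * t)))"
  proof (rule integral_dominated_convergence[where w = "\<lambda>x. norm (g x)"])
    show "AE x in M. (\<lambda>n. g x * exp (\<i> * of_real (v x * u n))) \<longlonglongrightarrow> g x * exp (\<i> * of_real (v x * t))"
      using u by (auto intro!: tendsto_intros)
  qed (use g in \<open>auto simp: norm_mult\<close>)
qed

text \<open>Dominated convergence for the difference quotients, which are at most |g v| because t
  \<mapsto> exp(i v t) is Lipschitz with constant |v|. The measure is kept general: the lemma serves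
  both the moments of a lattice law and the Gaussian integrals over the line.\<close>

lemma has_vector_derivative_integral_iexp:
  fixes g :: "'a \<Rightarrow> complex"
  assumes g: "integrable M g" and gv: "integrable M (\<lambda>x. g x * of_real (v x))"
    and [measurable]: "v \<in> borel_measurable M"
  shows "((\<lambda>t. LINT x|M. g x * exp (\<i> * of_real (v x * t))) has_vector_derivative
    (LINT x|M. \<i> * (g x * of_real (v x)) * exp (\<i> * of_real (v x * t)))) (at t)"
proof (rule has_vector_derivative_quotientI, subst tendsto_at_iff_sequentially, intro allI impI)
  fix u assume u: "\<forall>i. u i \<in> UNIV - {t}" "u \<longlonglongrightarrow> t"
  have [measurable]: "g \<in> borel_measurable M" using g by simp
  let ?F = "\<lambda>t. LINT x|M. g x * exp (\<i> * of_real (v x * t))"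
  let ?q = "\<lambda>n x. g x * ((exp (\<i> * of_real (v x * u n)) - exp (\<i> * of_real (v x * t))) /\<^sub>R (u n - t))"
  have eq: "(?F (u n) - ?F t) /\<^sub>R (u n - t) = (LINT x|M. ?q n x)" for n
  proof -
    have "?q n x = (g x * exp (\<i> * of_real (v x * u n)) - g x * exp (\<i> * of_real (v x * t))) /\<^sub>R (u n - t)" for x
      by (simp only: right_diff_distrib mult_scaleR_right)
    then have "(LINT x|M. ?q n x)
        = (LINT x|M. (g x * exp (\<i> * of_real (v x * u n)) - g x * exp (\<i> * of_real (v x * t))) /\<^sub>R (u n - t))"
      by (simp only:)
    also have "\<dots> = (LINT x|M. g x * exp (\<i> * of_real (v x * u n)) - g x * exp (\<i> * of_real (v x * t))) /\<^sub>R (u n - t)"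
      by (rule integral_scaleR_right)
    also have "(LINT x|M. g x * exp (\<i> * of_real (v x * u n)) - g x * exp (\<i> * of_real (v x * t))) = ?F (u n) - ?F t"
      by (intro Bochner_Integration.integral_diff integrable_mult_iexp g) measurable
    finally show ?thesis ..
  qed
  have "(\<lambda>n. LINT x|M. ?q n x) \<longlonglongrightarrow> (LINT x|M. \<i> * (g x * of_real (v x)) * exp (\<i> * of_real (v x * t)))"
  proof (rule integral_dominated_convergence[where w = "\<lambda>x. norm (g x * of_real (v x))"])
    show "AE x in M. (\<lambda>n. ?q n x) \<longlonglongrightarrow> \<i> * (g x * of_real (v x)) * exp (\<i> * of_real (v x * t))"
    proof (rule AE_I2)
      fix x
      have "((\<lambda>s. exp (\<i> * of_real (v x * s))) has_vector_derivative \<i> * of_real (v x) * exp (\<i> * of_real (v x * t))) (at t)"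
      proof -
        have "((\<lambda>s. \<i> * of_real (v x * s)) has_vector_derivative \<i> * of_real (v x)) (at t)"
          by (auto intro!: derivative_eq_intros)
        from field_vector_diff_chain_at[OF this DERIV_exp] show ?thesis by (simp add: o_def)
      qed
      from has_vector_derivative_quotientD[OF this] u
      have "(\<lambda>n. (exp (\<i> * of_real (v x * u n)) - exp (\<i> * of_real (v x * t))) /\<^sub>R (u n - t))
         \<longlonglongrightarrow> \<i> * of_real (v x) * exp (\<i> * of_real (v x * t))"
        unfolding tendsto_at_iff_sequentially by (auto simp: o_def)
      from tendsto_mult_left[OF this, of "g x"]
      show "(\<lambda>n. ?q n x) \<longlonglongrightarrow> \<i> * (g x * of_real (v x)) * exp (\<i> * of_real (v x * t))"
        by (simp add: mult_ac)
    qed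
    show "AE x in M. norm (?q n x) \<le> norm (g x * of_real (v x))" for n
    proof (rule AE_I2)
      fix x
      have "\<bar>u n - t\<bar> > 0" using u by auto
      moreover have "norm (exp (\<i> * of_real (v x * u n)) - exp (\<i> * of_real (v x * t))) \<le> \<bar>v x\<bar> * \<bar>u n - t\<bar>"
        using norm_iexp_diff_le[of "v x * u n" "v x * t"] by (simp add: abs_mult flip: right_diff_distrib)
      ultimately have "norm ((exp (\<i> * of_real (v x * u n)) - exp (\<i> * of_real (v x * t))) /\<^sub>R (u n - t)) \<le> \<bar>v x\<bar>"
        by (simp add: divide_inverse[symmetric] mult.commute[of "inverse _"] pos_divide_le_eq del: scaleR_diff_right)
      then show "norm (?q n x) \<le> norm (g x * of_real (v x))"
        unfolding norm_mult by (intro mult_left_mono) auto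
    qed
  qed (use g gv in auto)
  then show "((\<lambda>y. (?F y - ?F t) /\<^sub>R (y - t)) \<circ> u) \<longlonglongrightarrow> (LINT x|M. \<i> * (g x * of_real (v x)) * exp (\<i> * of_real (v x * t)))"
    by (simp only: o_def eq)
qed

section \<open>Smoothness of the exponent from the moments of the law\<close>

lemma has_vector_derivative_coordinate:
  assumes "(h has_vector_derivative D) (at (\<xi> $ j))"
  shows "((\<lambda>t. h ((\<xi> + t *\<^sub>R axis i 1) $ j)) has_vector_derivative (if i = j then D else 0)) (at 0)"
proof (cases "i = j")
  case True
  have 1: "((\<lambda>t. \<xi> $ j + t) has_vector_derivative 1) (at 0)"
    by (auto intro!: derivative_eq_intros)
  have 2: "(h has_vector_derivative D) (at (\<xi> $ j + 0))"
    using assms by simp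
  show ?thesis
    using vector_diff_chain_at[OF 1 2] True by (simp add: o_def axis_def)
qed (simp add: axis_def)

text \<open>A continuous logarithm differs locally from the principal one by a constant: near
  \<theta> the increment of \<phi> has imaginary part below 1 < pi, so \<open>Ln\<close> recovers it
  from exp(- \<phi> \<theta>) q.\<close>

lemma has_vector_derivative_log_lift:
  fixes \<phi> :: "real \<Rightarrow> complex"
  assumes \<phi>: "continuous_on UNIV \<phi>" and q: "\<And>\<theta>. exp (\<phi> \<theta>) = q \<theta>"
    and q': "(q has_vector_derivative D) (at \<theta>)"
  shows "(\<phi> has_vector_derivative D * exp (- \<phi> \<theta>)) (at \<theta>)"
proof -
  have "isCont \<phi> \<theta>" using \<phi> by (simp add: continuous_on_eq_continuous_at)
  then obtain d where d: "d > 0" "\<And>y. dist y \<theta> < d \<Longrightarrow> dist (\<phi> y) (\<phi> \<theta>) < 1"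
    unfolding continuous_at_eps_delta by (metis zero_less_one)
  have 1: "((\<lambda>y. exp (- \<phi> \<theta>) * q y) has_vector_derivative exp (- \<phi> \<theta>) * D) (at \<theta>)"
    by (rule has_vector_derivative_mult_right[OF q'])
  have one: "exp (- \<phi> \<theta>) * q \<theta> = 1"
    by (simp add: q[symmetric] exp_minus)
  have 2: "(Ln has_field_derivative 1) (at (exp (- \<phi> \<theta>) * q \<theta>))"
    unfolding one using has_field_derivative_Ln[of 1] by simp
  have "((\<lambda>y. Ln (exp (- \<phi> \<theta>) * q y)) has_vector_derivative exp (- \<phi> \<theta>) * D) (at \<theta>)"
    using field_vector_diff_chain_at[OF 1 2] by (simp add: o_def)
  then have 3: "((\<lambda>y. Ln (exp (- \<phi> \<theta>) * q y) + \<phi> \<theta>) has_vector_derivative exp (- \<phi> \<theta>) * D + 0) (at \<theta>)"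
    by (intro has_vector_derivative_add has_vector_derivative_const)
  have "(\<phi> has_vector_derivative exp (- \<phi> \<theta>) * D + 0) (at \<theta>)"
  proof (rule has_vector_derivative_transform_within[OF 3 d(1)])
    fix y assume "dist y \<theta> < d"
    then have "norm (\<phi> y - \<phi> \<theta>) < 1" using d(2) by (simp add: dist_norm)
    then have "\<bar>Im (\<phi> y - \<phi> \<theta>)\<bar> < 1" using abs_Im_le_cmod order.strict_trans1 by blast
    then have "- pi < Im (\<phi> y - \<phi> \<theta>)" "Im (\<phi> y - \<phi> \<theta>) \<le> pi"
      using pi_gt3 by linarith+
    then have "Ln (exp (\<phi> y - \<phi> \<theta>)) = \<phi> y - \<phi> \<theta>" by (rule Ln_exp)
    moreover have "exp (\<phi> y - \<phi> \<theta>) = exp (- \<phi> \<theta>) * q y"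
      by (simp add: exp_diff exp_minus divide_inverse q mult.commute)
    ultimately show "Ln (exp (- \<phi> \<theta>) * q y) + \<phi> \<theta> = \<phi> y" by simp
  qed simp
  then show ?thesis by (simp add: mult.commute)
qed

lemma integrable_pmf_lower_moment:
  fixes p :: "int pmf"
  assumes "integrable (measure_pmf p) (\<lambda>k. \<bar>real_of_int k\<bar> ^ K)" "l \<le> K"
  shows "integrable (measure_pmf p) (\<lambda>k. (\<i> * of_int k) ^ l)"
proof (rule Bochner_Integration.integrable_bound)
  show "integrable (measure_pmf p) (\<lambda>k. 1 + \<bar>real_of_int k\<bar> ^ K)"
    using assms by auto
  show "AE k in measure_pmf p. norm ((\<i> * of_int k :: complex) ^ l) \<le> norm (1 + \<bar>real_of_int k\<bar> ^ K)"
  proof (rule AE_I2)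
    fix k :: int
    have "\<bar>real_of_int k\<bar> ^ l \<le> 1 + \<bar>real_of_int k\<bar> ^ K"
    proof (cases "k = 0")
      case False
      then have "\<bar>real_of_int k\<bar> ^ l \<le> \<bar>real_of_int k\<bar> ^ K"
        by (intro power_increasing assms) linarith
      then show ?thesis by simp
    qed (cases l; simp)
    then show "norm ((\<i> * of_int k :: complex) ^ l) \<le> norm (1 + \<bar>real_of_int k\<bar> ^ K)"
      by (simp add: norm_power norm_mult)
  qed
qed simp

abbreviation pmf_char :: "int pmf \<Rightarrow> real \<Rightarrow> complex" where
  "pmf_char p \<theta> \<equiv> measure_pmf.expectation p (\<lambda>k. exp (\<i> * of_real (of_int k * \<theta>)))"

context
  fixes p :: "int pmf" and K :: nat and \<phi> :: "real \<Rightarrow> complex"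
  assumes mom: "integrable (measure_pmf p) (\<lambda>k. \<bar>real_of_int k\<bar> ^ K)"
    and char: "\<And>\<theta>. pmf_char p \<theta> = exp (\<phi> \<theta>)"
    and cont: "continuous_on UNIV \<phi>"
begin

definition char_deriv :: "nat \<Rightarrow> real \<Rightarrow> complex" where
  "char_deriv l \<theta> = measure_pmf.expectation p (\<lambda>k. (\<i> * of_int k) ^ l * exp (\<i> * of_real (of_int k * \<theta>)))"

lemma char_deriv_has_vector_derivative:
  assumes "Suc l \<le> K"
  shows "(char_deriv l has_vector_derivative char_deriv (Suc l) \<theta>) (at \<theta>)"
proof -
  have i: "integrable (measure_pmf p) (\<lambda>k. (\<i> * of_int k) ^ l * of_real (of_int k))"
    using integrable_mult_right[OF integrable_pmf_lower_moment[OF mom assms], of "-\<i>"] by (simp add: mult_ac)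
  show ?thesis
    using has_vector_derivative_integral_iexp[OF integrable_pmf_lower_moment[OF mom, of l] i, of \<theta>] assms
    unfolding char_deriv_def[abs_def] by (simp add: mult_ac)
qed

lemma class_C_char_deriv:
  "l + k \<le> K \<Longrightarrow> class_C k (\<lambda>\<xi>. char_deriv l (\<xi> $ j))"
proof (induction k arbitrary: l)
  case 0
  then have "continuous_on UNIV (char_deriv l)"
    unfolding char_deriv_def[abs_def]
    by (intro continuous_integral_iexp integrable_pmf_lower_moment[OF mom]) auto
  then show ?case
    by (auto intro!: continuous_on_compose2[of UNIV "char_deriv l"] continuous_intros)
next
  case (Suc k)
  show ?case
  proof (rule class_C_SucI[where f' = "\<lambda>i \<xi>. if i = j then char_deriv (Suc l) (\<xi> $ j) else 0"])
    show "continuous_on UNIV (\<lambda>\<xi>. char_deriv l (\<xi> $ j))"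
      using Suc.IH[of l] Suc.prems class_C_continuous by auto
    show "class_C k (\<lambda>\<xi>. if i = j then char_deriv (Suc l) (\<xi> $ j) else 0)" for i
      using Suc by (cases "i = j") (auto intro: class_C_const)
  qed (intro has_vector_derivative_coordinate char_deriv_has_vector_derivative, use Suc in simp)
qed

lemma exponent_has_vector_derivative:
  assumes "K \<ge> 1"
  shows "(\<phi> has_vector_derivative char_deriv 1 \<theta> * exp (- \<phi> \<theta>)) (at \<theta>)"
proof (rule has_vector_derivative_log_lift[OF cont])
  show "exp (\<phi> \<theta>) = char_deriv 0 \<theta>" for \<theta>
    by (simp only: char_deriv_def char power_0 mult_1)
  show "(char_deriv 0 has_vector_derivative char_deriv 1 \<theta>) (at \<theta>)"
    using char_deriv_has_vector_derivative[of 0 \<theta>] assms by simp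
qed

text \<open>Bootstrap through \<phi>' = q' exp(- \<phi>), where q = exp \<phi> is the characteristic
  function. If \<phi> has class k then so has the right-hand side, provided q has k + 1 derivatives,
  which the moments supply.\<close>

lemma class_C_exponent:
  "k \<le> K \<Longrightarrow> class_C k (\<lambda>\<xi>. \<phi> (\<xi> $ j))"
proof (induction k)
  case 0
  then show ?case by (auto intro!: continuous_on_compose2[OF cont] continuous_intros)
next
  case (Suc k)
  show ?case
  proof (rule class_C_SucI[where f' = "\<lambda>i \<xi>. if i = j then char_deriv 1 (\<xi> $ j) * exp (- \<phi> (\<xi> $ j)) else 0"])
    show "continuous_on UNIV (\<lambda>\<xi>. \<phi> (\<xi> $ j))"
      using Suc class_C_continuous by auto
    have "class_C k (\<lambda>\<xi>. char_deriv 1 (\<xi> $ j) * exp ((-1) * \<phi> (\<xi> $ j)))"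
      using Suc by (intro class_C_mult class_C_char_deriv class_C_exp class_C_const) auto
    then show "class_C k (\<lambda>\<xi>. if i = j then char_deriv 1 (\<xi> $ j) * exp (- \<phi> (\<xi> $ j)) else 0)" for i
      by (cases "i = j") (auto intro: class_C_const)
  qed (intro has_vector_derivative_coordinate exponent_has_vector_derivative, use Suc in simp)
qed

end

section \<open>Characteristic functions of modulus one\<close>

lemma pmf_norm_char_le_1:
  "norm (pmf_char p \<theta>) \<le> 1"
  by (rule order.trans[OF integral_norm_bound]) (simp add: measure_pmf.prob_space)

text \<open>Equality case of the triangle inequality: the real part of \<open>cnj w * ?e k\<close>
  is at most 1 and has mean 1, hence equals 1 on the support.\<close>

lemma pmf_char_const_of_norm_1:
  fixes p :: "int pmf" and \<theta> :: real
  defines "w \<equiv> pmf_char p \<theta>"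
  assumes w: "norm w = 1" and "k \<in> set_pmf p"
  shows "exp (\<i> * of_real (of_int k * \<theta>)) = w"
proof -
  let ?e = "\<lambda>k::int. exp (\<i> * of_real (of_int k * \<theta>))"
  have int: "integrable (measure_pmf p) ?e"
    by (rule measure_pmf.integrable_const_bound[where B = 1]) auto
  have ww: "cnj w * w = 1" using w complex_norm_square[of w] by (simp add: mult.commute)
  have "measure_pmf.expectation p (\<lambda>k. 1 - Re (cnj w * ?e k)) = 1 - Re (cnj w * w)"
    using int unfolding w_def
    by (subst Bochner_Integration.integral_diff) (auto simp: measure_pmf.prob_space)
  then have 0: "measure_pmf.expectation p (\<lambda>k. 1 - Re (cnj w * ?e k)) = 0" using ww by simp
  have nn: "1 - Re (cnj w * ?e k) \<ge> 0" for k
    using complex_Re_le_cmod[of "cnj w * ?e k"] w by (simp add: norm_mult)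
  have "AE k in measure_pmf p. 1 - Re (cnj w * ?e k) = 0"
    using 0 nn int by (subst (asm) integral_nonneg_eq_0_iff_AE) auto
  then have "Re (cnj w * ?e k) = 1"
    using \<open>k \<in> set_pmf p\<close> by (auto simp: AE_measure_pmf_iff)
  moreover have "norm (cnj w * ?e k) = 1" using w by (simp add: norm_mult)
  ultimately have "cnj w * ?e k = 1"
    using cmod_power2[of "cnj w * ?e k"] by (simp only: complex_eq_iff) simp
  then have "w * (cnj w * ?e k) = w" by simp
  then show ?thesis using ww by (metis mult.assoc mult.commute mult_1)
qed

text \<open>If the characteristic function has modulus \<open>1\<close> at \<open>\<theta>\<close>, then the differences of support points
  lie in \<open>t\<int>\<close> with \<open>t \<ge> 2\<close>. Hence the support of a \<open>t\<close>-th convolution root lies in a coset of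
  \<open>t\<int>\<close>, and the support of the law itself in \<open>t\<int>\<close>.\<close>

lemma infinitely_divisible_norm_char_less_1:
  assumes inf: "infinitely_divisible p"
    and lat: "\<And>a::int. set_pmf p \<subseteq> {k. a dvd k} \<Longrightarrow> \<bar>a\<bar> = 1"
    and nontriv: "\<nexists>k. set_pmf p = {k}"
    and \<theta>: "\<bar>\<theta>\<bar> \<le> pi" "\<theta> \<noteq> 0"
  shows "norm (pmf_char p \<theta>) < 1"
proof (rule ccontr)
  assume "\<not> ?thesis"
  then have "norm (pmf_char p \<theta>) = 1"
    using pmf_norm_char_le_1[of p \<theta>] by simp
  note const = pmf_char_const_of_norm_1[OF this]
  let ?e = "\<lambda>k::int. exp (\<i> * of_real (of_int k * \<theta>))"
  \<comment> \<open>The integers annihilated by \<theta>. They form a subgroup that contains all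
    differences of support points, and its least positive element \<open>t\<close> below divides
    every member.\<close>
  define G where "G = {a::int. ?e a = 1}"
  have e_add: "?e (a + b) = ?e a * ?e b" for a b
    by (simp add: algebra_simps flip: exp_add)
  have G_diff: "a - b \<in> G" if "?e a = ?e b" for a b
    using e_add[of b "a - b"] that by (simp add: G_def)
  have supp_diff: "a - b \<in> G" if "a \<in> set_pmf p" "b \<in> set_pmf p" for a b
    using const[OF that(1)] const[OF that(2)] by (intro G_diff) simp
  have G_add: "a + b \<in> G" if "a \<in> G" "b \<in> G" for a b
    using that e_add unfolding G_def by simp
  have G_uminus: "- a \<in> G" if "a \<in> G" for a
    using that G_diff[of 0 a] unfolding G_def by simp
  have G_mult: "of_nat n * a \<in> G" if "a \<in> G" for a n
  proof (induction n)
    case (Suc n)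
    then show ?case using G_add[OF that Suc] by (simp add: algebra_simps)
  qed (simp add: G_def)
  obtain a where a: "a \<in> set_pmf p" using set_pmf_not_empty[of p] by blast
  obtain b where b: "b \<in> set_pmf p" "b \<noteq> a" using nontriv a by blast
  have "\<exists>t. t > 0 \<and> int t \<in> G"
    using supp_diff[OF a b(1)] supp_diff[OF b(1) a] b(2)
    by (intro exI[of _ "nat \<bar>a - b\<bar>"]) (auto simp: abs_if)
  define t where "t = (LEAST t. t > 0 \<and> int t \<in> G)"
  have t: "t > 0" "int t \<in> G"
    using LeastI_ex[OF \<open>\<exists>t. t > 0 \<and> int t \<in> G\<close>] by (auto simp: t_def)
  have tmin: "\<not> (s > 0 \<and> int s \<in> G)" if "s < t" for s
    using not_less_Least that unfolding t_def by blast
  have dvd: "int t dvd c" if c: "c \<in> G" for c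
  proof -
    have "of_nat (nat \<bar>c div int t\<bar>) * int t \<in> G" by (rule G_mult[OF t(2)])
    then have "(c div int t) * int t \<in> G"
      using G_uminus by (fastforce simp: abs_if split: if_splits)
    then have "c mod int t \<in> G"
      using G_add[OF c G_uminus] by (metis minus_mult_div_eq_mod mult.commute uminus_add_conv_diff add.commute)
    moreover have "c mod int t = int (nat (c mod int t))" "nat (c mod int t) < t"
      using t(1) by (auto simp: nat_less_iff)
    ultimately have "nat (c mod int t) = 0"
      using tmin by (metis not_gr_zero)
    then have "c mod int t = 0" using t(1) by (simp add: dual_order.antisym)
    then show ?thesis by auto
  qed
  \<comment> \<open>Otherwise exp(i \<theta>) = 1, which 0 < |\<theta>| \<le> pi excludes.\<close>
  have "t \<noteq> 1"
  proof
    assume "t = 1"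
    then have "exp (\<i> * of_real \<theta>) = 1" using t by (simp add: G_def)
    then obtain n :: int where "\<theta> = of_int (2 * n) * pi"
      by (auto simp: exp_eq_1)
    then have "n \<noteq> 0" "\<bar>\<theta>\<bar> = 2 * \<bar>of_int n\<bar> * pi" using \<theta> by (auto simp: abs_mult)
    moreover from this have "1 \<le> \<bar>of_int n :: real\<bar>" by linarith
    ultimately have "\<bar>\<theta>\<bar> \<ge> 2 * 1 * pi" by (simp only:) (intro mult_right_mono, auto)
    then show False using \<theta> by (simp add: pi_gt_zero not_le[symmetric])
  qed
  \<comment> \<open>The order of the root is exactly \<open>t\<close>, so that the shift common to
    the \<open>t\<close> summands contributes a multiple of \<open>t\<close>.\<close>
  obtain q where q: "p = map_pmf sum_list (replicate_pmf t q)"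
    using inf t(1) unfolding infinitely_divisible_def by blast
  have supp: "sum_list xs \<in> set_pmf p" if "length xs = t" "set xs \<subseteq> set_pmf q" for xs
    using that unfolding q by (auto simp: set_replicate_pmf lists_eq_set)
  obtain x0 where x0: "x0 \<in> set_pmf q" using set_pmf_not_empty[of q] by blast
  \<comment> \<open>Replacing one of \<open>t\<close> summands \<open>x0\<close> by x moves the sum
    from one support point of \<open>p\<close> to another, and the difference is x - x0.\<close>
  have x_dvd: "int t dvd x - x0" if "x \<in> set_pmf q" for x
  proof (rule dvd)
    have "sum_list (replicate (t - 1) x0 @ [x]) - sum_list (replicate t x0) \<in> G"
      using that x0 t(1) by (intro supp_diff supp) auto
    moreover have "sum_list (replicate t x0) = sum_list (replicate (t - 1) x0) + x0"
      using t(1) by (simp add: sum_list_replicate of_nat_diff algebra_simps)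
    ultimately show "x - x0 \<in> G" by simp
  qed
  have "int t dvd sum_list xs - int (length xs) * x0" if "set xs \<subseteq> set_pmf q" for xs
    using that
  proof (induction xs)
    case (Cons x xs)
    then have "int t dvd (x - x0) + (sum_list xs - int (length xs) * x0)"
      using x_dvd by (intro dvd_add) auto
    then show ?case by (simp add: algebra_simps)
  qed simp
  note sum_dvd = this
  have "set_pmf p \<subseteq> {k. int t dvd k}"
  proof
    fix k assume "k \<in> set_pmf p"
    then obtain xs where xs: "k = sum_list xs" "length xs = t" "set xs \<subseteq> set_pmf q"
      unfolding q by (auto simp: set_replicate_pmf lists_eq_set)
    show "k \<in> {k. int t dvd k}"
      using dvd_add[OF sum_dvd[OF xs(3)], of "int t * x0"] xs by simp
  qed
  from lat[OF this] \<open>t \<noteq> 1\<close> show False by simp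
qed

section \<open>Quadratic decay and derivative bounds of the reference exponent\<close>

lemma reference_exponent_smooth:
  assumes "reference_exponent K \<phi> m \<sigma>"
  shows "class_C K (\<lambda>\<xi>. \<phi> (\<xi> $ j))"
proof -
  obtain p where p: "integrable (measure_pmf p) (\<lambda>k. \<bar>real_of_int k\<bar> ^ K)"
      "\<And>\<theta>. pmf_char p \<theta> = exp (\<phi> \<theta>)"
    and \<phi>: "continuous_on UNIV \<phi>"
    using assms unfolding reference_exponent_def by blast
  show ?thesis by (rule class_C_exponent[OF p \<phi> order.refl])
qed

lemma reference_exponent_quotient:
  assumes "reference_exponent K \<phi> m \<sigma>"
  shows "((\<lambda>\<theta>. (\<phi> \<theta> - \<i> * of_real (m * \<theta>)) / of_real (\<theta>\<^sup>2)) \<longlongrightarrow> - of_real (\<sigma>\<^sup>2 / 2)) (at 0)"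
proof -
  have "((\<lambda>\<theta>. (\<phi> \<theta> - (\<i> * of_real (m * \<theta>) - of_real (\<sigma>\<^sup>2 * \<theta>\<^sup>2 / 2))) / of_real (\<theta>\<^sup>2)) \<longlongrightarrow> 0) (at 0)"
    using assms unfolding reference_exponent_def by (auto intro: smalloD_tendsto)
  then have "((\<lambda>\<theta>. (\<phi> \<theta> - (\<i> * of_real (m * \<theta>) - of_real (\<sigma>\<^sup>2 * \<theta>\<^sup>2 / 2))) / of_real (\<theta>\<^sup>2) - of_real (\<sigma>\<^sup>2 / 2))
     \<longlongrightarrow> 0 - of_real (\<sigma>\<^sup>2 / 2)) (at 0)"
    by (intro tendsto_intros)
  then show ?thesis
    unfolding diff_0
  proof (rule Lim_transform_eventually)
    show "\<forall>\<^sub>F \<theta> in at 0. (\<phi> \<theta> - (\<i> * of_real (m * \<theta>) - of_real (\<sigma>\<^sup>2 * \<theta>\<^sup>2 / 2))) / of_real (\<theta>\<^sup>2) - of_real (\<sigma>\<^sup>2 / 2)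
       = (\<phi> \<theta> - \<i> * of_real (m * \<theta>)) / of_real (\<theta>\<^sup>2)"
      by (rule eventually_mono[OF eventually_neq_at_within[of 0]])
         (auto simp: field_simps power2_eq_square)
  qed
qed

text \<open>Near 0 the second-order expansion gives the bound with half of its leading constant
  \<sigma>^2 / 2. On the compact remainder of [-pi, pi] the real part is continuous and strictly
  negative, hence bounded away from 0.\<close>

lemma reference_exponent_Re_le:
  assumes ref: "reference_exponent K \<phi> m \<sigma>"
  obtains c where "c > 0" "\<And>\<theta>. \<bar>\<theta>\<bar> \<le> pi \<Longrightarrow> Re (\<phi> \<theta>) \<le> - c * \<theta>\<^sup>2"
proof -
  obtain p where p: "infinitely_divisible p"
      "\<And>\<theta>. pmf_char p \<theta> = exp (\<phi> \<theta>)"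
      "\<And>a::int. set_pmf p \<subseteq> {k. a dvd k} \<Longrightarrow> \<bar>a\<bar> = 1"
    and \<phi>: "continuous_on UNIV \<phi>" "\<phi> 0 = 0" and "\<sigma> > 0"
    using ref unfolding reference_exponent_def by blast
  have "((\<lambda>\<theta>. Re ((\<phi> \<theta> - \<i> * of_real (m * \<theta>)) / of_real (\<theta>\<^sup>2))) \<longlongrightarrow> Re (- of_real (\<sigma>\<^sup>2 / 2))) (at 0)"
    by (intro tendsto_Re reference_exponent_quotient[OF ref])
  moreover have "Re ((\<phi> \<theta> - \<i> * of_real (m * \<theta>)) / of_real (\<theta>\<^sup>2)) = Re (\<phi> \<theta>) / \<theta>\<^sup>2" for \<theta>
    by (subst Re_divide_of_real) simp
  ultimately have "((\<lambda>\<theta>. Re (\<phi> \<theta>) / \<theta>\<^sup>2) \<longlongrightarrow> - \<sigma>\<^sup>2 / 2) (at 0)" by simp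
  then have "\<forall>\<^sub>F \<theta> in at 0. Re (\<phi> \<theta>) / \<theta>\<^sup>2 < - \<sigma>\<^sup>2 / 4"
    by (rule order_tendstoD(2)) (use \<open>\<sigma> > 0\<close> in simp)
  then obtain d where d: "d > 0" "\<And>\<theta>. \<theta> \<noteq> 0 \<Longrightarrow> \<bar>\<theta>\<bar> < d \<Longrightarrow> Re (\<phi> \<theta>) / \<theta>\<^sup>2 < - \<sigma>\<^sup>2 / 4"
    unfolding eventually_at by (auto simp: dist_norm)
  have near: "Re (\<phi> \<theta>) \<le> - (\<sigma>\<^sup>2 / 4) * \<theta>\<^sup>2" if "\<bar>\<theta>\<bar> < d" for \<theta>
    using d(2)[of \<theta>] that \<phi>(2) by (cases "\<theta> = 0") (auto simp: field_simps)
  \<comment> \<open>The characteristic function of a point mass has modulus 1 everywhere, so the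
    real part would vanish at d / 2, against the decay near 0.\<close>
  have nontriv: "\<nexists>k. set_pmf p = {k}"
  proof
    assume "\<exists>k. set_pmf p = {k}"
    then obtain k where "p = return_pmf k" by (metis set_pmf_subset_singleton subset_refl)
    then have "exp (\<phi> (d / 2)) = exp (\<i> * of_real (of_int k * (d / 2)))"
      by (simp flip: p(2))
    then have "norm (exp (\<phi> (d / 2))) = 1" by simp
    then have "Re (\<phi> (d / 2)) = 0" by simp
    then show False using d(2)[of "d / 2"] d(1) \<open>\<sigma> > 0\<close> by simp
  qed
  have neg: "Re (\<phi> \<theta>) < 0" if "\<bar>\<theta>\<bar> \<le> pi" "\<theta> \<noteq> 0" for \<theta>
    using infinitely_divisible_norm_char_less_1[OF p(1,3) nontriv that] by (simp only: p(2) norm_exp_eq_Re) simp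
  define S where "S = {-pi..pi} - {-d<..<d}"
  have "compact S" unfolding S_def by (intro compact_diff compact_Icc open_greaterThanLessThan)
  obtain e where e: "e > 0" "\<And>\<theta>. \<theta> \<in> S \<Longrightarrow> Re (\<phi> \<theta>) \<le> - e"
  proof (cases "S = {}")
    case True
    then show ?thesis using that[of 1] by simp
  next
    case False
    have "continuous_on S (\<lambda>\<theta>. Re (\<phi> \<theta>))"
      by (intro continuous_intros continuous_on_subset[OF \<phi>(1)]) auto
    from continuous_attains_sup[OF \<open>compact S\<close> False this]
    obtain x where x: "x \<in> S" "\<forall>y\<in>S. Re (\<phi> y) \<le> Re (\<phi> x)" by blast
    have "Re (\<phi> x) < 0" using x(1) d(1) by (intro neg) (auto simp: S_def)
    then show ?thesis using that[of "- Re (\<phi> x)"] x by simp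
  qed
  \<comment> \<open>The second entry converts the constant bound - e into a quadratic one, by
    \<theta>^2 \<le> pi^2.\<close>
  define c where "c = min (\<sigma>\<^sup>2 / 4) (e / pi\<^sup>2)"
  show ?thesis
  proof
    show "c > 0" using \<open>\<sigma> > 0\<close> e(1) by (simp add: c_def)
    fix \<theta> :: real assume \<theta>: "\<bar>\<theta>\<bar> \<le> pi"
    show "Re (\<phi> \<theta>) \<le> - c * \<theta>\<^sup>2"
    proof (cases "\<bar>\<theta>\<bar> < d")
      case True
      have "c * \<theta>\<^sup>2 \<le> (\<sigma>\<^sup>2 / 4) * \<theta>\<^sup>2" unfolding c_def by (intro mult_right_mono min.cobounded1) simp
      then show ?thesis using near[OF True] by simp
    next
      case False
      have "\<theta>\<^sup>2 \<le> pi\<^sup>2" using power_mono[OF \<theta>, of 2] by simp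
      then have "c * \<theta>\<^sup>2 \<le> (e / pi\<^sup>2) * pi\<^sup>2" unfolding c_def using e(1) by (intro mult_mono min.cobounded2) auto
      then have "c * \<theta>\<^sup>2 \<le> e" by simp
      moreover have "\<theta> \<in> S" using False \<theta> by (auto simp: S_def abs_le_iff)
      ultimately show ?thesis using e(2) by fastforce
    qed
  qed
qed

lemma compact_torus: "compact (torus :: (real ^ 'd) set)"
proof -
  have "(torus :: (real ^ 'd) set) = cbox (\<chi> j. - pi) (\<chi> j. pi)"
    by (auto simp: torus_def mem_box_cart abs_le_iff minus_le_iff)
  then show ?thesis by (metis compact_cbox)
qed

lemma continuous_bounded_on_torus:
  fixes g :: "real ^ 'd \<Rightarrow> complex"
  assumes "continuous_on UNIV g"
  obtains B where "B \<ge> 0" "\<And>\<xi>. \<xi> \<in> torus \<Longrightarrow> norm (g \<xi>) \<le> B"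
proof -
  have "bounded (g ` torus)"
    using assms by (intro compact_imp_bounded compact_continuous_image compact_torus) (auto intro: continuous_on_subset)
  then show ?thesis using that unfolding bounded_pos by (metis image_eqI less_imp_le)
qed

text \<open>All derivatives up to order K are continuous and so bounded on the compact torus. The
  first one is i m where \<xi>_j = 0, and the bound on the second one turns this into a linear
  estimate in |\<xi>_j|.\<close>

lemma reference_exponent_deriv_bounds:
  fixes j :: "'d::finite"
  assumes ref: "reference_exponent K \<phi> m \<sigma>" and K: "K \<ge> 2"
  obtains C where "C \<ge> 0"
    and "\<And>\<xi> :: real ^ 'd. \<xi> \<in> torus \<Longrightarrow> norm (partial j (\<lambda>\<xi>. \<phi> (\<xi> $ j)) \<xi> - \<i> * of_real m) \<le> C * \<bar>\<xi> $ j\<bar>"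
    and "\<And>\<xi> :: real ^ 'd. \<And>l. \<xi> \<in> torus \<Longrightarrow> 2 \<le> l \<Longrightarrow> l \<le> K \<Longrightarrow>
      norm ((partial j ^^ l) (\<lambda>\<xi>. \<phi> (\<xi> $ j)) \<xi>) \<le> C"
proof -
  let ?f = "\<lambda>\<xi> :: real ^ 'd. \<phi> (\<xi> $ j)"
  have f: "class_C K ?f" by (rule reference_exponent_smooth[OF ref])
  have "\<exists>B. \<forall>\<xi>\<in>torus. norm ((partial j ^^ l) ?f \<xi>) \<le> B" if "l \<le> K" for l
  proof -
    have "class_C 0 ((partial j ^^ l) ?f)"
      unfolding funpow_partial_eq_foldr using class_C_mono[OF f that] by (intro class_C_foldr_partial) simp
    then show ?thesis using continuous_bounded_on_torus by (metis class_C.simps(1))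
  qed
  then obtain B where B: "\<And>l \<xi>. l \<le> K \<Longrightarrow> \<xi> \<in> torus \<Longrightarrow> norm ((partial j ^^ l) ?f \<xi>) \<le> B l"
    by metis
  define C where "C = (\<Sum>l\<le>K. \<bar>B l\<bar>)"
  have C: "norm ((partial j ^^ l) ?f \<xi>) \<le> C" if "l \<le> K" "\<xi> \<in> torus" for l \<xi>
  proof -
    have "B l \<le> \<bar>B l\<bar>" by simp
    also have "\<dots> \<le> C" unfolding C_def using that by (intro member_le_sum) auto
    finally show ?thesis using B[OF that] by simp
  qed
  \<comment> \<open>On this hyperplane the derivative is \<phi>'(0), which the expansion of \<phi>
    at 0 identifies.\<close>
  have at0: "partial j ?f \<xi> = \<i> * of_real m" if "\<xi> $ j = 0" for \<xi>
  proof (rule partial_eqI)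
    have \<phi>0: "\<phi> 0 = 0" using ref by (simp add: reference_exponent_def)
    have "((\<lambda>\<theta>. ((\<phi> \<theta> - \<i> * of_real (m * \<theta>)) / of_real (\<theta>\<^sup>2)) * of_real \<theta> + \<i> * of_real m)
       \<longlongrightarrow> - of_real (\<sigma>\<^sup>2 / 2) * of_real 0 + \<i> * of_real m) (at 0)"
      by (intro tendsto_intros reference_exponent_quotient[OF ref])
    then have "((\<lambda>\<theta>. (\<phi> \<theta> - \<phi> 0) /\<^sub>R (\<theta> - 0)) \<longlongrightarrow> \<i> * of_real m) (at 0)"
      unfolding of_real_0 mult_zero_right add_0_left
    proof (rule Lim_transform_eventually)
      show "\<forall>\<^sub>F \<theta> in at 0. ((\<phi> \<theta> - \<i> * of_real (m * \<theta>)) / of_real (\<theta>\<^sup>2)) * of_real \<theta> + \<i> * of_real m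
        = (\<phi> \<theta> - \<phi> 0) /\<^sub>R (\<theta> - 0)"
        by (rule eventually_mono[OF eventually_neq_at_within[of 0]])
           (auto simp: \<phi>0 scaleR_conv_of_real field_simps power2_eq_square)
    qed
    then have "(\<phi> has_vector_derivative \<i> * of_real m) (at (\<xi> $ j))"
      unfolding that by (rule has_vector_derivative_quotientI)
    from has_vector_derivative_coordinate[OF this, of j]
    show "((\<lambda>t. \<phi> ((\<xi> + t *\<^sub>R axis j 1) $ j)) has_vector_derivative \<i> * of_real m) (at 0)" by simp
  qed
  obtain K' where K': "K = Suc (Suc K')" using K by (metis add_2_eq_Suc le_Suc_ex)
  have p1: "class_C (Suc K') (partial j ?f)" using f K' by simp
  show ?thesis
  proof
    show "C \<ge> 0" unfolding C_def by (simp add: sum_nonneg)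
    fix \<xi> :: "real ^ 'd" assume \<xi>: "\<xi> \<in> torus"
    \<comment> \<open>The projection of \<xi> to the hyperplane where the value of the derivative is
      known; the segment back to \<xi> stays in the torus.\<close>
    define x where "x = \<xi> - (\<xi> $ j) *\<^sub>R axis j 1"
    have xj: "x $ j = 0" by (simp add: x_def axis_def)
    have "norm (partial j ?f (x + (\<xi> $ j) *\<^sub>R axis j 1) - partial j ?f x) \<le> \<bar>\<xi> $ j\<bar> * C"
    proof (rule norm_line_diff_abs_le[OF p1])
      fix t assume t: "\<bar>t\<bar> \<le> \<bar>\<xi> $ j\<bar>"
      have "x + t *\<^sub>R axis j 1 \<in> torus"
        unfolding torus_def
      proof (intro CollectI allI)
        fix i
        show "\<bar>(x + t *\<^sub>R axis j 1) $ i\<bar> \<le> pi"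
          using \<xi> t unfolding torus_def x_def axis_def by (cases "i = j") (auto intro: order.trans)
      qed
      from C[OF K this] show "norm (partial j (partial j ?f) (x + t *\<^sub>R axis j 1)) \<le> C"
        by (simp add: numeral_2_eq_2)
    qed
    then show "norm (partial j ?f \<xi> - \<i> * of_real m) \<le> C * \<bar>\<xi> $ j\<bar>"
      using at0[OF xj] by (simp add: x_def mult.commute)
  qed (use C in auto)
qed

section \<open>Integration over \<open>\<real>\<^sup>d\<close>\<close>

lemma Basis_cart: "(Basis :: (real ^ 'd) set) = range (\<lambda>j. axis j 1)"
  by (simp add: Basis_vec_def UNION_singleton_eq_range)

lemma inj_axis_1: "inj (\<lambda>j. axis j (1 :: real))"
  by (simp add: inj_on_def axis_eq_axis)

text \<open>Lebesgue measure is a product measure indexed by the basis vectors. Naming these by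
  coordinates makes the Fubini theorem for finite products applicable to
  \<open>real ^ 'd\<close>.\<close>

lemma lborel_cart_eq:
  "(lborel :: (real ^ 'd) measure) = distr (\<Pi>\<^sub>M b\<in>Basis. lborel) borel (\<lambda>f. \<chi> j. f (axis j (1 :: real)))"
proof -
  have "(\<Sum>b\<in>Basis. f b *\<^sub>R b) = (\<chi> j. f (axis j 1))" for f :: "real ^ 'd \<Rightarrow> real"
    unfolding Basis_cart sum.reindex[OF inj_axis_1] o_def
    by (simp add: vec_eq_iff) (simp add: axis_def if_distrib[of "\<lambda>c. _ * c"] cong: if_cong)
  then show ?thesis
    using lborel_eq[where 'a = "real ^ 'd"] by simp
qed

lemma prod_cart_Basis:
  fixes f :: "'d::finite \<Rightarrow> real \<Rightarrow> 'b::comm_monoid_mult"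
  shows "(\<Prod>j\<in>UNIV. f j (x (axis j 1))) = (\<Prod>b\<in>(Basis :: (real ^ 'd) set). f (axis_index b) (x b))"
  unfolding Basis_cart prod.reindex[OF inj_axis_1] o_def by simp

lemma
  fixes f :: "'d::finite \<Rightarrow> real \<Rightarrow> 'b::{real_normed_field,banach,second_countable_topology}"
  assumes f: "\<And>j. integrable lborel (f j)"
  shows integrable_prod_cart: "integrable lborel (\<lambda>x :: real ^ 'd. \<Prod>j\<in>UNIV. f j (x $ j))"
    and integral_prod_cart: "(LINT x|lborel. (\<Prod>j\<in>UNIV. f j ((x :: real ^ 'd) $ j))) = (\<Prod>j\<in>UNIV. integral\<^sup>L lborel (f j))"
proof -
  interpret product_sigma_finite "\<lambda>_ :: real ^ 'd. lborel :: real measure"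
    by standard
  have [measurable]: "f j \<in> borel_measurable borel" for j
    using borel_measurable_integrable[OF f] by simp
  have m: "(\<lambda>f. \<chi> j. f (axis j (1 :: real))) \<in> (\<Pi>\<^sub>M b\<in>(Basis :: (real ^ 'd) set). lborel) \<rightarrow>\<^sub>M (borel :: (real ^ 'd) measure)"
    by (rule borel_measurable_euclidean_space[THEN iffD2])
       (auto simp: inner_axis Basis_vec_def intro!: measurable_component_singleton
         measurable_compose[OF measurable_component_singleton])
  have m2: "(\<lambda>x :: real ^ 'd. \<Prod>j\<in>UNIV. f j (x $ j)) \<in> borel_measurable borel"
    by measurable
  have i: "integrable (\<Pi>\<^sub>M b\<in>(Basis :: (real ^ 'd) set). lborel) (\<lambda>x. \<Prod>b\<in>Basis. f (axis_index b) (x b))"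
    by (intro product_integrable_prod f finite_Basis)
  show "integrable lborel (\<lambda>x :: real ^ 'd. \<Prod>j\<in>UNIV. f j (x $ j))"
    by (subst lborel_cart_eq, subst integrable_distr_eq[OF m m2]) (simp add: prod_cart_Basis i)
  have "(LINT x|lborel. (\<Prod>j\<in>UNIV. f j ((x :: real ^ 'd) $ j))) = (\<Prod>b\<in>(Basis :: (real ^ 'd) set). integral\<^sup>L lborel (f (axis_index b)))"
    by (subst lborel_cart_eq, subst integral_distr[OF m m2]) (simp add: prod_cart_Basis product_integral_prod[OF finite_Basis f])
  also have "\<dots> = (\<Prod>j\<in>UNIV. integral\<^sup>L lborel (f j))"
    unfolding Basis_cart prod.reindex[OF inj_axis_1] o_def by simp
  finally show "(LINT x|lborel. (\<Prod>j\<in>UNIV. f j ((x :: real ^ 'd) $ j))) = (\<Prod>j\<in>UNIV. integral\<^sup>L lborel (f j))" .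
qed

lemma
  fixes f :: "real ^ 'd \<Rightarrow> 'b::{banach,second_countable_topology}" and c t :: "real ^ 'd"
  assumes c: "\<And>j. c $ j > 0" and f [measurable]: "f \<in> borel_measurable borel"
  shows integrable_diag_scale: "integrable lborel (\<lambda>x. f (t + (\<chi> j. c $ j * x $ j))) \<longleftrightarrow> integrable lborel f"
    and integral_diag_scale: "integral\<^sup>L lborel f = (\<Prod>j\<in>UNIV. c $ j) *\<^sub>R (LINT x|lborel. f (t + (\<chi> j. c $ j * x $ j)))"
proof -
  let ?T = "\<lambda>x. t + (\<chi> j. c $ j * x $ j)"
  have T: "t + (\<Sum>b\<in>Basis. (c $ axis_index b * (x \<bullet> b)) *\<^sub>R b) = ?T x" for x
    unfolding Basis_cart sum.reindex[OF inj_axis_1] o_def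
    by (simp add: vec_eq_iff inner_axis) (simp add: axis_def if_distrib[of "\<lambda>c. _ * c"] cong: if_cong)
  have P: "(\<Prod>b\<in>(Basis :: (real ^ 'd) set). \<bar>c $ axis_index b\<bar>) = (\<Prod>j\<in>UNIV. c $ j)"
    unfolding Basis_cart prod.reindex[OF inj_axis_1] o_def using c by (simp add: abs_of_pos)
  have lb: "(lborel :: (real ^ 'd) measure) = density (distr lborel borel ?T) (\<lambda>_. ennreal (\<Prod>j\<in>UNIV. c $ j))"
    using lborel_affine_euclidean[of "\<lambda>b. c $ axis_index b" t] c unfolding T P
    by (simp add: less_imp_neq[symmetric])
  have [measurable]: "?T \<in> borel \<rightarrow>\<^sub>M borel"
    by (intro borel_measurable_continuous_onI continuous_intros)
  have pos: "(\<Prod>j\<in>UNIV. c $ j) > 0" by (intro prod_pos) (use c in auto)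
  show "integrable lborel (\<lambda>x. f (?T x)) \<longleftrightarrow> integrable lborel f"
  proof -
    have "integrable lborel f \<longleftrightarrow> integrable lborel (\<lambda>x. (\<Prod>j\<in>UNIV. c $ j) *\<^sub>R f (?T x))"
      using pos by (subst lb) (simp add: integrable_density integrable_distr_eq)
    also have "\<dots> \<longleftrightarrow> integrable lborel (\<lambda>x. f (?T x))"
    proof
      assume "integrable lborel (\<lambda>x. (\<Prod>j\<in>UNIV. c $ j) *\<^sub>R f (?T x))"
      from integrable_scaleR_right[OF this, of "inverse (\<Prod>j\<in>UNIV. c $ j)"] pos
      show "integrable lborel (\<lambda>x. f (?T x))" by (simp add: less_imp_neq[symmetric])
    qed (rule integrable_scaleR_right)
    finally show ?thesis by simp
  qed
  show "integral\<^sup>L lborel f = (\<Prod>j\<in>UNIV. c $ j) *\<^sub>R (LINT x|lborel. f (?T x))"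
    using pos by (subst lb) (simp add: integral_density integral_distr)
qed

section \<open>Integrability of Gaussians, power tails and the inverse weight\<close>

lemma integrable_gaussian:
  assumes "c > 0"
  shows "integrable lborel (\<lambda>x :: real. exp (- c * x\<^sup>2))"
proof -
  define s where "s = 1 / sqrt (2 * c)"
  have s: "s > 0" "s\<^sup>2 = 1 / (2 * c)"
    using assms by (auto simp: s_def power_divide)
  have "integrable lborel (\<lambda>x. sqrt (2 * pi * s\<^sup>2) * normal_density 0 s x)"
    using s by (intro integrable_mult_right integrable_normal_density)
  moreover have "sqrt (2 * pi * s\<^sup>2) * normal_density 0 s x = exp (- c * x\<^sup>2)" for x
    using s(1) assms unfolding normal_density_def s(2) by simp
  ultimately show ?thesis by simp
qed

lemma norm_cart_power2: "(norm (x :: real ^ 'd))\<^sup>2 = (\<Sum>j\<in>UNIV. (x $ j)\<^sup>2)"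
  by (simp add: norm_vec_def L2_set_def sum_nonneg)

lemma exp_norm_cart: "exp (- c * (norm (x :: real ^ 'd))\<^sup>2) = (\<Prod>j\<in>UNIV. exp (- c * (x $ j)\<^sup>2))"
  by (simp add: norm_cart_power2 sum_distrib_left flip: exp_sum)

lemma integrable_gaussian_cart:
  assumes "c > 0"
  shows "integrable lborel (\<lambda>x :: real ^ 'd. exp (- c * (norm x)\<^sup>2))"
  unfolding exp_norm_cart by (intro integrable_prod_cart integrable_gaussian assms)

text \<open>Half of the Gaussian absorbs the polynomial: (1 + t)^N \<le> exp(N t), and N t \<le> N^2
  / (2 c) + c t^2 / 2 by completing the square, which is the origin of \<open>B\<close>.\<close>

lemma integrable_gaussian_moment_cart:
  assumes c: "c > 0"
  shows "integrable lborel (\<lambda>x :: real ^ 'd. (1 + norm x) ^ N * exp (- c * (norm x)\<^sup>2))"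
proof (rule Bochner_Integration.integrable_bound)
  define B where "B = exp ((real N)\<^sup>2 / (2 * c))"
  show "integrable lborel (\<lambda>x :: real ^ 'd. B * exp (- (c / 2) * (norm x)\<^sup>2))"
    using c by (intro integrable_mult_right integrable_gaussian_cart) auto
  show "AE x :: real ^ 'd in lborel. norm ((1 + norm x) ^ N * exp (- c * (norm x)\<^sup>2)) \<le> norm (B * exp (- (c / 2) * (norm x)\<^sup>2))"
  proof (rule AE_I2)
    fix x :: "real ^ 'd"
    define t where "t = norm x"
    have "t \<ge> 0" by (simp add: t_def)
    have "(1 + t) ^ N \<le> exp t ^ N"
      using \<open>t \<ge> 0\<close> exp_ge_add_one_self[of t] by (intro power_mono) auto
    also have "\<dots> = exp (real N * t)" by (simp add: exp_of_nat_mult)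
    also have "real N * t \<le> (real N)\<^sup>2 / (2 * c) + c / 2 * t\<^sup>2"
    proof -
      have "0 \<le> (real N - c * t)\<^sup>2 / (2 * c)" using c by simp
      also have "\<dots> = (real N)\<^sup>2 / (2 * c) + c / 2 * t\<^sup>2 - real N * t"
        using c by (simp add: power2_diff field_simps power2_eq_square)
      finally show ?thesis by simp
    qed
    finally have "(1 + t) ^ N \<le> B * exp (c / 2 * t\<^sup>2)" by (simp add: B_def exp_add)
    then have "(1 + t) ^ N * exp (- c * t\<^sup>2) \<le> B * exp (c / 2 * t\<^sup>2) * exp (- c * t\<^sup>2)"
      by (intro mult_right_mono) auto
    also have "\<dots> = B * exp (- (c / 2) * t\<^sup>2)"
      by (simp add: mult.assoc flip: exp_add)
    finally show "norm ((1 + norm x) ^ N * exp (- c * (norm x)\<^sup>2)) \<le> norm (B * exp (- (c / 2) * (norm x)\<^sup>2))"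
      using \<open>t \<ge> 0\<close> by (simp add: t_def B_def)
  qed
qed measurable

lemma integrable_powr_tail:
  assumes "p > 1"
  shows "integrable lborel (\<lambda>x :: real. (1 + \<bar>x\<bar>) powr (- p))"
proof -
  let ?v = "\<lambda>x :: real. (1 + \<bar>x\<bar>) powr (- p)"
  let ?F = "\<lambda>x :: real. - ((1 + x) powr (1 - p) / (p - 1))"
  have "((\<lambda>x :: real. (1 + x) powr (1 - p)) \<longlongrightarrow> 0) at_top"
    using assms by (intro tendsto_neg_powr filterlim_tendsto_add_at_top[OF tendsto_const] filterlim_ident) auto
  then have lim: "(?F \<longlongrightarrow> - (0 / (p - 1))) at_top"
    using assms by (intro tendsto_intros) auto
  have "(\<integral>\<^sup>+x. ennreal ((1 + x) powr (- p)) * indicator {0..} x \<partial>lborel) = - (0 / (p - 1)) - ?F 0"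
  proof (rule nn_integral_FTC_atLeast[OF _ _ _ lim])
    fix x :: real assume "0 \<le> x"
    then have "((\<lambda>x. (1 + x) powr (1 - p)) has_real_derivative (1 - p) * (1 + x) powr (1 - p - 1) * (0 + 1)) (at x)"
      by (intro DERIV_chain2[of "\<lambda>y. y powr (1 - p)"] has_real_derivative_powr DERIV_add DERIV_const DERIV_ident) auto
    from DERIV_minus[OF DERIV_cdivide[OF this, of "p - 1"]]
    show "(?F has_real_derivative (1 + x) powr (- p)) (at x)"
    proof (rule DERIV_cong)
      have "- ((1 - p) * y / (p - 1)) = y" for y
        using assms by (simp add: field_simps)
      then show "- ((1 - p) * (1 + x) powr (1 - p - 1) * (0 + 1) / (p - 1)) = (1 + x) powr (- p)"
        by simp
    qed
  qed auto
  then have half: "(\<integral>\<^sup>+x. ennreal (?v x) * indicator {0..} x \<partial>lborel) < \<infinity>"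
  proof -
    have "(\<integral>\<^sup>+x. ennreal (?v x) * indicator {0..} x \<partial>lborel) = (\<integral>\<^sup>+x. ennreal ((1 + x) powr (- p)) * indicator {0..} x \<partial>lborel)"
      by (intro nn_integral_cong) (auto split: split_indicator)
    moreover assume "(\<integral>\<^sup>+x. ennreal ((1 + x) powr (- p)) * indicator {0..} x \<partial>lborel) = - (0 / (p - 1)) - ?F 0"
    ultimately show ?thesis by simp
  qed
  have "(\<integral>\<^sup>+x. ennreal (?v x) * indicator {0..} x \<partial>lborel)
      = (\<integral>\<^sup>+x. ennreal (?v x) * indicator {..0} x \<partial>lborel)"
  proof -
    have "(\<integral>\<^sup>+x. ennreal (?v x) * indicator {0..} x \<partial>lborel)
      = (\<integral>\<^sup>+x. ennreal (?v (0 + - 1 * x)) * indicator {0..} (0 + - 1 * x) \<partial>lborel)"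
      by (subst nn_integral_real_affine[where c = "- 1" and t = 0]) auto
    also have "\<dots> = (\<integral>\<^sup>+x. ennreal (?v x) * indicator {..0} x \<partial>lborel)"
      by (intro nn_integral_cong) (auto split: split_indicator)
    finally show ?thesis .
  qed
  with half have half': "(\<integral>\<^sup>+x. ennreal (?v x) * indicator {..0} x \<partial>lborel) < \<infinity>" by simp
  have "(\<integral>\<^sup>+x. ennreal (?v x) \<partial>lborel)
     \<le> (\<integral>\<^sup>+x. ennreal (?v x) * indicator {0..} x + ennreal (?v x) * indicator {..0} x \<partial>lborel)"
    by (intro nn_integral_mono) (auto split: split_indicator)
  also have "\<dots> < \<infinity>"
    using half half' by (subst nn_integral_add) auto
  finally show ?thesis
    by (intro integrableI_nonneg) auto
qed

text \<open>The weight is compared with a product of one-dimensional powers of exponent p = 2 K / d,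
  and p > 1 is precisely the hypothesis. If t is the largest |x_j|, the product of the (1 + |x_j|)^p
  is at most (1 + t)^(2 K), which is at most 2^(2 K) times the weight.\<close>

lemma integrable_inverse_weight:
  assumes "2 * K > CARD('d)"
  shows "integrable lborel (\<lambda>x :: real ^ 'd. 1 / (1 + (\<Sum>j\<in>UNIV. \<bar>x $ j\<bar> ^ (2 * K))))"
proof (rule Bochner_Integration.integrable_bound)
  define p where "p = 2 * real K / real CARD('d)"
  have p: "p > 1" "p * real CARD('d) = real (2 * K)" using assms by (auto simp: p_def field_simps)
  show "integrable lborel (\<lambda>x :: real ^ 'd. 2 ^ (2 * K) * (\<Prod>j\<in>UNIV. (1 + \<bar>x $ j\<bar>) powr (- p)))"
    by (intro integrable_mult_right integrable_prod_cart integrable_powr_tail p)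
  show "AE x :: real ^ 'd in lborel. norm (1 / (1 + (\<Sum>j\<in>UNIV. \<bar>x $ j\<bar> ^ (2 * K))))
     \<le> norm (2 ^ (2 * K) * (\<Prod>j\<in>UNIV. (1 + \<bar>x $ j\<bar>) powr (- p)))"
  proof (rule AE_I2)
    fix x :: "real ^ 'd"
    define W where "W = 1 + (\<Sum>j\<in>UNIV. \<bar>x $ j\<bar> ^ (2 * K))"
    define t where "t = Max (range (\<lambda>j. \<bar>x $ j\<bar>))"
    have t: "\<bar>x $ j\<bar> \<le> t" for j unfolding t_def by (intro Max_ge) auto
    have "t \<in> range (\<lambda>j. \<bar>x $ j\<bar>)" unfolding t_def by (intro Max_in) auto
    then obtain i where i: "t = \<bar>x $ i\<bar>" by blast
    have "W \<ge> 1" unfolding W_def by (simp add: sum_nonneg)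
    have "\<bar>x $ i\<bar> ^ (2 * K) \<le> (\<Sum>j\<in>UNIV. \<bar>x $ j\<bar> ^ (2 * K))"
      by (rule member_le_sum) auto
    then have tW: "1 + t ^ (2 * K) \<le> W" by (simp add: W_def i)
    have "(\<Prod>j\<in>UNIV. (1 + \<bar>x $ j\<bar>) powr p) \<le> (\<Prod>j\<in>(UNIV :: 'd set). (1 + t) powr p)"
      using p t by (intro prod_mono conjI powr_mono2) auto
    also have "\<dots> = (1 + t) powr (p * real CARD('d))"
      using i by (simp add: powr_power mult.commute)
    also have "\<dots> = (1 + t) ^ (2 * K)"
      unfolding p(2) using i by (intro powr_realpow) auto
    also have "\<dots> \<le> (2 * max 1 t) ^ (2 * K)" using i by (intro power_mono) auto
    also have "\<dots> = 2 ^ (2 * K) * (max 1 t) ^ (2 * K)" by (rule power_mult_distrib)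
    also have "\<dots> \<le> 2 ^ (2 * K) * W"
      using tW i \<open>W \<ge> 1\<close> by (intro mult_left_mono) (auto simp: max_def)
    finally have le: "(\<Prod>j\<in>UNIV. (1 + \<bar>x $ j\<bar>) powr p) \<le> 2 ^ (2 * K) * W" .
    have pos: "(\<Prod>j\<in>UNIV. (1 + \<bar>x $ j\<bar>) powr p) > 0" by (intro prod_pos) auto
    have "1 / W \<le> 2 ^ (2 * K) / (\<Prod>j\<in>UNIV. (1 + \<bar>x $ j\<bar>) powr p)"
      using le pos \<open>W \<ge> 1\<close> by (simp add: divide_simps)
    also have "\<dots> = 2 ^ (2 * K) * (\<Prod>j\<in>UNIV. (1 + \<bar>x $ j\<bar>) powr (- p))"
      by (simp add: powr_minus divide_inverse prod_inversef[symmetric] o_def)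
    finally show "norm (1 / (1 + (\<Sum>j\<in>UNIV. \<bar>x $ j\<bar> ^ (2 * K))))
     \<le> norm (2 ^ (2 * K) * (\<Prod>j\<in>UNIV. (1 + \<bar>x $ j\<bar>) powr (- p)))"
      using \<open>W \<ge> 1\<close> by (simp add: W_def prod_nonneg)
  qed
qed measurable

text \<open>Truncating \<open>\<bar>u\<bar>\<close> at \<open>1 / (\<epsilon> W)\<close> changes the integral by at most
  \<open>\<epsilon> \<integral> W \<bar>u\<bar>\<^sup>2\<close>, and the truncated functions are dominated.\<close>

lemma tendsto_integral_norm_weighted:
  fixes A :: "nat \<Rightarrow> 'a \<Rightarrow> complex"
  assumes A [measurable]: "\<And>n. A n \<in> borel_measurable M" and A' [measurable]: "A' \<in> borel_measurable M"
    and W [measurable]: "W \<in> borel_measurable M" and Wpos: "\<And>x. W x > 0"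
    and Wint: "integrable M (\<lambda>x. 1 / W x)"
    and lim: "\<And>x. (\<lambda>n. A n x) \<longlonglongrightarrow> A' x"
    and bound: "\<And>n. (\<integral>\<^sup>+x. ennreal (W x * (norm (A n x))\<^sup>2) \<partial>M) \<le> ennreal C" and "C \<ge> 0"
  shows "(\<lambda>n. LINT x|M. norm (A n x)) \<longlonglongrightarrow> (LINT x|M. norm (A' x))"
proof -
  \<comment> \<open>Fatou's lemma transfers the weighted bound to the limit function, which
    therefore admits the same truncation estimate.\<close>
  have "(\<integral>\<^sup>+x. ennreal (W x * (norm (A' x))\<^sup>2) \<partial>M)
      = (\<integral>\<^sup>+x. liminf (\<lambda>n. ennreal (W x * (norm (A n x))\<^sup>2)) \<partial>M)"
  proof (rule nn_integral_cong)
    fix x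
    have "(\<lambda>n. ennreal (W x * (norm (A n x))\<^sup>2)) \<longlonglongrightarrow> ennreal (W x * (norm (A' x))\<^sup>2)"
      by (intro tendsto_intros lim)
    then show "ennreal (W x * (norm (A' x))\<^sup>2) = liminf (\<lambda>n. ennreal (W x * (norm (A n x))\<^sup>2))"
      by (simp add: lim_imp_Liminf)
  qed
  also have "\<dots> \<le> liminf (\<lambda>n. (\<integral>\<^sup>+x. ennreal (W x * (norm (A n x))\<^sup>2) \<partial>M))"
    by (intro nn_integral_liminf) auto
  also have "\<dots> \<le> ennreal C"
    using bound by (intro Liminf_le) (auto intro!: always_eventually)
  finally have bound': "(\<integral>\<^sup>+x. ennreal (W x * (norm (A' x))\<^sup>2) \<partial>M) \<le> ennreal C" .
  have int2: "integrable M (\<lambda>x. W x * (norm (u x))\<^sup>2)" "(LINT x|M. W x * (norm (u x))\<^sup>2) \<le> C"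
    if [measurable]: "u \<in> borel_measurable M" and u: "(\<integral>\<^sup>+x. ennreal (W x * (norm (u x))\<^sup>2) \<partial>M) \<le> ennreal C" for u :: "'a \<Rightarrow> complex"
  proof -
    show i: "integrable M (\<lambda>x. W x * (norm (u x))\<^sup>2)"
      using u Wpos by (intro integrableI_nonneg) (auto simp: less_imp_le intro: order.strict_trans1)
    then have "ennreal (LINT x|M. W x * (norm (u x))\<^sup>2) \<le> ennreal C"
      using u Wpos by (subst nn_integral_eq_integral[symmetric]) (auto simp: less_imp_le)
    then show "(LINT x|M. W x * (norm (u x))\<^sup>2) \<le> C" using \<open>C \<ge> 0\<close> by simp
  qed
  define B where "B = (\<lambda>\<epsilon> (u :: 'a \<Rightarrow> complex) x. min (norm (u x)) (1 / (\<epsilon> * W x)))"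
  have Bmeas [measurable]: "B \<epsilon> u \<in> borel_measurable M" if "u \<in> borel_measurable M" for \<epsilon> u
    using that unfolding B_def by measurable
  have diff: "\<bar>norm (u x) - B \<epsilon> u x\<bar> \<le> \<epsilon> * (W x * (norm (u x))\<^sup>2)" if "\<epsilon> > 0" for \<epsilon> u x
  proof (cases "norm (u x) \<le> 1 / (\<epsilon> * W x)")
    case True
    then show ?thesis using that Wpos[of x] by (simp add: B_def)
  next
    case False
    then have "1 \<le> norm (u x) * (\<epsilon> * W x)"
      using that Wpos[of x] by (simp add: field_simps)
    then have "norm (u x) * 1 \<le> norm (u x) * (norm (u x) * (\<epsilon> * W x))"
      by (intro mult_left_mono) auto
    then have le: "norm (u x) \<le> \<epsilon> * (W x * (norm (u x))\<^sup>2)" by (simp add: power2_eq_square mult_ac)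
    have "0 \<le> 1 / (\<epsilon> * W x)" using that Wpos[of x] by simp
    moreover have "B \<epsilon> u x = 1 / (\<epsilon> * W x)" using False by (simp add: B_def)
    ultimately show ?thesis using False le by linarith
  qed
  have Bint: "integrable M (B \<epsilon> u)" if "\<epsilon> > 0" "u \<in> borel_measurable M" for \<epsilon> u
  proof (rule Bochner_Integration.integrable_bound)
    show "integrable M (\<lambda>x. (1 / \<epsilon>) * (1 / W x))" by (rule integrable_mult_right[OF Wint])
    show "AE x in M. norm (B \<epsilon> u x) \<le> norm ((1 / \<epsilon>) * (1 / W x))"
      using that Wpos by (auto simp: B_def less_imp_le)
  qed (use that in auto)
  have close: "\<bar>(LINT x|M. norm (u x)) - (LINT x|M. B \<epsilon> u x)\<bar> \<le> \<epsilon> * C"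
    if \<epsilon>: "\<epsilon> > 0" and [measurable]: "u \<in> borel_measurable M" and u: "(\<integral>\<^sup>+x. ennreal (W x * (norm (u x))\<^sup>2) \<partial>M) \<le> ennreal C" for \<epsilon> u
  proof -
    note i2 = int2[OF that(2,3)]
    have idiff: "integrable M (\<lambda>x. norm (u x) - B \<epsilon> u x)"
    proof (rule Bochner_Integration.integrable_bound)
      show "integrable M (\<lambda>x. \<epsilon> * (W x * (norm (u x))\<^sup>2))" by (rule integrable_mult_right[OF i2(1)])
      show "AE x in M. norm (norm (u x) - B \<epsilon> u x) \<le> norm (\<epsilon> * (W x * (norm (u x))\<^sup>2))"
        unfolding real_norm_def by (intro AE_I2 order.trans[OF diff[OF \<epsilon>] abs_ge_self])
    qed measurable
    have "integrable M (\<lambda>x. (norm (u x) - B \<epsilon> u x) + B \<epsilon> u x)"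
      by (intro Bochner_Integration.integrable_add idiff Bint \<epsilon>) measurable
    then have "integrable M (\<lambda>x. norm (u x))" by simp
    then have "(LINT x|M. norm (u x)) - (LINT x|M. B \<epsilon> u x) = (LINT x|M. norm (u x) - B \<epsilon> u x)"
      by (subst Bochner_Integration.integral_diff) (auto intro: Bint \<epsilon>)
    also have "\<bar>\<dots>\<bar> \<le> (LINT x|M. \<epsilon> * (W x * (norm (u x))\<^sup>2))"
    proof -
      have "\<bar>LINT x|M. norm (u x) - B \<epsilon> u x\<bar> \<le> (LINT x|M. \<bar>norm (u x) - B \<epsilon> u x\<bar>)"
        by (rule integral_abs_bound)
      also have "\<dots> \<le> (LINT x|M. \<epsilon> * (W x * (norm (u x))\<^sup>2))"
        by (intro integral_mono integrable_abs idiff integrable_mult_right i2(1) diff[OF \<epsilon>])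
      finally show ?thesis .
    qed
    also have "\<dots> \<le> \<epsilon> * C" using i2(2) \<epsilon> by simp
    finally show ?thesis .
  qed
  have limB: "(\<lambda>n. LINT x|M. B \<epsilon> (A n) x) \<longlonglongrightarrow> (LINT x|M. B \<epsilon> A' x)" if \<epsilon>: "\<epsilon> > 0" for \<epsilon>
  proof (rule integral_dominated_convergence[where w = "\<lambda>x. (1 / \<epsilon>) * (1 / W x)"])
    show "AE x in M. (\<lambda>n. B \<epsilon> (A n) x) \<longlonglongrightarrow> B \<epsilon> A' x"
      unfolding B_def by (intro AE_I2 tendsto_min tendsto_norm lim tendsto_const)
    show "AE x in M. norm (B \<epsilon> (A n) x) \<le> (1 / \<epsilon>) * (1 / W x)" for n
      using \<epsilon> Wpos by (auto simp: B_def less_imp_le)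
    show "integrable M (\<lambda>x. (1 / \<epsilon>) * (1 / W x))" by (rule integrable_mult_right[OF Wint])
  qed measurable
  show ?thesis
  proof (rule LIMSEQ_I)
    fix e :: real assume "e > 0"
    \<comment> \<open>The error splits into three parts: two truncations, each at most \<epsilon> C,
      and the convergence of the truncated integrals. The summand 1 in the denominator covers C =
      0.\<close>
    define \<epsilon> where "\<epsilon> = e / (3 * (C + 1))"
    have \<epsilon>: "\<epsilon> > 0" using \<open>e > 0\<close> \<open>C \<ge> 0\<close> by (simp add: \<epsilon>_def)
    have "\<epsilon> * C \<le> \<epsilon> * (C + 1)" using \<epsilon> by simp
    also have "\<dots> = e / 3" using \<open>C \<ge> 0\<close> by (simp add: \<epsilon>_def field_simps)
    finally have \<epsilon>C: "\<epsilon> * C \<le> e / 3" .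
    obtain N where N: "\<And>n. n \<ge> N \<Longrightarrow> norm ((LINT x|M. B \<epsilon> (A n) x) - (LINT x|M. B \<epsilon> A' x)) < e / 3"
      using LIMSEQ_D[OF limB[OF \<epsilon>], of "e / 3"] \<open>e > 0\<close> by auto
    have "norm ((LINT x|M. norm (A n x)) - (LINT x|M. norm (A' x))) < e" if "n \<ge> N" for n
      using close[OF \<epsilon> A bound, of n] close[OF \<epsilon> A' bound'] N[OF that] \<epsilon>C
      unfolding real_norm_def by linarith
    then show "\<exists>N. \<forall>n\<ge>N. norm ((LINT x|M. norm (A n x)) - (LINT x|M. norm (A' x))) < e" by blast
  qed
qed

section \<open>Gaussian integrals and Hermite polynomials\<close>

lemma integrable_gaussian_power:
  "integrable lborel (\<lambda>u :: real. (c * of_real u) ^ r * of_real (exp (- u\<^sup>2 / 2)) :: complex)"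
proof -
  have "integrable lborel (\<lambda>u. sqrt (2 * pi) * (std_normal_density u * u ^ r))"
    by (intro integrable_mult_right integrable_std_normal_moment)
  then have "integrable lborel (\<lambda>u :: real. exp (- u\<^sup>2 / 2) * u ^ r)"
    by (simp add: std_normal_density_def)
  then have "integrable lborel (\<lambda>u. c ^ r * of_real (exp (- u\<^sup>2 / 2) * u ^ r) :: complex)"
    by (intro integrable_mult_right integrable_of_real)
  then show ?thesis by (simp add: power_mult_distrib mult_ac)
qed

text \<open>Each derivative in x of the Fourier integral of the Gaussian brings down a factor - i u,
  and the integral itself is sqrt(2 pi) exp(- x^2 / 2). The sign (-1)^r between powers of i u and of
  - i u is the one in the definition of \<open>hermite\<close>.\<close>

lemma integral_gaussian_hermite:
  "(LINT u|lborel. (\<i> * of_real u) ^ r * of_real (exp (- u\<^sup>2 / 2)) * exp (- \<i> * of_real (u * x)))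
    = of_real (sqrt (2 * pi) * hermite r x * exp (- x\<^sup>2 / 2))"
proof -
  define C where "C = (\<lambda>r x. LINT u|lborel. (- \<i> * of_real u) ^ r * of_real (exp (- u\<^sup>2 / 2)) * exp (\<i> * of_real (- u * x)))"
  have dC: "(C r has_vector_derivative C (Suc r) x) (at x)" for r x
  proof -
    let ?g = "\<lambda>u. (- \<i> * of_real u) ^ r * of_real (exp (- u\<^sup>2 / 2)) :: complex"
    have eq: "\<i> * (?g u * of_real (- u)) = (- \<i> * of_real u) ^ Suc r * of_real (exp (- u\<^sup>2 / 2))" for u
      by simp
    have "integrable lborel (\<lambda>u. - \<i> * (\<i> * (?g u * of_real (- u))))"
      unfolding eq by (intro integrable_mult_right integrable_gaussian_power)
    then have i2: "integrable lborel (\<lambda>u. ?g u * of_real (- u))"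
      by (simp add: mult.assoc[symmetric])
    show ?thesis
      using has_vector_derivative_integral_iexp[OF integrable_gaussian_power[of "- \<i>" r] i2, of x]
      unfolding eq C_def by simp
  qed
  have C0: "C 0 x = of_real (sqrt (2 * pi) * exp (- (x\<^sup>2) / 2))" for x
  proof -
    have "of_real (exp (- (x\<^sup>2) / 2)) = char std_normal_distribution (- x)"
      by (simp add: char_std_normal_distribution)
    also have "\<dots> = (LINT u|lborel. std_normal_density u *\<^sub>R exp (\<i> * of_real (- x * u)))"
      unfolding char_def by (subst integral_density) auto
    also have "\<dots> = (LINT u|lborel. of_real (1 / sqrt (2 * pi)) * (of_real (exp (- u\<^sup>2 / 2)) * exp (\<i> * of_real (- u * x))))"
      by (rule arg_cong[of _ _ "integral\<^sup>L lborel"]) (auto simp: std_normal_density_def scaleR_conv_of_real mult_ac)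
    also have "\<dots> = of_real (1 / sqrt (2 * pi)) * C 0 x"
      unfolding C_def by (subst integral_mult_right_zero) simp
    finally show ?thesis by (simp add: field_simps)
  qed
  have Cr: "C r x = of_real (sqrt (2 * pi) * (deriv ^^ r) (\<lambda>y. exp (- (y\<^sup>2) / 2)) x)" for r x
  proof (induction r arbitrary: x)
    case (Suc r)
    let ?G = "(deriv ^^ r) (\<lambda>y. exp (- (y\<^sup>2) / 2)) :: real \<Rightarrow> real"
    have d: "(C r has_vector_derivative C (Suc r) x) (at x)" by (rule dC)
    \<comment> \<open>\<open>hermite\<close> uses the real \<open>deriv\<close>, so the complex
      derivative is split into real and imaginary part; by induction the imaginary part of
      \<open>C r\<close> is constantly 0.\<close>
    have "((\<lambda>x. Re (C r x)) has_real_derivative Re (C (Suc r) x)) (at x)"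
      "((\<lambda>x. Im (C r x)) has_real_derivative Im (C (Suc r) x)) (at x)"
      using d by (auto simp: has_vector_derivative_complex_iff o_def)
    then have 1: "((\<lambda>x. sqrt (2 * pi) * ?G x) has_real_derivative Re (C (Suc r) x)) (at x)"
      and 2: "((\<lambda>x. 0) has_real_derivative Im (C (Suc r) x)) (at x)"
      unfolding Suc by simp_all
    have "Im (C (Suc r) x) = 0" using DERIV_unique[OF 2 DERIV_const] .
    have "((\<lambda>x. (1 / sqrt (2 * pi)) * (sqrt (2 * pi) * ?G x)) has_real_derivative (1 / sqrt (2 * pi)) * Re (C (Suc r) x)) (at x)"
      by (rule DERIV_cmult[OF 1])
    then have "deriv ?G x = (1 / sqrt (2 * pi)) * Re (C (Suc r) x)"
      by (intro DERIV_imp_deriv) simp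
    then have "Re (C (Suc r) x) = sqrt (2 * pi) * (deriv ^^ Suc r) (\<lambda>y. exp (- (y\<^sup>2) / 2)) x"
      by simp
    then show ?case using \<open>Im (C (Suc r) x) = 0\<close> by (simp add: complex_eq_iff)
  qed (simp add: C0)
  have "(LINT u|lborel. (\<i> * of_real u) ^ r * of_real (exp (- u\<^sup>2 / 2)) * exp (- \<i> * of_real (u * x))) = (-1) ^ r * C r x"
  proof -
    have "(\<i> * of_real u) ^ r = (-1) ^ r * (- \<i> * of_real u) ^ r" for u
      by (simp flip: power_mult_distrib)
    then have "(\<i> * of_real u) ^ r * of_real (exp (- u\<^sup>2 / 2)) * exp (- \<i> * of_real (u * x))
      = (-1) ^ r * ((- \<i> * of_real u) ^ r * of_real (exp (- u\<^sup>2 / 2)) * exp (\<i> * of_real (- u * x)))" for u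
      by simp
    then show ?thesis
      unfolding C_def by (simp only: integral_mult_right_zero)
  qed
  also have "\<dots> = of_real (sqrt (2 * pi) * hermite r x * exp (- x\<^sup>2 / 2))"
  proof -
    have "exp (x\<^sup>2 / 2) * exp (- x\<^sup>2 / 2) = 1" by (simp add: exp_minus_inverse)
    then have "hermite r x * exp (- x\<^sup>2 / 2) = (-1) ^ r * (deriv ^^ r) (\<lambda>y. exp (- (y\<^sup>2) / 2)) x"
      unfolding hermite_def by (metis (no_types, lifting) mult.assoc mult.commute mult.right_neutral)
    then show ?thesis
      unfolding Cr mult.assoc by (simp add: mult_ac)
  qed
  finally show ?thesis .
qed

lemma
  fixes x :: "real ^ 'd"
  shows integrable_gaussian_i_monom: "integrable lborel (\<lambda>u. i_monom u \<alpha> * of_real (exp (- (norm u)\<^sup>2 / 2)) * exp (- \<i> * of_real (\<Sum>j\<in>UNIV. u $ j * x $ j)))"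
    and integral_gaussian_mi_hermite: "(LINT u|lborel. i_monom u \<alpha> * of_real (exp (- (norm u)\<^sup>2 / 2)) * exp (- \<i> * of_real (\<Sum>j\<in>UNIV. u $ j * x $ j)))
     = of_real (sqrt (2 * pi) ^ CARD('d) * mi_hermite \<alpha> x * exp (- (norm x)\<^sup>2 / 2))"
proof -
  let ?f = "\<lambda>j v. (\<i> * of_real v) ^ (\<alpha> $ j) * of_real (exp (- v\<^sup>2 / 2)) * exp (- \<i> * of_real (v * x $ j))"
  have i: "integrable lborel (?f j)" for j
    using integrable_mult_iexp[OF integrable_gaussian_power[of \<i> "\<alpha> $ j"], of "\<lambda>u. u" "- x $ j"] by simp
  have eq: "i_monom u \<alpha> * of_real (exp (- (norm u)\<^sup>2 / 2)) * exp (- \<i> * of_real (\<Sum>j\<in>UNIV. u $ j * x $ j)) = (\<Prod>j\<in>UNIV. ?f j (u $ j))" for u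
    using exp_norm_cart[of "1/2" u]
    by (simp add: i_monom_def prod.distrib exp_sum sum_distrib_left sum_negf[symmetric] del: sum_negf)
  show "integrable lborel (\<lambda>u. i_monom u \<alpha> * of_real (exp (- (norm u)\<^sup>2 / 2)) * exp (- \<i> * of_real (\<Sum>j\<in>UNIV. u $ j * x $ j)))"
    unfolding eq by (rule integrable_prod_cart[OF i])
  show "(LINT u|lborel. i_monom u \<alpha> * of_real (exp (- (norm u)\<^sup>2 / 2)) * exp (- \<i> * of_real (\<Sum>j\<in>UNIV. u $ j * x $ j)))
     = of_real (sqrt (2 * pi) ^ CARD('d) * mi_hermite \<alpha> x * exp (- (norm x)\<^sup>2 / 2))"
    unfolding eq integral_prod_cart[OF i] integral_gaussian_hermite
    using exp_norm_cart[of "1/2" x] by (simp add: mi_hermite_def prod.distrib)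
qed

section \<open>Fourier series on the torus\<close>

definition floor_vec :: "real ^ 'd \<Rightarrow> int ^ 'd" where
  "floor_vec x = (\<chi> j. \<lfloor>x $ j\<rfloor>)"

lemma measurable_floor_vec [measurable]:
  "(floor_vec :: real ^ 'd \<Rightarrow> int ^ 'd) \<in> borel \<rightarrow>\<^sub>M count_space UNIV"
proof (subst measurable_count_space_eq2_countable, safe)
  fix k :: "int ^ 'd"
  have "floor_vec -` {k} \<inter> space borel = {x \<in> space borel. \<forall>j\<in>UNIV. \<lfloor>x $ j\<rfloor> = k $ j}"
    by (auto simp: floor_vec_def vec_eq_iff)
  also have "\<dots> \<in> sets borel" by measurable
  finally show "floor_vec -` {k} \<inter> space borel \<in> sets borel" .
qed auto

text \<open>The half-open unit cube lies between an open and a closed box of the same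
  volume.\<close>

lemma emeasure_floor_vec_vimage: "emeasure lborel (floor_vec -` {k :: int ^ 'd}) = 1"
proof -
  define l u :: "real ^ 'd" where "l = (\<chi> j. of_int (k $ j))" and "u = (\<chi> j. of_int (k $ j) + 1)"
  have lu: "l \<bullet> b \<le> u \<bullet> b" "(u - l) \<bullet> b = 1" if "b \<in> Basis" for b
    using that by (auto simp: Basis_cart inner_axis l_def u_def)
  have "box l u \<subseteq> floor_vec -` {k}"
    by (auto simp: floor_vec_def vec_eq_iff mem_box_cart l_def u_def floor_eq_iff less_imp_le)
  moreover have "floor_vec -` {k} \<subseteq> cbox l u"
    by (auto simp: floor_vec_def vec_eq_iff mem_box_cart l_def u_def floor_eq_iff less_imp_le)
  moreover have "floor_vec -` {k} \<in> sets lborel"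
    using measurable_sets[OF measurable_floor_vec, of "{k}"] by simp
  ultimately have "emeasure lborel (box l u) \<le> emeasure lborel (floor_vec -` {k})"
    "emeasure lborel (floor_vec -` {k}) \<le> emeasure lborel (cbox l u)"
    by (auto intro!: emeasure_mono)
  then show ?thesis
    using lu by (simp add: emeasure_lborel_box emeasure_lborel_cbox)
qed

text \<open>Since every cell has volume 1, the image of Lebesgue measure is counting measure. A sum
  over the lattice thereby becomes the integral of a function that is constant on cells.\<close>

lemma distr_floor_vec: "distr lborel (count_space UNIV) floor_vec = count_space (UNIV :: (int ^ 'd) set)"
proof (rule measure_eqI_countable[of _ UNIV])
  fix k :: "int ^ 'd"
  show "emeasure (distr lborel (count_space UNIV) floor_vec) {k} = emeasure (count_space UNIV) {k}"
    by (subst emeasure_distr) (auto simp: emeasure_floor_vec_vimage)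
qed auto

lemma
  fixes h :: "'k \<Rightarrow> 'b::{banach,second_countable_topology}"
  assumes "(\<lambda>k. norm (h k)) summable_on UNIV"
  shows integrable_count_space_of_summable: "integrable (count_space UNIV) h"
    and integral_count_space_eq_infsum: "integral\<^sup>L (count_space UNIV) h = (\<Sum>\<^sub>\<infinity>k. h k)"
proof -
  have "Infinite_Set_Sum.abs_summable_on h UNIV"
    using assms by (simp add: abs_summable_equivalent)
  then show "integrable (count_space UNIV) h" "integral\<^sup>L (count_space UNIV) h = (\<Sum>\<^sub>\<infinity>k. h k)"
    using infsetsum_infsum[of h UNIV] by (auto simp: Infinite_Set_Sum.abs_summable_on_def infsetsum_def)
qed

lemma
  fixes g :: "int ^ 'd \<Rightarrow> 'b::{banach,second_countable_topology}" and c t :: "real ^ 'd"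
  assumes c: "\<And>j. c $ j > 0" and g: "(\<lambda>k. norm (g k)) summable_on UNIV"
  shows integrable_floor_vec: "integrable lborel (\<lambda>x. g (floor_vec (t + (\<chi> j. c $ j * x $ j))))"
    and integral_floor_vec: "(\<Prod>j\<in>UNIV. c $ j) *\<^sub>R (LINT x|lborel. g (floor_vec (t + (\<chi> j. c $ j * x $ j)))) = (\<Sum>\<^sub>\<infinity>k. g k)"
proof -
  have m: "(\<lambda>x. g (floor_vec x)) \<in> borel_measurable borel"
    by (rule measurable_compose[OF measurable_floor_vec]) simp
  have "integrable (distr lborel (count_space UNIV) floor_vec) g"
    unfolding distr_floor_vec by (rule integrable_count_space_of_summable[OF g])
  then have i: "integrable lborel (\<lambda>x. g (floor_vec x))"
    by (subst (asm) integrable_distr_eq) auto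
  have e: "(LINT x|lborel. g (floor_vec x)) = (\<Sum>\<^sub>\<infinity>k. g k)"
    unfolding integral_count_space_eq_infsum[OF g, symmetric]
    by (subst distr_floor_vec[symmetric], subst integral_distr) auto
  show "integrable lborel (\<lambda>x. g (floor_vec (t + (\<chi> j. c $ j * x $ j))))"
    using integrable_diag_scale[OF c m, of t] i by simp
  show "(\<Prod>j\<in>UNIV. c $ j) *\<^sub>R (LINT x|lborel. g (floor_vec (t + (\<chi> j. c $ j * x $ j)))) = (\<Sum>\<^sub>\<infinity>k. g k)"
    using integral_diag_scale[OF c m, of t] e by simp
qed

section \<open>Characters of the lattice and their orthogonality on the torus\<close>

lemma norm_lattice_char [simp]: "norm (lattice_char k \<xi>) = 1"
  unfolding lattice_char_def by (rule norm_exp_i_times)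

lemma lattice_char_add_right: "lattice_char k (\<xi> + \<eta>) = lattice_char k \<xi> * lattice_char k \<eta>"
  unfolding lattice_char_def by (simp add: distrib_left sum.distrib exp_add)

lemma lattice_char_add_left: "lattice_char (k + l) \<xi> = lattice_char k \<xi> * lattice_char l \<xi>"
  unfolding lattice_char_def by (simp add: distrib_left distrib_right sum.distrib exp_add)

lemma lattice_char_uminus: "lattice_char (- k) \<xi> = cnj (lattice_char k \<xi>)"
  unfolding lattice_char_def by (simp add: exp_cnj sum_negf)

lemma lattice_char_scaleR_axis: "lattice_char k (t *\<^sub>R axis j 1) = exp (\<i> * of_real (of_int (k $ j) * t))"
  unfolding lattice_char_def by (simp add: axis_def if_distrib[of "\<lambda>x. _ * x"] cong: if_cong)

lemma lattice_char_eq_prod: "lattice_char k \<xi> = (\<Prod>j\<in>UNIV. exp (\<i> * of_real (of_int (k $ j) * \<xi> $ j)))"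
  unfolding lattice_char_def by (simp add: sum_distrib_left flip: exp_sum)

lemma continuous_on_lattice_char: "continuous_on S (lattice_char k)"
  unfolding lattice_char_def[abs_def] by (intro continuous_intros)

lemma borel_measurable_lattice_char [measurable]: "lattice_char k \<in> borel_measurable borel"
  by (intro borel_measurable_continuous_onI continuous_on_lattice_char)

text \<open>Not normalized: the total mass is (2 pi)^d, and this factor reappears in the coefficient
  formula and in Parseval's identity.\<close>

definition torus_measure :: "(real ^ 'd) measure" where
  "torus_measure = restrict_space lborel torus"

lemma torus_sets [measurable]: "torus \<in> sets borel"
  by (rule borel_compact[OF compact_torus])

lemma space_torus_measure [simp]: "space torus_measure = torus"
  by (simp add: torus_measure_def space_restrict_space)

lemma measurable_torus_measure [measurable (raw)]:
  "f \<in> borel_measurable borel \<Longrightarrow> f \<in> borel_measurable torus_measure"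
  unfolding torus_measure_def by (intro measurable_restrict_space1) simp

lemma finite_torus_measure: "finite_measure (torus_measure :: (real ^ 'd) measure)"
proof
  have "emeasure lborel (torus :: (real ^ 'd) set) < \<infinity>"
    by (rule emeasure_bounded_finite[OF compact_imp_bounded[OF compact_torus]])
  then show "emeasure torus_measure (space (torus_measure :: (real ^ 'd) measure)) \<noteq> \<infinity>"
    unfolding space_torus_measure unfolding torus_measure_def
    by (subst emeasure_restrict_space) auto
qed

lemma integrable_torus_measure_bounded:
  fixes g :: "real ^ 'd \<Rightarrow> 'b::{banach,second_countable_topology}"
  assumes "g \<in> borel_measurable torus_measure" "\<And>\<xi>. \<xi> \<in> torus \<Longrightarrow> norm (g \<xi>) \<le> B"
  shows "integrable torus_measure g"
  using assms by (intro finite_measure.integrable_const_bound[OF finite_torus_measure, of _ B] AE_I2) auto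

lemma integral_torus_measure:
  fixes g :: "real ^ 'd \<Rightarrow> 'b::{banach,second_countable_topology}"
  shows "(LINT \<xi>|torus_measure. g \<xi>) = (LINT \<xi>|lborel. indicator torus \<xi> *\<^sub>R g \<xi>)"
  unfolding torus_measure_def by (subst integral_restrict_space) auto

lemma integral_iexp_period:
  fixes k :: int
  shows "integrable lborel (\<lambda>x. indicator {-pi..pi} x *\<^sub>R exp (\<i> * of_real (of_int k * x)))"
    and "(LINT x|lborel. indicator {-pi..pi} x *\<^sub>R exp (\<i> * of_real (of_int k * x))) = (if k = 0 then 2 * of_real pi else 0)"
proof -
  have cont: "continuous_on {-pi..pi} (\<lambda>x. exp (\<i> * of_real (of_int k * x)))"
    by (intro continuous_intros)
  have le: "- pi \<le> pi" using pi_gt_zero by simp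
  have *: "has_bochner_integral lborel (\<lambda>x. indicator {-pi..pi} x *\<^sub>R exp (\<i> * of_real (of_int k * x)))
      (if k = 0 then 2 * of_real pi else 0)"
  proof (cases "k = 0")
    case True
    have d: "((\<lambda>x. of_real x) has_vector_derivative exp (\<i> * of_real (of_int k * x))) (at x within {-pi..pi})" for x
      using True by (auto intro!: derivative_eq_intros)
    from has_bochner_integral_FTC_Icc[OF le d cont] show ?thesis using True by simp
  next
    case False
    let ?F = "\<lambda>x. exp (\<i> * of_real (of_int k * x)) / (\<i> * of_int k)"
    have d: "(?F has_vector_derivative exp (\<i> * of_real (of_int k * x))) (at x within {-pi..pi})" for x
    proof -
      have "((\<lambda>x. \<i> * of_real (of_int k * x)) has_vector_derivative \<i> * of_int k) (at x)"
        by (auto intro!: derivative_eq_intros)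
      from has_vector_derivative_divide[OF field_vector_diff_chain_at[OF this DERIV_exp], of "\<i> * of_int k"] False
      have "(?F has_vector_derivative exp (\<i> * of_real (of_int k * x))) (at x)"
        by (simp add: o_def)
      then show ?thesis by (rule has_vector_derivative_at_within)
    qed
    have "exp (\<i> * of_real (of_int k * pi)) = exp (\<i> * of_real (of_int k * - pi))"
      by (subst exp_eq) (auto intro!: exI[of _ k])
    then show ?thesis
      using has_bochner_integral_FTC_Icc[OF le d cont] False by simp
  qed
  then show "integrable lborel (\<lambda>x. indicator {-pi..pi} x *\<^sub>R exp (\<i> * of_real (of_int k * x)))"
    "(LINT x|lborel. indicator {-pi..pi} x *\<^sub>R exp (\<i> * of_real (of_int k * x))) = (if k = 0 then 2 * of_real pi else 0)"
    by (auto simp: has_bochner_integral_iff)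
qed

lemma integral_lattice_char:
  fixes k :: "int ^ 'd"
  shows "(LINT \<xi>|torus_measure. lattice_char k \<xi>) = (if k = 0 then (2 * of_real pi) ^ CARD('d) else 0)"
proof -
  let ?f = "\<lambda>j x. indicator {-pi..pi} x *\<^sub>R exp (\<i> * of_real (of_int (k $ j) * x))"
  have eq: "indicator torus \<xi> *\<^sub>R lattice_char k \<xi> = (\<Prod>j\<in>UNIV. ?f j (\<xi> $ j))" for \<xi> :: "real ^ 'd"
  proof (cases "\<xi> \<in> torus")
    case True
    then have "indicator {-pi..pi} (\<xi> $ j) = (1 :: real)" for j
      by (auto simp: torus_def abs_le_iff minus_le_iff indicator_def)
    then show ?thesis using True by (simp add: lattice_char_eq_prod)
  next
    case False
    then obtain j where "\<xi> $ j \<notin> {-pi..pi}"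
      by (auto simp: torus_def abs_le_iff minus_le_iff)
    then have "?f j (\<xi> $ j) = 0" by simp
    then have "(\<Prod>j\<in>UNIV. ?f j (\<xi> $ j)) = 0" by (intro prod_zero) auto
    then show ?thesis using False by simp
  qed
  have "(LINT \<xi>|torus_measure. lattice_char k \<xi>) = (\<Prod>j\<in>UNIV. LINT x|lborel. ?f j x)"
    unfolding integral_torus_measure eq by (rule integral_prod_cart[OF integral_iexp_period(1)])
  also have "\<dots> = (\<Prod>j\<in>(UNIV :: 'd set). if k $ j = 0 then 2 * of_real pi else 0)"
    by (simp only: integral_iexp_period(2))
  also have "\<dots> = (if k = 0 then (2 * of_real pi) ^ CARD('d) else 0)"
    by (auto simp: vec_eq_iff intro: prod_zero)
  finally show ?thesis .
qed

section \<open>Fourier coefficients and Parseval's identity for absolutely convergent series\<close>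

lemma summable_norm_mult_bounded:
  fixes a b :: "'k \<Rightarrow> complex"
  assumes a: "(\<lambda>k. norm (a k)) summable_on UNIV" and b: "\<And>k. norm (b k) \<le> B"
  shows "(\<lambda>k. norm (a k * b k)) summable_on UNIV"
proof (rule summable_on_comparison_test)
  show "(\<lambda>k. norm (a k) * B) summable_on UNIV" by (rule summable_on_cmult_left[OF a])
  show "norm (a k * b k) \<le> norm (a k) * B" for k
    unfolding norm_mult by (intro mult_left_mono b norm_ge_zero)
qed simp

context
  fixes a :: "int ^ 'd \<Rightarrow> complex" and F :: "real ^ 'd \<Rightarrow> complex"
  assumes a: "(\<lambda>k. norm (a k)) summable_on UNIV"
    and F: "\<And>\<xi>. F \<xi> = (\<Sum>\<^sub>\<infinity>k. a k * lattice_char k \<xi>)"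
begin

lemma series_measurable_pair:
  "(\<lambda>(k, \<xi>). a k * lattice_char k \<xi>) \<in> borel_measurable (count_space UNIV \<Otimes>\<^sub>M (torus_measure :: (real ^ 'd) measure))"
  by (rule measurable_pair_measure_countable1) auto

lemma series_eq_integral: "F \<xi> = (LINT k|count_space UNIV. a k * lattice_char k \<xi>)"
  unfolding F by (rule integral_count_space_eq_infsum[symmetric], rule summable_norm_mult_bounded[OF a, of _ 1]) simp

lemma norm_series_le: "norm (F \<xi>) \<le> (\<Sum>\<^sub>\<infinity>k. norm (a k))"
  unfolding F using norm_infsum_bound[of "\<lambda>k. a k * lattice_char k \<xi>" UNIV] a by (simp add: norm_mult)

lemma series_measurable: "F \<in> borel_measurable (torus_measure :: (real ^ 'd) measure)"
proof -
  interpret sigma_finite_measure "count_space (UNIV :: (int ^ 'd) set)"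
    by (rule sigma_finite_measure_count_space_countable) simp
  have "(\<lambda>(\<xi>, k). a k * lattice_char k \<xi>) \<in> borel_measurable ((torus_measure :: (real ^ 'd) measure) \<Otimes>\<^sub>M count_space UNIV)"
    using measurable_pair_swap[OF series_measurable_pair] by simp
  from borel_measurable_lebesgue_integral[OF this]
  show ?thesis by (simp add: series_eq_integral[abs_def])
qed

text \<open>Fubini for counting measure times the finite measure on the torus. The bounded factor
  \<open>g\<close> is left free because two choices are needed: a character extracts a coefficient,
  and the conjugate of \<open>F\<close> yields Parseval's identity.\<close>

lemma series_integral_swap:
  assumes g [measurable]: "g \<in> borel_measurable (torus_measure :: (real ^ 'd) measure)"
    and B: "\<And>\<xi>. \<xi> \<in> torus \<Longrightarrow> norm (g \<xi>) \<le> B" "B \<ge> 0"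
  shows "(LINT \<xi>|torus_measure. F \<xi> * g \<xi>) = (\<Sum>\<^sub>\<infinity>k. a k * (LINT \<xi>|torus_measure. lattice_char k \<xi> * g \<xi>))"
proof -
  interpret fin: finite_measure "torus_measure :: (real ^ 'd) measure" by (rule finite_torus_measure)
  interpret c: sigma_finite_measure "count_space (UNIV :: (int ^ 'd) set)"
    by (rule sigma_finite_measure_count_space_countable) simp
  interpret pair_sigma_finite "count_space (UNIV :: (int ^ 'd) set)" "torus_measure :: (real ^ 'd) measure" ..
  let ?\<tau> = "torus_measure :: (real ^ 'd) measure"
  let ?f = "\<lambda>k \<xi>. a k * lattice_char k \<xi> * g \<xi>"
  have fi: "integrable ?\<tau> (\<lambda>\<xi>. lattice_char k \<xi> * g \<xi>)" for k
    by (rule integrable_torus_measure_bounded[of _ B]) (use B in \<open>auto simp: norm_mult\<close>)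
  have nb: "(LINT \<xi>|?\<tau>. norm (?f k \<xi>)) \<le> norm (a k) * (B * measure ?\<tau> torus)" for k
  proof -
    have "(LINT \<xi>|?\<tau>. norm (?f k \<xi>)) \<le> (LINT \<xi>|?\<tau>. norm (a k) * B)"
    proof (rule integral_mono)
      show "integrable ?\<tau> (\<lambda>\<xi>. norm (?f k \<xi>))"
        using integrable_mult_right[OF fi[of k], of "a k"] by (intro integrable_norm) (simp only: mult.assoc)
      show "norm (?f k \<xi>) \<le> norm (a k) * B" if "\<xi> \<in> space ?\<tau>" for \<xi>
        using B(1)[of \<xi>] that by (simp add: norm_mult mult_left_mono)
    qed simp
    then show ?thesis by (simp add: mult_ac)
  qed
  have int: "integrable (count_space UNIV \<Otimes>\<^sub>M ?\<tau>) (\<lambda>(k, \<xi>). ?f k \<xi>)"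
  proof (rule Fubini_integrable)
    show "(\<lambda>(k, \<xi>). ?f k \<xi>) \<in> borel_measurable (count_space UNIV \<Otimes>\<^sub>M ?\<tau>)"
      by (rule measurable_pair_measure_countable1) auto
    show "integrable (count_space UNIV) (\<lambda>k. LINT \<xi>|?\<tau>. norm (case (k, \<xi>) of (k, \<xi>) \<Rightarrow> ?f k \<xi>))"
    proof (rule Bochner_Integration.integrable_bound)
      show "integrable (count_space UNIV) (\<lambda>k. norm (a k) * (B * measure ?\<tau> torus))"
        using integrable_count_space_of_summable[of "\<lambda>k. norm (a k)"] a by (intro integrable_mult_left) simp
      show "AE k in count_space UNIV. norm (LINT \<xi>|?\<tau>. norm (case (k, \<xi>) of (k, \<xi>) \<Rightarrow> ?f k \<xi>)) \<le> norm (norm (a k) * (B * measure ?\<tau> torus))"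
        using nb B by (intro AE_I2) simp
    qed simp
    show "AE k in count_space UNIV. integrable ?\<tau> (\<lambda>\<xi>. case (k, \<xi>) of (k, \<xi>) \<Rightarrow> ?f k \<xi>)"
      using fi by (simp add: mult.assoc)
  qed
  have "(LINT \<xi>|?\<tau>. F \<xi> * g \<xi>) = (LINT \<xi>|?\<tau>. LINT k|count_space UNIV. ?f k \<xi>)"
    unfolding series_eq_integral by simp
  also have "\<dots> = (LINT k|count_space UNIV. LINT \<xi>|?\<tau>. ?f k \<xi>)"
    by (rule Fubini_integral[OF int])
  also have "\<dots> = (LINT k|count_space UNIV. a k * (LINT \<xi>|?\<tau>. lattice_char k \<xi> * g \<xi>))"
    by (simp add: mult.assoc)
  also have "\<dots> = (\<Sum>\<^sub>\<infinity>k. a k * (LINT \<xi>|?\<tau>. lattice_char k \<xi> * g \<xi>))"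
  proof (intro integral_count_space_eq_infsum summable_norm_mult_bounded[OF a])
    fix k
    have "norm (LINT \<xi>|?\<tau>. lattice_char k \<xi> * g \<xi>) \<le> (LINT \<xi>|?\<tau>. norm (lattice_char k \<xi> * g \<xi>))"
      by (rule integral_norm_bound)
    also have "\<dots> \<le> (LINT \<xi>|?\<tau>. B)"
      using integrable_norm[OF fi[of k]] B by (intro integral_mono) (auto simp: norm_mult)
    finally show "norm (LINT \<xi>|?\<tau>. lattice_char k \<xi> * g \<xi>) \<le> (LINT \<xi>|?\<tau>. B)" .
  qed
  finally show ?thesis .
qed

lemma fourier_coefficient:
  "(LINT \<xi>|torus_measure. F \<xi> * lattice_char (- k) \<xi>) = (2 * of_real pi) ^ CARD('d) * a k"
proof -
  have "(LINT \<xi>|torus_measure. F \<xi> * lattice_char (- k) \<xi>)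
      = (\<Sum>\<^sub>\<infinity>l. a l * (LINT \<xi>|torus_measure. lattice_char (l - k) \<xi>))"
    by (subst series_integral_swap[of _ 1]) (auto simp flip: lattice_char_add_left)
  also have "\<dots> = (\<Sum>\<^sub>\<infinity>l\<in>{k}. a l * (2 * of_real pi) ^ CARD('d))"
    by (rule infsum_cong_neutral) (auto simp: integral_lattice_char)
  finally show ?thesis by simp
qed

lemma summable_power2_coefficients: "(\<lambda>k. (norm (a k))\<^sup>2) summable_on UNIV"
proof -
  have "norm (a k) \<le> (\<Sum>\<^sub>\<infinity>k. norm (a k))" for k
    using finite_sum_le_infsum[OF a, of "{k}"] by simp
  from summable_norm_mult_bounded[OF a this] show ?thesis
    by (simp add: norm_mult power2_eq_square)
qed

lemma parseval:
  "(2 * pi) ^ CARD('d) * (\<Sum>\<^sub>\<infinity>k. (norm (a k))\<^sup>2) = (LINT \<xi>|torus_measure. (norm (F \<xi>))\<^sup>2)"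
proof -
  note [measurable] = series_measurable
  have [measurable]: "(\<lambda>\<xi>. cnj (F \<xi>)) \<in> borel_measurable (torus_measure :: (real ^ 'd) measure)"
    by (rule measurable_compose[OF series_measurable borel_measurable_continuous_onI]) (intro continuous_intros)
  have coeff: "(LINT \<xi>|torus_measure. lattice_char k \<xi> * cnj (F \<xi>)) = (2 * of_real pi) ^ CARD('d) * cnj (a k)" for k
  proof -
    have "(LINT \<xi>|torus_measure. lattice_char k \<xi> * cnj (F \<xi>)) = (LINT \<xi>|torus_measure. cnj (F \<xi> * lattice_char (- k) \<xi>))"
      by (simp add: lattice_char_uminus mult.commute)
    also have "\<dots> = cnj (LINT \<xi>|torus_measure. F \<xi> * lattice_char (- k) \<xi>)"
    proof (rule integral_bounded_linear[OF bounded_linear_cnj])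
      show "integrable torus_measure (\<lambda>\<xi>. F \<xi> * lattice_char (- k) \<xi>)"
        using norm_series_le by (intro integrable_torus_measure_bounded[of _ "\<Sum>\<^sub>\<infinity>k. norm (a k)"]) (auto simp: norm_mult)
    qed
    finally show ?thesis by (simp add: fourier_coefficient)
  qed
  have "(LINT \<xi>|torus_measure. F \<xi> * cnj (F \<xi>)) = (\<Sum>\<^sub>\<infinity>k. a k * (LINT \<xi>|torus_measure. lattice_char k \<xi> * cnj (F \<xi>)))"
  proof (rule series_integral_swap)
    show "0 \<le> (\<Sum>\<^sub>\<infinity>k. norm (a k))" by (rule infsum_nonneg) simp
  qed (use norm_series_le in auto)
  also have "\<dots> = (\<Sum>\<^sub>\<infinity>k. a k * ((2 * of_real pi) ^ CARD('d) * cnj (a k)))"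
    by (simp only: coeff)
  also have "\<dots> = (\<Sum>\<^sub>\<infinity>k. of_real ((2 * pi) ^ CARD('d) * (norm (a k))\<^sup>2))"
    by (simp only: mult.left_commute[of "a _"] complex_norm_square[symmetric]) simp
  also have "\<dots> = of_real ((2 * pi) ^ CARD('d) * (\<Sum>\<^sub>\<infinity>k. (norm (a k))\<^sup>2))"
  proof (rule infsumI)
    have "((\<lambda>k. (2 * pi) ^ CARD('d) * (norm (a k))\<^sup>2) has_sum (2 * pi) ^ CARD('d) * (\<Sum>\<^sub>\<infinity>k. (norm (a k))\<^sup>2)) UNIV"
      by (intro has_sum_cmult_right has_sum_infsum summable_power2_coefficients)
    from has_sum_bounded_linear[OF bounded_linear_of_real this]
    show "((\<lambda>k. complex_of_real ((2 * pi) ^ CARD('d) * (norm (a k))\<^sup>2)) has_sum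
      of_real ((2 * pi) ^ CARD('d) * (\<Sum>\<^sub>\<infinity>k. (norm (a k))\<^sup>2))) UNIV"
      by (simp only: o_def)
  qed
  finally have sum_eq: "(LINT \<xi>|torus_measure. F \<xi> * cnj (F \<xi>)) = of_real ((2 * pi) ^ CARD('d) * (\<Sum>\<^sub>\<infinity>k. (norm (a k))\<^sup>2))" .
  have "(LINT \<xi>|torus_measure. F \<xi> * cnj (F \<xi>)) = (LINT \<xi>|torus_measure. complex_of_real ((norm (F \<xi>))\<^sup>2))"
    by (simp only: complex_norm_square)
  also have "\<dots> = of_real (LINT \<xi>|torus_measure. (norm (F \<xi>))\<^sup>2)"
  proof (rule integral_of_real)
    show "integrable torus_measure (\<lambda>\<xi>. (norm (F \<xi>))\<^sup>2)"
      by (rule integrable_torus_measure_bounded[of _ "(\<Sum>\<^sub>\<infinity>k. norm (a k))\<^sup>2"])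
         (auto intro!: power_mono norm_series_le)
  qed
  finally show ?thesis unfolding sum_eq of_real_eq_iff by simp
qed

end

section \<open>Finite differences and the L2 norm of pure derivatives\<close>

definition fdiff :: "'d \<Rightarrow> real \<Rightarrow> (real ^ 'd \<Rightarrow> complex) \<Rightarrow> real ^ 'd \<Rightarrow> complex" where
  "fdiff j t f \<xi> = f (\<xi> + t *\<^sub>R axis j 1) - f \<xi>"

text \<open>A difference of step t multiplies the coefficient at k by exp(i k_j t) - 1, of modulus
  at most 2, so absolute summability survives any number of differences.\<close>

lemma fdiff_series:
  assumes "(\<lambda>k. norm (a k)) summable_on UNIV" "\<And>\<xi>. F \<xi> = (\<Sum>\<^sub>\<infinity>k. a k * lattice_char k \<xi>)"
  shows "(\<lambda>k. norm (a k * (exp (\<i> * of_real (of_int (k $ j) * t)) - 1) ^ n)) summable_on UNIV"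
    and "(fdiff j t ^^ n) F \<xi> = (\<Sum>\<^sub>\<infinity>k. a k * (exp (\<i> * of_real (of_int (k $ j) * t)) - 1) ^ n * lattice_char k \<xi>)"
  using assms
proof (induction n arbitrary: a F \<xi>)
  case 0
  { case 1 then show ?case by simp next case 2 then show ?case by simp }
next
  case (Suc n)
  let ?e = "\<lambda>k. exp (\<i> * of_real (of_int (k $ j) * t)) - 1"
  { fix a :: "int ^ 'a \<Rightarrow> complex" and F :: "real ^ 'a \<Rightarrow> complex"
    assume a: "(\<lambda>k. norm (a k)) summable_on UNIV" and F: "\<And>\<xi>. F \<xi> = (\<Sum>\<^sub>\<infinity>k. a k * lattice_char k \<xi>)"
    have "norm (?e k) \<le> 1 + 1" for k
      by (rule order.trans[OF norm_triangle_ineq4]) simp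
    then have s: "(\<lambda>k. norm (a k * ?e k)) summable_on UNIV"
      by (rule summable_norm_mult_bounded[OF a])
    have "fdiff j t F \<xi> = (\<Sum>\<^sub>\<infinity>k. (a k * ?e k) * lattice_char k \<xi>)" for \<xi>
    proof -
      have "fdiff j t F \<xi> = (\<Sum>\<^sub>\<infinity>k. a k * lattice_char k (\<xi> + t *\<^sub>R axis j 1)) + (\<Sum>\<^sub>\<infinity>k. - (a k * lattice_char k \<xi>))"
        by (simp add: fdiff_def F infsum_uminus)
      also have "\<dots> = (\<Sum>\<^sub>\<infinity>k. a k * lattice_char k (\<xi> + t *\<^sub>R axis j 1) + - (a k * lattice_char k \<xi>))"
        using summable_norm_mult_bounded[OF a, of "\<lambda>k. lattice_char k (\<xi> + t *\<^sub>R axis j 1)" 1]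
          summable_norm_mult_bounded[OF a, of "\<lambda>k. lattice_char k \<xi>" 1]
        by (intro infsum_add[symmetric] summable_on_uminus) (auto intro: abs_summable_summable)
      also have "\<dots> = (\<Sum>\<^sub>\<infinity>k. (a k * ?e k) * lattice_char k \<xi>)"
        by (intro infsum_cong) (simp add: lattice_char_add_right lattice_char_scaleR_axis algebra_simps)
      finally show ?thesis .
    qed
    note s this }
  note step = this
  { case 1
    from Suc.IH(1)[OF step[OF 1]] show ?case by (simp add: mult_ac)
  next
    case 2
    from Suc.IH(2)[OF step[OF 2]] show ?case by (simp add: mult_ac funpow_swap1) }
qed

lemma has_vector_derivative_shift_partial:
  "class_C (Suc k) f \<Longrightarrow> ((\<lambda>t. f (x + t *\<^sub>R axis i 1 + v)) has_vector_derivative partial i f (x + v)) (at 0)"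
  using class_C_has_partial[of k f "x + v" i] by (simp add: algebra_simps)

lemma class_C_shift: "class_C k f \<Longrightarrow> class_C k (\<lambda>x. f (x + v))"
proof (induction k arbitrary: f)
  case 0
  then show ?case by (auto intro!: continuous_on_compose2[of UNIV f] continuous_intros)
next
  case (Suc k)
  have "class_C k (\<lambda>x. partial i f (x + v))" for i
    using Suc by simp
  moreover have "continuous_on UNIV (\<lambda>x. f (x + v))"
    using Suc.prems class_C_continuous by (auto intro!: continuous_on_compose2[of UNIV f] continuous_intros)
  ultimately show ?case
    by (intro class_C_SucI[OF _ has_vector_derivative_shift_partial[OF Suc.prems]])
qed

lemma class_C_fdiff: "class_C k f \<Longrightarrow> class_C k (fdiff j t f)"
  unfolding fdiff_def[abs_def] by (intro class_C_diff class_C_shift)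

lemma partial_fdiff: "class_C (Suc k) f \<Longrightarrow> partial i (fdiff j t f) = fdiff j t (partial i f)"
proof -
  assume f: "class_C (Suc k) f"
  have "partial i (fdiff j t f) x = fdiff j t (partial i f) x" for x
    unfolding fdiff_def[abs_def]
    by (rule partial_eqI, rule has_vector_derivative_diff[OF has_vector_derivative_shift_partial[OF f] class_C_has_partial[OF f]])
  then show ?thesis by auto
qed

lemma class_C_funpow_partial: "class_C (n + k) f \<Longrightarrow> class_C k ((partial j ^^ n) f)"
proof (induction n arbitrary: f)
  case (Suc n)
  then show ?case by (simp add: funpow_swap1)
qed simp

lemma funpow_partial_fdiff:
  "class_C n f \<Longrightarrow> (partial i ^^ n) (fdiff j t f) = fdiff j t ((partial i ^^ n) f)"
proof (induction n)
  case (Suc n)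
  have "class_C (Suc 0) ((partial i ^^ n) f)"
    using Suc.prems by (intro class_C_funpow_partial) simp
  then show ?case
    using Suc.IH class_C_SucD[OF Suc.prems] partial_fdiff[of 0] by (simp del: class_C.simps)
qed simp

text \<open>One difference is peeled off and the mean value inequality is applied to the derivative
  of order n of the differenced function, which gains a factor t. With c the derivative at x this
  yields convergence of the quotients, with c = 0 a uniform bound for them.\<close>

lemma norm_funpow_fdiff_le:
  assumes "class_C n f" "t \<ge> 0"
    and "\<And>s. 0 \<le> s \<Longrightarrow> s \<le> real n * t \<Longrightarrow> norm ((partial j ^^ n) f (x + s *\<^sub>R axis j 1) - c) \<le> B"
  shows "norm ((fdiff j t ^^ n) f x - t ^ n *\<^sub>R c) \<le> t ^ n * B"
  using assms
proof (induction n arbitrary: f c B)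
  case 0
  then show ?case using "0.prems"(3)[of 0] by simp
next
  case (Suc n)
  have Df: "class_C (Suc 0) ((partial j ^^ n) f)"
    using Suc.prems(1) by (intro class_C_funpow_partial) simp
  have "norm ((fdiff j t ^^ n) (fdiff j t f) x - t ^ n *\<^sub>R (t *\<^sub>R c)) \<le> t ^ n * (t * B)"
  proof (rule Suc.IH)
    show "class_C n (fdiff j t f)"
      using class_C_SucD[OF Suc.prems(1)] by (rule class_C_fdiff)
    fix s assume s: "0 \<le> s" "s \<le> real n * t"
    have "norm ((partial j ^^ n) f (x + s *\<^sub>R axis j 1 + t *\<^sub>R axis j 1) - (partial j ^^ n) f (x + s *\<^sub>R axis j 1) - t *\<^sub>R c) \<le> t * B"
    proof (rule norm_line_diff_le[OF Df \<open>t \<ge> 0\<close>])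
      fix u assume "0 \<le> u" "u \<le> t"
      then have "norm ((partial j ^^ Suc n) f (x + (s + u) *\<^sub>R axis j 1) - c) \<le> B"
        using s by (intro Suc.prems(3)) (auto simp: algebra_simps)
      then show "norm (partial j ((partial j ^^ n) f) (x + s *\<^sub>R axis j 1 + u *\<^sub>R axis j 1) - c) \<le> B"
        by (simp add: scaleR_add_left add.assoc)
    qed
    then show "norm ((partial j ^^ n) (fdiff j t f) (x + s *\<^sub>R axis j 1) - t *\<^sub>R c) \<le> t * B"
      using class_C_SucD[OF Suc.prems(1)] by (simp add: funpow_partial_fdiff) (simp add: fdiff_def)
  qed (rule \<open>t \<ge> 0\<close>)
  then show ?case by (simp add: funpow_swap1 mult_ac)
qed

lemma tendsto_fdiff_quotient:
  assumes f: "class_C n f"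
  shows "((\<lambda>t. (fdiff j t ^^ n) f x /\<^sub>R t ^ n) \<longlongrightarrow> (partial j ^^ n) f x) (at_right 0)"
proof (rule tendstoI)
  fix e :: real assume "e > 0"
  let ?g = "(partial j ^^ n) f"
  have "class_C 0 ?g" using f by (intro class_C_funpow_partial) simp
  then have "isCont ?g x" by (simp add: continuous_on_eq_continuous_at)
  then obtain d where d: "d > 0" "\<And>y. dist y x < d \<Longrightarrow> dist (?g y) (?g x) < e / 2"
    using \<open>e > 0\<close> by (metis continuous_at_eps_delta half_gt_zero)
  \<comment> \<open>A total displacement of up to n t must stay below d; adding 1 in the denominator
    avoids a division by 0 when n = 0.\<close>
  have "\<forall>\<^sub>F t in at_right 0. t \<in> {0<..<d / (real n + 1)}"
    using d(1) by (intro eventually_at_right_real) simp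
  then show "\<forall>\<^sub>F t in at_right 0. dist ((fdiff j t ^^ n) f x /\<^sub>R t ^ n) (?g x) < e"
  proof eventually_elim
    case (elim t)
    then have t: "t > 0" "(real n + 1) * t < d" by (auto simp: field_simps)
    have "norm ((fdiff j t ^^ n) f x - t ^ n *\<^sub>R ?g x) \<le> t ^ n * (e / 2)"
    proof (rule norm_funpow_fdiff_le[OF f])
      fix s assume s: "0 \<le> s" "s \<le> real n * t"
      have "dist (x + s *\<^sub>R axis j 1) x = s" using s by (simp add: dist_norm norm_axis_1)
      also have "\<dots> < d" using s t by (simp add: algebra_simps)
      finally show "norm (?g (x + s *\<^sub>R axis j 1) - ?g x) \<le> e / 2"
        using d(2) by (simp add: dist_norm less_imp_le)
    qed (use t in simp)
    moreover have "(fdiff j t ^^ n) f x /\<^sub>R t ^ n - ?g x = ((fdiff j t ^^ n) f x - t ^ n *\<^sub>R ?g x) /\<^sub>R t ^ n"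
      using t by (simp add: scaleR_diff_right)
    ultimately have "norm ((fdiff j t ^^ n) f x /\<^sub>R t ^ n - ?g x) \<le> e / 2"
      using t by (simp add: divide_simps mult.commute)
    then show ?case using \<open>e > 0\<close> by (simp add: dist_norm)
  qed
qed

text \<open>Parseval's identity for the differences \<open>t\<^sup>-\<^sup>K \<Delta>\<^sub>t\<^sup>K F\<close>, whose Fourier series converges absolutely
  (unlike that of \<open>\<partial>\<^sub>j\<^sup>K F\<close>, in general), and \<open>t \<rightarrow> 0\<close>.\<close>

lemma bessel_partial:
  fixes a :: "int ^ 'd \<Rightarrow> complex"
  assumes a: "(\<lambda>k. norm (a k)) summable_on UNIV"
    and F: "\<And>\<xi>. F \<xi> = (\<Sum>\<^sub>\<infinity>k. a k * lattice_char k \<xi>)"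
    and smooth: "class_C K F" and "finite S"
  shows "(2 * pi) ^ CARD('d) * (\<Sum>k\<in>S. \<bar>of_int (k $ j)\<bar> ^ (2 * K) * (norm (a k))\<^sup>2)
    \<le> (LINT \<xi>|torus_measure. (norm ((partial j ^^ K) F \<xi>))\<^sup>2)"
proof -
  define t where "t = (\<lambda>n. inverse (real (Suc n)))"
  have t: "t n > 0" "t n \<le> 1" for n by (auto simp: t_def divide_simps)
  have t0: "t \<longlonglongrightarrow> 0" unfolding t_def by (rule LIMSEQ_inverse_real_of_nat)
  have t_right: "filterlim t (at_right 0) sequentially"
    using t by (intro tendsto_imp_filterlim_at_right[OF t0]) (auto intro: always_eventually)
  let ?e = "\<lambda>t k. exp (\<i> * of_real (of_int (k $ j) * t)) - 1 :: complex"
  let ?G = "\<lambda>n \<xi>. (fdiff j (t n) ^^ K) F \<xi> /\<^sub>R t n ^ K"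
  let ?D = "(partial j ^^ K) F"
  have ineq: "(2 * pi) ^ CARD('d) * (\<Sum>k\<in>S. norm (?e (t n) k /\<^sub>R t n) ^ (2 * K) * (norm (a k))\<^sup>2)
     \<le> (LINT \<xi>|torus_measure. (norm (?G n \<xi>))\<^sup>2)" for n
  proof -
    let ?b = "\<lambda>k. a k * ?e (t n) k ^ K"
    have b: "(\<lambda>k. norm (?b k)) summable_on UNIV" "\<And>\<xi>. (fdiff j (t n) ^^ K) F \<xi> = (\<Sum>\<^sub>\<infinity>k. ?b k * lattice_char k \<xi>)"
      using fdiff_series[OF a F] by auto
    have "(\<Sum>k\<in>S. norm (?e (t n) k) ^ (2 * K) * (norm (a k))\<^sup>2) = (\<Sum>k\<in>S. (norm (?b k))\<^sup>2)"
      by (simp add: norm_mult norm_power power_mult_distrib mult.commute power_mult[symmetric])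
    also have "\<dots> \<le> (\<Sum>\<^sub>\<infinity>k. (norm (?b k))\<^sup>2)"
      by (intro finite_sum_le_infsum summable_power2_coefficients[OF b] \<open>finite S\<close>) auto
    finally have "(2 * pi) ^ CARD('d) * (\<Sum>k\<in>S. norm (?e (t n) k) ^ (2 * K) * (norm (a k))\<^sup>2)
       \<le> (LINT \<xi>|torus_measure. (norm ((fdiff j (t n) ^^ K) F \<xi>))\<^sup>2)"
      unfolding parseval[OF b, symmetric] by (intro mult_left_mono) auto
    then have "(inverse (t n)) ^ (2 * K) * ((2 * pi) ^ CARD('d) * (\<Sum>k\<in>S. norm (?e (t n) k) ^ (2 * K) * (norm (a k))\<^sup>2))
       \<le> (inverse (t n)) ^ (2 * K) * (LINT \<xi>|torus_measure. (norm ((fdiff j (t n) ^^ K) F \<xi>))\<^sup>2)"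
      using t by (intro mult_left_mono) (auto simp: less_imp_le)
    also have "\<dots> = (LINT \<xi>|torus_measure. (inverse (t n)) ^ (2 * K) * (norm ((fdiff j (t n) ^^ K) F \<xi>))\<^sup>2)"
      by simp
    also have "\<dots> = (LINT \<xi>|torus_measure. (norm (?G n \<xi>))\<^sup>2)"
      using t by (simp add: power_mult_distrib power_mult[symmetric] mult.commute abs_of_pos power_inverse)
    also have "(inverse (t n)) ^ (2 * K) * ((2 * pi) ^ CARD('d) * (\<Sum>k\<in>S. norm (?e (t n) k) ^ (2 * K) * (norm (a k))\<^sup>2))
       = (2 * pi) ^ CARD('d) * (\<Sum>k\<in>S. norm (?e (t n) k /\<^sub>R t n) ^ (2 * K) * (norm (a k))\<^sup>2)"
      using t by (simp add: sum_distrib_left power_mult_distrib mult_ac abs_of_pos)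
    finally show ?thesis .
  qed
  \<comment> \<open>The sum runs over the finite set \<open>S\<close>, so the limit may be taken
    term by term; the multiplier divided by t tends to i k_j.\<close>
  have left: "(\<lambda>n. (2 * pi) ^ CARD('d) * (\<Sum>k\<in>S. norm (?e (t n) k /\<^sub>R t n) ^ (2 * K) * (norm (a k))\<^sup>2))
     \<longlonglongrightarrow> (2 * pi) ^ CARD('d) * (\<Sum>k\<in>S. \<bar>of_int (k $ j)\<bar> ^ (2 * K) * (norm (a k))\<^sup>2)"
  proof (intro tendsto_intros)
    fix k :: "int ^ 'd"
    have "((\<lambda>s. \<i> * of_real (of_int (k $ j) * s)) has_vector_derivative \<i> * of_int (k $ j)) (at 0)"
      by (auto intro!: derivative_eq_intros)
    from has_vector_derivative_quotientD[OF field_vector_diff_chain_at[OF this DERIV_exp]]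
    have "((\<lambda>s. ?e s k /\<^sub>R s) \<longlongrightarrow> \<i> * of_int (k $ j)) (at 0)"
      by (simp add: o_def)
    then have "((\<lambda>s. ?e s k /\<^sub>R s) \<longlongrightarrow> \<i> * of_int (k $ j)) (at_right 0)"
      by (rule tendsto_mono[rotated]) (simp add: at_within_le_at)
    from tendsto_norm[OF filterlim_compose[OF this t_right]]
    show "(\<lambda>n. norm (?e (t n) k /\<^sub>R t n)) \<longlonglongrightarrow> \<bar>of_int (k $ j)\<bar>"
      by (simp add: norm_mult)
  qed
  have D: "class_C 0 ?D" using smooth by (intro class_C_funpow_partial) simp
  then have contD: "continuous_on UNIV ?D" by simp
  \<comment> \<open>K shifts of length at most 1 may leave the torus, so the derivative is bounded
    on a larger ball.\<close>
  define R where "R = pi * real CARD('d) + real K"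
  have "bounded (?D ` cball 0 R)"
    by (intro compact_imp_bounded compact_continuous_image continuous_on_subset[OF contD]) auto
  then obtain B where B: "\<And>x. norm x \<le> R \<Longrightarrow> norm (?D x) \<le> B" "B \<ge> 0"
    unfolding bounded_pos by (metis image_eqI less_imp_le mem_cball_0)
  have Gb: "norm (?G n \<xi>) \<le> B" if "\<xi> \<in> torus" for n \<xi>
  proof -
    have "norm ((fdiff j (t n) ^^ K) F \<xi> - t n ^ K *\<^sub>R 0) \<le> t n ^ K * B"
    proof (rule norm_funpow_fdiff_le[OF smooth])
      fix s assume s: "0 \<le> s" "s \<le> real K * t n"
      have "real K * t n \<le> real K * 1" using t by (intro mult_left_mono) auto
      have "norm (\<xi> + s *\<^sub>R axis j 1) \<le> norm \<xi> + s"
        by (rule order.trans[OF norm_triangle_ineq]) (use s in \<open>simp add: norm_axis_1\<close>)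
      also have "\<dots> \<le> R" using norm_torus_le[OF that] s \<open>real K * t n \<le> real K * 1\<close> by (simp add: R_def)
      finally show "norm (?D (\<xi> + s *\<^sub>R axis j 1) - 0) \<le> B" using B by simp
    qed (use t in \<open>simp add: less_imp_le\<close>)
    then show ?thesis using t[of n] by (simp add: divide_simps mult.commute abs_of_pos)
  qed
  have contG: "continuous_on UNIV (?G n)" for n
  proof -
    have "class_C 0 ((fdiff j (t n) ^^ i) F)" for i
      using class_C_mono[OF smooth, of 0] class_C_fdiff[of 0] by (induction i) auto
    then show ?thesis by (intro continuous_intros) simp
  qed
  have [measurable]: "?D \<in> borel_measurable borel" "?G n \<in> borel_measurable borel" for n
    using contD contG by (auto intro: borel_measurable_continuous_onI)
  have right: "(\<lambda>n. LINT \<xi>|torus_measure. (norm (?G n \<xi>))\<^sup>2) \<longlonglongrightarrow> (LINT \<xi>|torus_measure. (norm (?D \<xi>))\<^sup>2)"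
  proof (rule integral_dominated_convergence[where w = "\<lambda>_. B\<^sup>2"])
    show "AE \<xi> in torus_measure. (\<lambda>n. (norm (?G n \<xi>))\<^sup>2) \<longlonglongrightarrow> (norm (?D \<xi>))\<^sup>2"
      by (intro AE_I2 tendsto_intros filterlim_compose[OF tendsto_fdiff_quotient[OF smooth] t_right])
    show "AE \<xi> in torus_measure. norm ((norm (?G n \<xi>))\<^sup>2) \<le> B\<^sup>2" for n
      using Gb[of _ n] by (intro AE_I2) (simp add: power_mono)
    show "integrable torus_measure (\<lambda>\<xi> :: real ^ 'd. B\<^sup>2)"
      by (rule integrable_torus_measure_bounded[of _ "B\<^sup>2"]) auto
  qed measurable
  show ?thesis
    by (rule LIMSEQ_le[OF left right]) (use ineq in blast)
qed

section \<open>Derivative bounds for the modulated residues\<close>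

text \<open>Leibniz rule in geometric form: if the derivatives of both factors grow at rate b, those
  of the product grow at rate 2 b, the powers of 2 being sums of binomial coefficients.\<close>

lemma funpow_partial_mult_bound:
  assumes "class_C l f" "class_C l g" "b \<ge> 0"
    and "\<And>i. i \<le> l \<Longrightarrow> norm ((partial j ^^ i) f x) \<le> A * b ^ i"
    and "\<And>i. i \<le> l \<Longrightarrow> norm ((partial j ^^ i) g x) \<le> B * b ^ i"
  shows "norm ((partial j ^^ l) (\<lambda>x. f x * g x) x) \<le> A * B * (2 * b) ^ l"
  using assms
proof (induction l arbitrary: f g A B)
  case 0
  have "norm (f x) \<le> A" "norm (g x) \<le> B" using "0.prems"(4)[of 0] "0.prems"(5)[of 0] by auto
  moreover from this have "0 \<le> A" by (smt (verit) norm_ge_zero)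
  ultimately show ?case by (simp add: norm_mult mult_mono)
next
  case (Suc l)
  note f = Suc.prems(1) and g = Suc.prems(2)
  have f': "class_C l (partial j f)" and g': "class_C l (partial j g)"
    using f g by auto
  note f0 = class_C_SucD[OF f] and g0 = class_C_SucD[OF g]
  have 1: "norm ((partial j ^^ l) (\<lambda>x. partial j f x * g x) x) \<le> A * b * B * (2 * b) ^ l"
  proof (rule Suc.IH[OF f' g0 \<open>b \<ge> 0\<close>])
    show "norm ((partial j ^^ i) (partial j f) x) \<le> A * b * b ^ i" if "i \<le> l" for i
      using Suc.prems(4)[of "Suc i"] that by (simp add: funpow_swap1 mult.assoc)
    show "norm ((partial j ^^ i) g x) \<le> B * b ^ i" if "i \<le> l" for i
      using Suc.prems(5)[of i] that by simp
  qed
  have 2: "norm ((partial j ^^ l) (\<lambda>x. f x * partial j g x) x) \<le> A * (B * b) * (2 * b) ^ l"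
  proof (rule Suc.IH[OF f0 g' \<open>b \<ge> 0\<close>])
    show "norm ((partial j ^^ i) (partial j g) x) \<le> B * b * b ^ i" if "i \<le> l" for i
      using Suc.prems(5)[of "Suc i"] that by (simp add: funpow_swap1 mult.assoc)
    show "norm ((partial j ^^ i) f x) \<le> A * b ^ i" if "i \<le> l" for i
      using Suc.prems(4)[of i] that by simp
  qed
  have "(partial j ^^ Suc l) (\<lambda>x. f x * g x) = (partial j ^^ l) (\<lambda>x. partial j f x * g x + f x * partial j g x)"
    by (simp add: funpow_swap1 partial_mult[OF f g])
  also have "\<dots> = (\<lambda>x. (partial j ^^ l) (\<lambda>x. partial j f x * g x) x + (partial j ^^ l) (\<lambda>x. f x * partial j g x) x)"
    unfolding funpow_partial_eq_foldr
    by (rule foldr_partial_add[where k = 0]) (use class_C_mult[OF f' g0] class_C_mult[OF f0 g'] in auto)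
  finally have "norm ((partial j ^^ Suc l) (\<lambda>x. f x * g x) x) \<le> A * b * B * (2 * b) ^ l + A * (B * b) * (2 * b) ^ l"
    using norm_triangle_mono[OF 1 2] by simp
  then show ?case by (simp add: algebra_simps)
qed

text \<open>Only derivatives of \<open>h\<close> of order at least 1 are restricted, because
  \<open>h\<close> itself enters through |exp h|. The constant \<open>E\<close> is chosen before
  \<open>h\<close>, x and b, on which the later uniformity in n rests.\<close>

lemma funpow_partial_exp_bound:
  assumes "C \<ge> 0"
  shows "\<exists>E\<ge>0. \<forall>h x b. class_C l h \<longrightarrow> b \<ge> 0 \<longrightarrow> (\<forall>i. 1 \<le> i \<longrightarrow> i \<le> l \<longrightarrow> norm ((partial j ^^ i) h x) \<le> C * b ^ i) \<longrightarrow>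
    (\<forall>i\<le>l. norm ((partial j ^^ i) (\<lambda>x. exp (h x)) x) \<le> E * norm (exp (h x)) * b ^ i)"
proof (induction l)
  case 0
  show ?case by (intro exI[of _ 1]) auto
next
  case (Suc l)
  then obtain E where E: "E \<ge> 0" "\<And>h x b i. class_C l h \<Longrightarrow> b \<ge> 0 \<Longrightarrow>
      (\<And>i. 1 \<le> i \<Longrightarrow> i \<le> l \<Longrightarrow> norm ((partial j ^^ i) h x) \<le> C * b ^ i) \<Longrightarrow> i \<le> l \<Longrightarrow>
      norm ((partial j ^^ i) (\<lambda>x. exp (h x)) x) \<le> E * norm (exp (h x)) * b ^ i"
    by blast
  \<comment> \<open>The second entry of the maximum comes from the product bound for h' exp h, whose
    factor 2^l is pulled out of (2 b)^l.\<close>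
  show ?case
  proof (intro exI[of _ "max E (C * E * 2 ^ l)"] conjI allI impI)
    show "0 \<le> max E (C * E * 2 ^ l)" using E(1) by simp
    fix h :: "real ^ 'a \<Rightarrow> complex" and x :: "real ^ 'a" and b :: real and i
    assume h: "class_C (Suc l) h" and b: "b \<ge> 0"
      and hb: "\<forall>i. 1 \<le> i \<longrightarrow> i \<le> Suc l \<longrightarrow> norm ((partial j ^^ i) h x) \<le> C * b ^ i" and i: "i \<le> Suc l"
    let ?e = "\<lambda>x. exp (h x)"
    have IH: "norm ((partial j ^^ i) ?e x) \<le> E * norm (?e x) * b ^ i" if "i \<le> l" for i
      by (rule E(2)[OF class_C_SucD[OF h] b _ that]) (use hb in auto)
    show "norm ((partial j ^^ i) ?e x) \<le> max E (C * E * 2 ^ l) * norm (?e x) * b ^ i"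
    proof (cases "i \<le> l")
      case True
      show ?thesis
        by (rule order.trans[OF IH[OF True]]) (intro mult_right_mono, use b in auto)
    next
      case False
      then have i': "i = Suc l" using i by simp
      have "norm ((partial j ^^ l) (\<lambda>x. partial j h x * ?e x) x) \<le> C * b * (E * norm (?e x)) * (2 * b) ^ l"
      proof (rule funpow_partial_mult_bound)
        show "class_C l (partial j h)" "class_C l ?e"
          using h class_C_exp[OF class_C_SucD[OF h]] by auto
        show "norm ((partial j ^^ i) (partial j h) x) \<le> C * b * b ^ i" if "i \<le> l" for i
          using hb[rule_format, of "Suc i"] that by (simp add: funpow_swap1 mult.assoc)
      qed (use IH b in auto)
      then have "norm ((partial j ^^ Suc l) ?e x) \<le> (C * E * 2 ^ l) * norm (?e x) * b ^ Suc l"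
        by (simp add: funpow_swap1 partial_exp[OF h] power_mult_distrib mult_ac)
      also have "\<dots> \<le> max E (C * E * 2 ^ l) * norm (?e x) * b ^ Suc l"
        using b by (intro mult_right_mono) auto
      finally show ?thesis unfolding i' .
    qed
  qed
qed

text \<open>The exponent of \<open>e\<^bsup>\<lambda>\<phi>\<^esup>\<close> at \<open>\<lambda> = s\<^sup>2\<close>, recentred by the lattice point \<open>b\<close>.\<close>

definition centred_exponent :: "('d::finite \<Rightarrow> real \<Rightarrow> complex) \<Rightarrow> real \<Rightarrow> int ^ 'd \<Rightarrow> real ^ 'd \<Rightarrow> complex" where
  "centred_exponent \<phi> s b \<xi> = (\<Sum>i\<in>UNIV. of_real (s\<^sup>2) * \<phi> i (\<xi> $ i) - \<i> * of_int (b $ i) * of_real (\<xi> $ i))"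

lemma has_vector_derivative_of_real_coordinate:
  "((\<lambda>t. of_real ((\<xi> + t *\<^sub>R axis j 1) $ i) :: complex) has_vector_derivative (if j = i then 1 else 0)) (at 0)"
  by (rule has_vector_derivative_coordinate) (auto intro!: derivative_eq_intros)

lemma class_C_of_real_coordinate: "class_C k (\<lambda>\<xi>. of_real (\<xi> $ i))"
proof (cases k)
  case 0
  then show ?thesis by (auto intro!: continuous_intros)
next
  case (Suc l)
  show ?thesis
    unfolding Suc by (rule class_C_SucI[OF _ has_vector_derivative_of_real_coordinate])
       (auto intro!: continuous_intros class_C_const)
qed

lemma class_C_centred_exponent:
  assumes "\<And>i. class_C k (\<lambda>\<xi> :: real ^ 'd. \<phi> i (\<xi> $ i))"
  shows "class_C k (centred_exponent \<phi> s b)"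
  unfolding centred_exponent_def[abs_def]
  by (intro class_C_sum class_C_diff class_C_cmult class_C_of_real_coordinate assms)

lemma partial_centred_exponent:
  assumes "class_C (Suc k) (\<lambda>\<xi> :: real ^ 'd. \<phi> j (\<xi> $ j))"
  shows "partial j (centred_exponent \<phi> s b) =
    (\<lambda>\<xi>. of_real (s\<^sup>2) * partial j (\<lambda>\<xi>. \<phi> j (\<xi> $ j)) \<xi> - \<i> * of_int (b $ j))"
proof (rule ext, rule partial_eqI)
  fix \<xi> :: "real ^ 'd"
  let ?D = "partial j (\<lambda>\<xi>. \<phi> j (\<xi> $ j)) \<xi>"
  have d: "((\<lambda>t. of_real (s\<^sup>2) * \<phi> i ((\<xi> + t *\<^sub>R axis j 1) $ i) - \<i> * of_int (b $ i) * of_real ((\<xi> + t *\<^sub>R axis j 1) $ i))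
      has_vector_derivative of_real (s\<^sup>2) * (if j = i then ?D else 0) - \<i> * of_int (b $ i) * (if j = i then 1 else 0)) (at 0)" for i
  proof (intro has_vector_derivative_diff has_vector_derivative_mult_right has_vector_derivative_of_real_coordinate)
    show "((\<lambda>t. \<phi> i ((\<xi> + t *\<^sub>R axis j 1) $ i)) has_vector_derivative (if j = i then ?D else 0)) (at 0)"
    proof (cases "j = i")
      case True
      then show ?thesis using class_C_has_partial[OF assms, of \<xi> j] by simp
    qed (simp add: axis_def)
  qed
  have "((\<lambda>t. centred_exponent \<phi> s b (\<xi> + t *\<^sub>R axis j 1)) has_vector_derivative
      (\<Sum>i\<in>UNIV. of_real (s\<^sup>2) * (if j = i then ?D else 0) - \<i> * of_int (b $ i) * (if j = i then 1 else 0))) (at 0)"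
    unfolding centred_exponent_def by (rule has_vector_derivative_sum) (rule d)
  then show "((\<lambda>t. centred_exponent \<phi> s b (\<xi> + t *\<^sub>R axis j 1)) has_vector_derivative
      of_real (s\<^sup>2) * ?D - \<i> * of_int (b $ j)) (at 0)"
    by (simp add: sum_subtractf if_distrib[of "\<lambda>x. _ * x"] cong: if_cong)
qed

text \<open>The recentring term is linear, so it affects only the first derivative.\<close>

lemma funpow_partial_centred_exponent:
  assumes f: "class_C (Suc (Suc l)) (\<lambda>\<xi> :: real ^ 'd. \<phi> j (\<xi> $ j))"
  shows "(partial j ^^ Suc (Suc l)) (centred_exponent \<phi> s b) =
    (\<lambda>\<xi>. of_real (s\<^sup>2) * (partial j ^^ Suc (Suc l)) (\<lambda>\<xi>. \<phi> j (\<xi> $ j)) \<xi>)"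
proof -
  let ?f = "\<lambda>\<xi> :: real ^ 'd. \<phi> j (\<xi> $ j)"
  have f1: "class_C (Suc l) (partial j ?f)" and f2: "class_C l (partial j (partial j ?f))"
    using f by auto
  have "partial j (\<lambda>\<xi>. of_real (s\<^sup>2) * partial j ?f \<xi> - \<i> * of_int (b $ j)) = (\<lambda>\<xi>. of_real (s\<^sup>2) * partial j (partial j ?f) \<xi> - 0)"
    by (rule ext, rule partial_eqI)
       (intro has_vector_derivative_diff has_vector_derivative_mult_right class_C_has_partial[OF f1] has_vector_derivative_const)
  then have "(partial j ^^ Suc (Suc l)) (centred_exponent \<phi> s b) = (partial j ^^ l) (\<lambda>\<xi>. of_real (s\<^sup>2) * partial j (partial j ?f) \<xi>)"
    by (simp add: funpow_swap1 partial_centred_exponent[of "Suc l" \<phi> j s b, OF f])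
  also have "\<dots> = (\<lambda>\<xi>. of_real (s\<^sup>2) * (partial j ^^ l) (partial j (partial j ?f)) \<xi>)"
    unfolding funpow_partial_eq_foldr by (rule foldr_partial_cmult[where k = 0]) (use f2 in simp)
  finally show ?thesis by (simp add: funpow_swap1)
qed

lemma norm_exp_centred_exponent:
  "norm (exp (centred_exponent \<phi> s b \<xi>)) = exp (s\<^sup>2 * (\<Sum>i\<in>UNIV. Re (\<phi> i (\<xi> $ i))))"
  by (simp add: centred_exponent_def norm_exp_eq_Re sum_distrib_left)

text \<open>Since b is integral, recentring multiplies by a character of the lattice and merely
  translates the Fourier coefficients by b.\<close>

lemma exp_centred_exponent:
  "exp (centred_exponent \<phi> s b \<xi>) = exp (of_real (s\<^sup>2) * (\<Sum>i\<in>UNIV. \<phi> i (\<xi> $ i))) * lattice_char (- b) \<xi>"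
  by (simp add: centred_exponent_def lattice_char_def sum_subtractf sum_distrib_left sum_negf mult.assoc flip: exp_add)

lemma reference_exponents_Re_le:
  fixes \<phi> :: "'d::finite \<Rightarrow> real \<Rightarrow> complex"
  assumes ref: "\<And>j. reference_exponent K (\<phi> j) (m j) (\<sigma> $ j)"
  obtains c where "c > 0" "\<And>\<xi> :: real ^ 'd. \<xi> \<in> torus \<Longrightarrow> (\<Sum>i\<in>UNIV. Re (\<phi> i (\<xi> $ i))) \<le> - c * (norm \<xi>)\<^sup>2"
proof -
  have "\<forall>j. \<exists>c>0. \<forall>\<theta>. \<bar>\<theta>\<bar> \<le> pi \<longrightarrow> Re (\<phi> j \<theta>) \<le> - c * \<theta>\<^sup>2"
    using reference_exponent_Re_le[OF ref] by metis
  then obtain c where c: "\<And>j. c j > 0" "\<And>j \<theta>. \<bar>\<theta>\<bar> \<le> pi \<Longrightarrow> Re (\<phi> j \<theta>) \<le> - c j * \<theta>\<^sup>2"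
    by metis
  define c0 where "c0 = Min (range c)"
  have c0: "c0 \<le> c j" for j unfolding c0_def by (intro Min_le) auto
  have "c0 \<in> range c" unfolding c0_def by (intro Min_in) auto
  then have "c0 > 0" using c(1) by auto
  show ?thesis
  proof (rule that[OF \<open>c0 > 0\<close>])
    fix \<xi> :: "real ^ 'd" assume \<xi>: "\<xi> \<in> torus"
    have "Re (\<phi> i (\<xi> $ i)) \<le> - c0 * (\<xi> $ i)\<^sup>2" for i
    proof -
      have "Re (\<phi> i (\<xi> $ i)) \<le> - c i * (\<xi> $ i)\<^sup>2" using \<xi> by (intro c(2)) (simp add: torus_def)
      also have "\<dots> \<le> - c0 * (\<xi> $ i)\<^sup>2" using c0 by (intro mult_right_mono) auto
      finally show ?thesis .
    qed
    then have "(\<Sum>i\<in>UNIV. Re (\<phi> i (\<xi> $ i))) \<le> (\<Sum>i\<in>UNIV. - c0 * (\<xi> $ i)\<^sup>2)"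
      by (intro sum_mono)
    then show "(\<Sum>i\<in>UNIV. Re (\<phi> i (\<xi> $ i))) \<le> - c0 * (norm \<xi>)\<^sup>2"
      by (simp add: norm_cart_power2 sum_distrib_left sum_negf)
  qed
qed

text \<open>Each derivative in direction \<open>j\<close> costs a factor \<open>s (1 + s \<bar>\<xi>\<bar>)\<close>, both on
  \<open>exp (centred_exponent \<phi> s b)\<close> and on \<open>f\<close>.\<close>

lemma modulated_partial_bound:
  fixes \<phi> :: "'d::finite \<Rightarrow> real \<Rightarrow> complex" and j :: 'd
  assumes ref: "\<And>j. reference_exponent K (\<phi> j) (m j) (\<sigma> $ j)" and K: "K \<ge> 2"
    and Cf: "Cf \<ge> 0" and Kr: "K \<le> r + 1"
    and Re: "\<And>\<xi> :: real ^ 'd. \<xi> \<in> torus \<Longrightarrow> (\<Sum>i\<in>UNIV. Re (\<phi> i (\<xi> $ i))) \<le> - c * (norm \<xi>)\<^sup>2"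
  obtains C where "C \<ge> 0"
    and "\<And>s b f \<xi> l. s \<ge> 1 \<Longrightarrow> class_C K f \<Longrightarrow>
      (\<And>l \<xi>. l \<le> K \<Longrightarrow> \<xi> \<in> torus \<Longrightarrow> norm ((partial j ^^ l) f \<xi>) \<le> Cf * norm \<xi> ^ (r + 1 - l)) \<Longrightarrow>
      \<bar>s\<^sup>2 * m j - of_int (b $ j)\<bar> \<le> 1 \<Longrightarrow> \<xi> \<in> torus \<Longrightarrow> l \<le> K \<Longrightarrow>
      norm ((partial j ^^ l) (\<lambda>\<xi>. exp (centred_exponent \<phi> s b \<xi>) * f \<xi>) \<xi>)
       \<le> C * (s ^ l / s ^ (r + 1)) * (1 + s * norm \<xi>) ^ (r + 1 + K) * exp (- c * (s * norm \<xi>)\<^sup>2)"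
proof -
  let ?\<Phi> = "\<lambda>\<xi> :: real ^ 'd. \<phi> j (\<xi> $ j)"
  obtain C1 where C1: "C1 \<ge> 0"
    "\<And>\<xi> :: real ^ 'd. \<xi> \<in> torus \<Longrightarrow> norm (partial j ?\<Phi> \<xi> - \<i> * of_real (m j)) \<le> C1 * \<bar>\<xi> $ j\<bar>"
    "\<And>\<xi> :: real ^ 'd. \<And>l. \<xi> \<in> torus \<Longrightarrow> 2 \<le> l \<Longrightarrow> l \<le> K \<Longrightarrow> norm ((partial j ^^ l) ?\<Phi> \<xi>) \<le> C1"
    using reference_exponent_deriv_bounds[OF ref[of j] K, of j] by blast
  have \<Phi>: "class_C K (\<lambda>\<xi> :: real ^ 'd. \<phi> i (\<xi> $ i))" for i
    by (rule reference_exponent_smooth[OF ref])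
  have "C1 + 1 \<ge> 0" using C1 by simp
  from funpow_partial_exp_bound[OF this, of K j]
  obtain E where E: "E \<ge> 0" "\<And>h x b i. class_C K h \<Longrightarrow> b \<ge> 0 \<Longrightarrow>
      (\<And>i. 1 \<le> i \<Longrightarrow> i \<le> K \<Longrightarrow> norm ((partial j ^^ i) h x) \<le> (C1 + 1) * b ^ i) \<Longrightarrow> i \<le> K \<Longrightarrow>
      norm ((partial j ^^ i) (\<lambda>x. exp (h x)) x) \<le> E * norm (exp (h x)) * b ^ i"
    by blast
  show ?thesis
  proof
    show "0 \<le> E * Cf * 2 ^ K" using E Cf by simp
    fix s and b :: "int ^ 'd" and f and \<xi> :: "real ^ 'd" and l
    assume s: "(s :: real) \<ge> 1" and f: "class_C K f"
      and fb: "\<And>l \<xi>. l \<le> K \<Longrightarrow> \<xi> \<in> torus \<Longrightarrow> norm ((partial j ^^ l) f \<xi>) \<le> Cf * norm \<xi> ^ (r + 1 - l)"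
      and b: "\<bar>s\<^sup>2 * m j - of_int (b $ j)\<bar> \<le> 1" and \<xi>: "\<xi> \<in> torus" and l: "l \<le> K"
    \<comment> \<open>The norm of the rescaled frequency. All bounds become a power of s times a
      function of u.\<close>
    define u where "u = s * norm \<xi>"
    define B where "B = s * (1 + u)"
    have u: "u \<ge> 0" using s by (simp add: u_def)
    have sB: "s \<le> B" using s u by (simp add: B_def)
    then have B1: "B \<ge> 1" using s by simp
    let ?h = "centred_exponent \<phi> s b"
    have h: "class_C K ?h" by (rule class_C_centred_exponent[OF \<Phi>])
    \<comment> \<open>For i = 1, s^2 (\<phi>' - i m) is of size s^2 |\<xi>| = s u and the leftover
      drift is at most 1 by the choice of b; without recentring a term of size s^2 would remain. For
      i \<ge> 2, the factor s^2 is absorbed by s^2 \<le> B^2 \<le> B^i.\<close>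
    have hb: "norm ((partial j ^^ i) ?h \<xi>) \<le> (C1 + 1) * B ^ i" if i: "1 \<le> i" "i \<le> K" for i
    proof (cases "i = 1")
      case True
      obtain K' where K': "K = Suc K'" using K by (cases K) auto
      have "partial j ?h \<xi> = of_real (s\<^sup>2) * (partial j ?\<Phi> \<xi> - \<i> * of_real (m j)) + \<i> * of_real (s\<^sup>2 * m j - of_int (b $ j))"
        using partial_centred_exponent[of K' \<phi> j s b] \<Phi>[of j] K' by (simp add: algebra_simps)
      also have "norm \<dots> \<le> s\<^sup>2 * (C1 * \<bar>\<xi> $ j\<bar>) + 1"
      proof (rule norm_triangle_mono)
        show "norm (of_real (s\<^sup>2) * (partial j ?\<Phi> \<xi> - \<i> * of_real (m j))) \<le> s\<^sup>2 * (C1 * \<bar>\<xi> $ j\<bar>)"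
          unfolding norm_mult using C1(2)[OF \<xi>] by (intro mult_mono) (auto simp: norm_power)
        have "norm (\<i> * complex_of_real (s\<^sup>2 * m j - of_int (b $ j))) = \<bar>s\<^sup>2 * m j - of_int (b $ j)\<bar>"
          by (simp only: norm_mult norm_of_real) simp
        then show "norm (\<i> * complex_of_real (s\<^sup>2 * m j - of_int (b $ j))) \<le> 1" using b by simp
      qed
      also have "s\<^sup>2 * (C1 * \<bar>\<xi> $ j\<bar>) \<le> s\<^sup>2 * (C1 * norm \<xi>)"
        using C1(1) component_le_norm_cart by (intro mult_left_mono) auto
      also have "s\<^sup>2 * (C1 * norm \<xi>) = C1 * (s * u)" by (simp add: u_def power2_eq_square)
      also have "C1 * (s * u) + 1 \<le> C1 * B + B"
        using C1(1) s u B1 by (intro add_mono mult_left_mono) (auto simp: B_def)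
      finally show ?thesis using True by (simp add: algebra_simps)
    next
      case False
      then obtain i' where i': "i = Suc (Suc i')" using i by (metis One_nat_def Suc_le_D le_antisym not_less_eq_eq)
      have "class_C (Suc (Suc i')) ?\<Phi>" using class_C_mono[OF \<Phi>] i i' by blast
      then have "norm ((partial j ^^ i) ?h \<xi>) = s\<^sup>2 * norm ((partial j ^^ i) ?\<Phi> \<xi>)"
        unfolding i' by (subst funpow_partial_centred_exponent) (auto simp: norm_mult norm_power)
      also have "\<dots> \<le> s\<^sup>2 * C1" using i i' by (intro mult_left_mono C1(3)[OF \<xi>]) auto
      also have "\<dots> \<le> B\<^sup>2 * (C1 + 1)" using s sB C1(1) by (intro mult_mono power_mono) auto
      also have "\<dots> \<le> B ^ i * (C1 + 1)"
        using B1 C1(1) i i' by (intro mult_right_mono power_increasing) auto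
      finally show ?thesis by (simp add: mult.commute)
    qed
    \<comment> \<open>Vanishing of order r + 1 at 0 becomes a negative power of s: |\<xi>|^(r + 1 -
      i) = u^(r + 1 - i) s^i / s^(r + 1).\<close>
    define A where "A = Cf * (1 + u) ^ (r + 1) / s ^ (r + 1)"
    have A0: "A \<ge> 0" unfolding A_def using Cf s u by simp
    have fA: "norm ((partial j ^^ i) f \<xi>) \<le> A * B ^ i" if "i \<le> K" for i
    proof -
      have ir: "i \<le> r + 1" using that Kr by simp
      have "norm \<xi> ^ (r + 1 - i) * s ^ (r + 1) = u ^ (r + 1 - i) * s ^ i"
        unfolding u_def power_mult_distrib using ir by (simp add: mult_ac flip: power_add)
      also have "\<dots> \<le> (1 + u) ^ (r + 1) * B ^ i"
      proof (rule mult_mono)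
        have "u ^ (r + 1 - i) \<le> (1 + u) ^ (r + 1 - i)" using u by (intro power_mono) auto
        also have "\<dots> \<le> (1 + u) ^ (r + 1)" using u by (intro power_increasing) auto
        finally show "u ^ (r + 1 - i) \<le> (1 + u) ^ (r + 1)" .
      qed (use s sB u in \<open>auto intro: power_mono\<close>)
      finally have "norm \<xi> ^ (r + 1 - i) \<le> (1 + u) ^ (r + 1) * B ^ i / s ^ (r + 1)"
        using s by (simp add: field_simps)
      then have "Cf * norm \<xi> ^ (r + 1 - i) \<le> Cf * ((1 + u) ^ (r + 1) * B ^ i / s ^ (r + 1))"
        using Cf by (intro mult_left_mono)
      then show ?thesis using fb[OF that \<xi>] by (simp add: A_def mult_ac)
    qed
    have "norm (exp (?h \<xi>)) \<le> exp (- c * u\<^sup>2)"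
    proof -
      have "s\<^sup>2 * (\<Sum>i\<in>UNIV. Re (\<phi> i (\<xi> $ i))) \<le> s\<^sup>2 * (- c * (norm \<xi>)\<^sup>2)"
        using Re[OF \<xi>] by (intro mult_left_mono) auto
      then show ?thesis unfolding norm_exp_centred_exponent by (simp add: u_def power_mult_distrib mult_ac)
    qed
    have "norm ((partial j ^^ l) (\<lambda>\<xi>. exp (?h \<xi>) * f \<xi>) \<xi>) \<le> (E * norm (exp (?h \<xi>))) * A * (2 * B) ^ l"
    proof (rule funpow_partial_mult_bound)
      show "class_C l (\<lambda>\<xi>. exp (?h \<xi>))" "class_C l f"
        using class_C_mono[OF class_C_exp[OF h] l] class_C_mono[OF f l] by auto
      show "norm ((partial j ^^ i) (\<lambda>\<xi>. exp (?h \<xi>)) \<xi>) \<le> E * norm (exp (?h \<xi>)) * B ^ i" if "i \<le> l" for i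
        by (rule E(2)[OF h]) (use hb that l B1 in auto)
      show "norm ((partial j ^^ i) f \<xi>) \<le> A * B ^ i" if "i \<le> l" for i
        using fA that l by simp
    qed (use B1 in simp)
    also have "\<dots> \<le> (E * exp (- c * u\<^sup>2)) * A * (2 ^ K * s ^ l * (1 + u) ^ K)"
    proof (intro mult_mono)
      have "(2 * B) ^ l = 2 ^ l * s ^ l * (1 + u) ^ l" by (simp add: B_def power_mult_distrib)
      also have "\<dots> \<le> 2 ^ K * s ^ l * (1 + u) ^ K"
        using l s u by (intro mult_mono power_increasing) auto
      finally show "(2 * B) ^ l \<le> 2 ^ K * s ^ l * (1 + u) ^ K" .
    qed (use E(1) s B1 A0 \<open>norm (exp (?h \<xi>)) \<le> exp (- c * u\<^sup>2)\<close> in auto)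
    also have "\<dots> = E * Cf * 2 ^ K * (s ^ l / s ^ (r + 1)) * (1 + u) ^ (r + 1 + K) * exp (- c * u\<^sup>2)"
      unfolding A_def power_add[of "1 + u" "r + 1" K] by (simp add: mult_ac)
    finally show "norm ((partial j ^^ l) (\<lambda>\<xi>. exp (?h \<xi>) * f \<xi>) \<xi>)
       \<le> E * Cf * 2 ^ K * (s ^ l / s ^ (r + 1)) * (1 + s * norm \<xi>) ^ (r + 1 + K) * exp (- c * (s * norm \<xi>)\<^sup>2)"
      unfolding u_def .
  qed
qed

text \<open>Moments of |a|^2 about b are moments about 0 of the translated coefficients, that is, of
  the recentred function, to which \<open>bessel_partial\<close> applies. Enlarging the torus to the
  whole space and substituting u = s \<xi> produces the factor s^(-d).\<close>

lemma second_moment_bound: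
  fixes \<phi> :: "'d::finite \<Rightarrow> real \<Rightarrow> complex" and a :: "int ^ 'd \<Rightarrow> complex"
  assumes a: "(\<lambda>k. norm (a k)) summable_on UNIV"
    and F: "\<And>\<xi>. exp (of_real (s\<^sup>2) * (\<Sum>i\<in>UNIV. \<phi> i (\<xi> $ i))) * f \<xi> = (\<Sum>\<^sub>\<infinity>k. a k * lattice_char k \<xi>)"
    and \<Phi>: "\<And>i. class_C l (\<lambda>\<xi> :: real ^ 'd. \<phi> i (\<xi> $ i))" and f: "class_C l f" and "s > 0" "c > 0"
    and bound: "\<And>\<xi>. \<xi> \<in> torus \<Longrightarrow> norm ((partial j ^^ l) (\<lambda>\<xi>. exp (centred_exponent \<phi> s b \<xi>) * f \<xi>) \<xi>)
       \<le> Q * (1 + s * norm \<xi>) ^ N * exp (- c * (s * norm \<xi>)\<^sup>2)"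
    and "finite S"
  shows "(2 * pi) ^ CARD('d) * (\<Sum>k\<in>S. \<bar>of_int (k $ j - b $ j)\<bar> ^ (2 * l) * (norm (a k))\<^sup>2)
    \<le> Q\<^sup>2 / s ^ CARD('d) * (LINT u|lborel. (1 + norm (u :: real ^ 'd)) ^ (2 * N) * exp (- (2 * c) * (norm u)\<^sup>2))"
proof -
  let ?F = "\<lambda>\<xi>. exp (centred_exponent \<phi> s b \<xi>) * f \<xi>"
  have bij: "bij (\<lambda>k. k + b)" by (rule bij_plus_right)
  have a': "(\<lambda>k. norm (a (k + b))) summable_on UNIV"
    using a summable_on_reindex_bij_betw[OF bij, of "\<lambda>k. norm (a k)"] by simp
  have F': "?F \<xi> = (\<Sum>\<^sub>\<infinity>k. a (k + b) * lattice_char k \<xi>)" for \<xi>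
  proof -
    have "?F \<xi> = (\<Sum>\<^sub>\<infinity>k. a k * lattice_char k \<xi>) * lattice_char (- b) \<xi>"
      unfolding exp_centred_exponent F[symmetric] by (simp add: mult_ac)
    also have "\<dots> = (\<Sum>\<^sub>\<infinity>k. a k * lattice_char k \<xi> * lattice_char (- b) \<xi>)"
      by (rule infsum_cmult_left'[symmetric])
    also have "\<dots> = (\<Sum>\<^sub>\<infinity>k. a k * lattice_char (k - b) \<xi>)"
      by (simp add: mult.assoc flip: lattice_char_add_left)
    also have "\<dots> = (\<Sum>\<^sub>\<infinity>k. a (k + b) * lattice_char k \<xi>)"
      using infsum_reindex_bij_betw[OF bij, of "\<lambda>k. a k * lattice_char (k - b) \<xi>"] by simp
    finally show ?thesis .
  qed
  have smooth: "class_C l ?F"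
    by (intro class_C_mult class_C_exp class_C_centred_exponent \<Phi> f)
  have "(\<Sum>k\<in>S. \<bar>of_int (k $ j - b $ j)\<bar> ^ (2 * l) * (norm (a k))\<^sup>2)
     = (\<Sum>k\<in>(\<lambda>k. k - b) ` S. \<bar>of_int (k $ j)\<bar> ^ (2 * l) * (norm (a (k + b)))\<^sup>2)"
    by (subst sum.reindex) (auto simp: inj_on_def)
  then have "(2 * pi) ^ CARD('d) * (\<Sum>k\<in>S. \<bar>of_int (k $ j - b $ j)\<bar> ^ (2 * l) * (norm (a k))\<^sup>2)
     \<le> (LINT \<xi>|torus_measure. (norm ((partial j ^^ l) ?F \<xi>))\<^sup>2)"
    using bessel_partial[OF a' F' smooth, of "(\<lambda>k. k - b) ` S" j] \<open>finite S\<close> by simp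
  also have "\<dots> = (LINT \<xi>|lborel. indicator torus \<xi> *\<^sub>R (norm ((partial j ^^ l) ?F \<xi>))\<^sup>2)"
    by (rule integral_torus_measure)
  also have "\<dots> \<le> (LINT \<xi>|lborel. Q\<^sup>2 * ((1 + s * norm (\<xi> :: real ^ 'd)) ^ (2 * N) * exp (- (2 * c) * (s * norm \<xi>)\<^sup>2)))"
  proof (rule Bochner_Integration.integral_mono')
    let ?g = "\<lambda>u :: real ^ 'd. (1 + norm u) ^ (2 * N) * exp (- (2 * c) * (norm u)\<^sup>2)"
    have i: "integrable lborel ?g" using \<open>c > 0\<close> by (intro integrable_gaussian_moment_cart) simp
    have sc: "(0 :: real ^ 'd) + (\<chi> j. (\<chi> j. s) $ j * \<xi> $ j) = s *\<^sub>R \<xi>" for \<xi> :: "real ^ 'd"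
      by (simp add: vec_eq_iff)
    have "integrable lborel (\<lambda>\<xi>. ?g (s *\<^sub>R \<xi>))"
      using integrable_diag_scale[of "\<chi> j. s" ?g 0] i \<open>s > 0\<close> unfolding sc by simp
    then show "integrable lborel (\<lambda>\<xi> :: real ^ 'd. Q\<^sup>2 * ((1 + s * norm \<xi>) ^ (2 * N) * exp (- (2 * c) * (s * norm \<xi>)\<^sup>2)))"
      using \<open>s > 0\<close> by (intro integrable_mult_right) simp
    fix \<xi> :: "real ^ 'd"
    show "indicator torus \<xi> *\<^sub>R (norm ((partial j ^^ l) ?F \<xi>))\<^sup>2 \<le> Q\<^sup>2 * ((1 + s * norm \<xi>) ^ (2 * N) * exp (- (2 * c) * (s * norm \<xi>)\<^sup>2))"
    proof (cases "\<xi> \<in> torus")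
      case True
      have "(norm ((partial j ^^ l) ?F \<xi>))\<^sup>2 \<le> (Q * (1 + s * norm \<xi>) ^ N * exp (- c * (s * norm \<xi>)\<^sup>2))\<^sup>2"
        by (intro power_mono bound[OF True]) simp
      also have "\<dots> = Q\<^sup>2 * ((1 + s * norm \<xi>) ^ (2 * N) * exp (- (2 * c) * (s * norm \<xi>)\<^sup>2))"
      proof -
        have "(exp (- c * (s * norm \<xi>)\<^sup>2))\<^sup>2 = exp (- (2 * c) * (s * norm \<xi>)\<^sup>2)"
          unfolding power2_eq_square[of "exp _"] by (simp flip: exp_add)
        then show ?thesis by (simp only: power_mult_distrib mult.assoc power_mult[symmetric] mult.commute[of N 2])
      qed
      finally show ?thesis using True by simp
    qed simp
  qed simp
  also have "\<dots> = Q\<^sup>2 * (LINT \<xi>|lborel. (1 + s * norm (\<xi> :: real ^ 'd)) ^ (2 * N) * exp (- (2 * c) * (s * norm \<xi>)\<^sup>2))"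
    by simp
  also have "(LINT \<xi>|lborel. (1 + s * norm (\<xi> :: real ^ 'd)) ^ (2 * N) * exp (- (2 * c) * (s * norm \<xi>)\<^sup>2))
    = (LINT u|lborel. (1 + norm (u :: real ^ 'd)) ^ (2 * N) * exp (- (2 * c) * (norm u)\<^sup>2)) / s ^ CARD('d)"
  proof -
    let ?g = "\<lambda>u :: real ^ 'd. (1 + norm u) ^ (2 * N) * exp (- (2 * c) * (norm u)\<^sup>2)"
    have sc: "(0 :: real ^ 'd) + (\<chi> j. (\<chi> j. s) $ j * \<xi> $ j) = s *\<^sub>R \<xi>" for \<xi> :: "real ^ 'd"
      by (simp add: vec_eq_iff)
    have "integral\<^sup>L lborel ?g = s ^ CARD('d) * (LINT \<xi>|lborel. ?g (s *\<^sub>R \<xi>))"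
      using integral_diag_scale[of "\<chi> j. s" ?g 0] \<open>s > 0\<close> unfolding sc by simp
    then show ?thesis using \<open>s > 0\<close> by simp
  qed
  finally show ?thesis by (simp add: mult_ac)
qed

section \<open>Pointwise limit\<close>

text \<open>With \<theta> = u / (s \<sigma>), the part s^2 (\<phi>(\<theta>) - i m \<theta>) tends
  to - u^2 / 2. The remaining phase (\<kappa> - s^2 m) \<theta> tends to u x, since rounding changes
  \<kappa> by at most 1 while \<theta> is of order 1 / s.\<close>

lemma centred_exponent_term_tendsto:
  assumes ref: "reference_exponent K \<phi> m \<sigma>" and s: "\<And>n. s n \<ge> 1" "filterlim s at_top sequentially"
    and \<kappa>: "\<And>n. \<bar>of_int (\<kappa> n) - ((s n)\<^sup>2 * m + s n * \<sigma> * x)\<bar> \<le> 1"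
  shows "(\<lambda>n. of_real ((s n)\<^sup>2) * \<phi> (u / (s n * \<sigma>)) - \<i> * of_int (\<kappa> n) * of_real (u / (s n * \<sigma>)))
    \<longlonglongrightarrow> - of_real (u\<^sup>2 / 2) - \<i> * of_real (u * x)"
proof (cases "u = 0")
  case True
  then show ?thesis using ref by (simp add: reference_exponent_def)
next
  case False
  have \<sigma>: "\<sigma> > 0" using ref by (simp add: reference_exponent_def)
  have sn: "s n > 0" for n using s(1)[of n] by simp
  define \<theta> where "\<theta> = (\<lambda>n. u / (s n * \<sigma>))"
  have inv: "(\<lambda>n. inverse (s n)) \<longlonglongrightarrow> 0"
    by (rule tendsto_inverse_0_at_top[OF s(2)])
  have "(\<lambda>n. (u / \<sigma>) * inverse (s n)) \<longlonglongrightarrow> (u / \<sigma>) * 0"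
    by (intro tendsto_intros inv)
  then have "\<theta> \<longlonglongrightarrow> 0" by (simp add: \<theta>_def field_simps)
  moreover have \<theta>0: "\<theta> n \<noteq> 0" for n using False \<sigma> sn[of n] by (simp add: \<theta>_def)
  ultimately have \<theta>: "filterlim \<theta> (at 0) sequentially"
    by (auto simp: filterlim_at intro: always_eventually)
  have q: "(\<lambda>n. (\<phi> (\<theta> n) - \<i> * of_real (m * \<theta> n)) / of_real ((\<theta> n)\<^sup>2)) \<longlonglongrightarrow> - of_real (\<sigma>\<^sup>2 / 2)"
    by (rule filterlim_compose[OF reference_exponent_quotient[OF ref] \<theta>])
  have "(\<lambda>n. (of_int (\<kappa> n) - (s n)\<^sup>2 * m) / s n - \<sigma> * x) \<longlonglongrightarrow> 0"
  proof (rule tendsto_rabs_zero_cancel, rule tendsto_sandwich[OF _ _ tendsto_const inv])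
    show "\<forall>\<^sub>F n in sequentially. \<bar>(of_int (\<kappa> n) - (s n)\<^sup>2 * m) / s n - \<sigma> * x\<bar> \<le> inverse (s n)"
    proof (rule always_eventually, rule allI)
      fix n
      have "(of_int (\<kappa> n) - (s n)\<^sup>2 * m) / s n - \<sigma> * x = (of_int (\<kappa> n) - ((s n)\<^sup>2 * m + s n * \<sigma> * x)) / s n"
        using sn[of n] by (simp add: field_simps)
      also have "\<bar>\<dots>\<bar> \<le> 1 / s n"
        unfolding abs_divide abs_of_pos[OF sn] using sn[of n] by (intro divide_right_mono \<kappa>) simp
      finally show "\<bar>(of_int (\<kappa> n) - (s n)\<^sup>2 * m) / s n - \<sigma> * x\<bar> \<le> inverse (s n)"
        by (simp add: inverse_eq_divide)
    qed
  qed (auto intro: always_eventually)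
  then have \<kappa>lim: "(\<lambda>n. (of_int (\<kappa> n) - (s n)\<^sup>2 * m) / s n) \<longlonglongrightarrow> \<sigma> * x"
    by (rule LIM_zero_cancel)
  have "(\<lambda>n. of_real (u\<^sup>2 / \<sigma>\<^sup>2) * ((\<phi> (\<theta> n) - \<i> * of_real (m * \<theta> n)) / of_real ((\<theta> n)\<^sup>2))
        - \<i> * of_real ((of_int (\<kappa> n) - (s n)\<^sup>2 * m) / s n * (u / \<sigma>)))
     \<longlonglongrightarrow> of_real (u\<^sup>2 / \<sigma>\<^sup>2) * (- of_real (\<sigma>\<^sup>2 / 2)) - \<i> * of_real (\<sigma> * x * (u / \<sigma>))"
    by (intro tendsto_intros q \<kappa>lim)
  also have "of_real (u\<^sup>2 / \<sigma>\<^sup>2) * (- of_real (\<sigma>\<^sup>2 / 2)) - \<i> * of_real (\<sigma> * x * (u / \<sigma>)) = - of_real (u\<^sup>2 / 2) - \<i> * complex_of_real (u * x)"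
    using \<sigma> by (simp add: field_simps)
  also have "(\<lambda>n. of_real (u\<^sup>2 / \<sigma>\<^sup>2) * ((\<phi> (\<theta> n) - \<i> * of_real (m * \<theta> n)) / of_real ((\<theta> n)\<^sup>2))
        - \<i> * of_real ((of_int (\<kappa> n) - (s n)\<^sup>2 * m) / s n * (u / \<sigma>)))
    = (\<lambda>n. of_real ((s n)\<^sup>2) * \<phi> (u / (s n * \<sigma>)) - \<i> * of_int (\<kappa> n) * of_real (u / (s n * \<sigma>)))"
  proof
    fix n
    have "of_real (u\<^sup>2 / \<sigma>\<^sup>2) = of_real ((s n)\<^sup>2) * complex_of_real ((\<theta> n)\<^sup>2)"
      using \<sigma> sn[of n] by (simp add: \<theta>_def power_divide power_mult_distrib)
    then have 1: "of_real (u\<^sup>2 / \<sigma>\<^sup>2) * ((\<phi> (\<theta> n) - \<i> * of_real (m * \<theta> n)) / of_real ((\<theta> n)\<^sup>2))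
      = of_real ((s n)\<^sup>2) * (\<phi> (\<theta> n) - \<i> * of_real (m * \<theta> n))"
      using \<theta>0[of n] by simp
    have 2: "(of_int (\<kappa> n) - (s n)\<^sup>2 * m) / s n * (u / \<sigma>) = (of_int (\<kappa> n) - (s n)\<^sup>2 * m) * \<theta> n"
      using \<sigma> sn[of n] by (simp add: \<theta>_def)
    have 3: "u / (s n * \<sigma>) = \<theta> n" by (simp add: \<theta>_def)
    show "of_real (u\<^sup>2 / \<sigma>\<^sup>2) * ((\<phi> (\<theta> n) - \<i> * of_real (m * \<theta> n)) / of_real ((\<theta> n)\<^sup>2))
        - \<i> * of_real ((of_int (\<kappa> n) - (s n)\<^sup>2 * m) / s n * (u / \<sigma>))
      = of_real ((s n)\<^sup>2) * \<phi> (u / (s n * \<sigma>)) - \<i> * of_int (\<kappa> n) * of_real (u / (s n * \<sigma>))"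
      unfolding 1 2 3 by (simp add: algebra_simps)
  qed
  finally show ?thesis .
qed

lemma i_monom_diag: "i_monom (\<chi> j. c $ j * \<xi> $ j) \<alpha> = of_real (mi_power c \<alpha>) * i_monom \<xi> \<alpha>"
  by (simp add: i_monom_def mi_power_def power_mult_distrib prod.distrib mult_ac)

lemma i_poly_scaleR: "i_poly q b (c *\<^sub>R \<xi>) = of_real (c ^ q) * i_poly q b \<xi>"
proof -
  have "i_monom (c *\<^sub>R \<xi>) \<alpha> = of_real (c ^ q) * i_monom \<xi> \<alpha>" if "mi_abs \<alpha> = q" for \<alpha>
  proof -
    have "mi_power (\<chi> j. c) \<alpha> = c ^ q" using that by (simp add: mi_power_def mi_abs_def power_sum[symmetric])
    moreover have "c *\<^sub>R \<xi> = (\<chi> j. (\<chi> j. c) $ j * \<xi> $ j)" by (simp add: vec_eq_iff)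
    ultimately show ?thesis using i_monom_diag[of "\<chi> j. c" \<xi> \<alpha>] by simp
  qed
  then show ?thesis by (auto simp: i_poly_def sum_distrib_left mult_ac intro!: sum.cong)
qed

text \<open>The cell that contains s^2 m + s \<sigma> x. The nested \<open>\<chi>\<close> reproduces
  literally the shape of the affine map in \<open>integral_floor_vec\<close>.\<close>

abbreviation lattice_point :: "('d \<Rightarrow> real) \<Rightarrow> real ^ 'd \<Rightarrow> real \<Rightarrow> real ^ 'd \<Rightarrow> int ^ 'd" where
  "lattice_point m \<sigma> s x \<equiv> floor_vec ((\<chi> j. s\<^sup>2 * m j) + (\<chi> j. (\<chi> j. s * \<sigma> $ j) $ j * x $ j))"

text \<open>In the rescaled inversion integral, \<open>f1\<close> together with the quadratic decay
  gives a majorant independent of n, while \<open>f2\<close> identifies the limit of the integrand;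
  the rest is the Gaussian integral of monomials.\<close>

lemma pointwise_limit:
  fixes \<phi> :: "'d::finite \<Rightarrow> real \<Rightarrow> complex" and m :: "'d \<Rightarrow> real" and \<sigma> x :: "real ^ 'd"
    and a :: "nat \<Rightarrow> int ^ 'd \<Rightarrow> complex" and f :: "nat \<Rightarrow> real ^ 'd \<Rightarrow> complex"
  assumes ref: "\<And>j. reference_exponent K (\<phi> j) (m j) (\<sigma> $ j)"
    and s: "\<And>n. s n \<ge> 1" "filterlim s at_top sequentially"
    and a: "\<And>n. (\<lambda>k. norm (a n k)) summable_on UNIV"
    and F: "\<And>n \<xi>. exp (of_real ((s n)\<^sup>2) * (\<Sum>i\<in>UNIV. \<phi> i (\<xi> $ i))) * f n \<xi> = (\<Sum>\<^sub>\<infinity>k. a n k * lattice_char k \<xi>)"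
    and cont: "\<And>n. continuous_on UNIV (f n)"
    and f1: "\<And>n \<xi>. \<xi> \<in> torus \<Longrightarrow> norm (f n \<xi>) \<le> C * norm \<xi> ^ (r + 1)"
    and f2: "\<And>n \<xi>. \<xi> \<in> torus \<Longrightarrow> norm (f n \<xi> - i_poly (r + 1) (\<beta>\<^sub>n n) \<xi>) \<le> C * norm \<xi> ^ (r + 2)"
    and \<beta>: "\<And>\<alpha>. mi_abs \<alpha> = r + 1 \<Longrightarrow> (\<lambda>n. \<beta>\<^sub>n n \<alpha>) \<longlonglongrightarrow> \<beta> \<alpha>"
    and c: "c > 0" and Re: "\<And>\<xi> :: real ^ 'd. \<xi> \<in> torus \<Longrightarrow> (\<Sum>i\<in>UNIV. Re (\<phi> i (\<xi> $ i))) \<le> - c * (norm \<xi>)\<^sup>2"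
  shows "(\<lambda>n. of_real (s n ^ (CARD('d) + (r + 1)) * (\<Prod>j\<in>UNIV. \<sigma> $ j)) *
      a n (lattice_point m \<sigma> (s n) x))
    \<longlonglongrightarrow> of_real (exp (- (norm x)\<^sup>2 / 2) / (2 * pi) powr (CARD('d) / 2)) *
        (\<Sum>\<alpha> | mi_abs \<alpha> = r + 1. \<beta> \<alpha> * of_real (mi_hermite \<alpha> x / mi_power \<sigma> \<alpha>))"
proof -
  let ?d = "CARD('d)"
  have \<sigma>: "\<sigma> $ j > 0" for j using ref[of j] by (simp add: reference_exponent_def)
  have sn: "s n > 0" for n using s(1)[of n] by simp
  have inv: "(\<lambda>n. inverse (s n)) \<longlonglongrightarrow> 0"
    by (rule tendsto_inverse_0_at_top[OF s(2)])
  \<comment> \<open>Read off from \<open>f1\<close> at the corner (pi, ..., pi) of the torus, whose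
    norm is positive.\<close>
  have C: "C \<ge> 0"
  proof -
    define \<xi> :: "real ^ 'd" where "\<xi> = (\<chi> j. pi)"
    have "\<xi> \<in> torus" by (simp add: \<xi>_def torus_def)
    from f1[OF this] have "0 \<le> C * norm \<xi> ^ (r + 1)" by (meson norm_ge_zero order.trans)
    moreover have "norm \<xi> > 0" by (auto simp: \<xi>_def vec_eq_iff)
    then have "norm \<xi> ^ (r + 1) > 0" by (rule zero_less_power)
    ultimately show ?thesis using mult_neg_pos[of C "norm \<xi> ^ (r + 1)"] by linarith
  qed
  define P where "P = (\<Prod>j\<in>UNIV. \<sigma> $ j)"
  have P: "P > 0" unfolding P_def by (intro prod_pos) (use \<sigma> in auto)
  define k where "k = (\<lambda>n. lattice_point m \<sigma> (s n) x)"
  have k: "\<bar>of_int (k n $ j) - ((s n)\<^sup>2 * m j + s n * \<sigma> $ j * x $ j)\<bar> \<le> 1" for n j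
    unfolding k_def floor_vec_def by (simp, linarith)
  \<comment> \<open>Division by \<sigma> makes the limiting Gaussian standard and is the source of
    \<open>mi_power \<sigma> \<alpha>\<close> in the denominators.\<close>
  define v where "v = (\<lambda>u :: real ^ 'd. (\<chi> j. (\<chi> j. inverse (\<sigma> $ j)) $ j * u $ j) :: real ^ 'd)"
  define \<theta> where "\<theta> = (\<lambda>n u. inverse (s n) *\<^sub>R v u)"
  have \<theta>j: "\<theta> n u $ j = u $ j / (s n * \<sigma> $ j)" for n u j
    by (simp add: \<theta>_def v_def field_simps)
  have norm_\<theta>: "norm (\<theta> n u) = norm (v u) / s n" for n u
    using sn[of n] by (simp add: \<theta>_def divide_inverse mult.commute)
  define I where "I = (\<lambda>n u. indicator torus (\<theta> n u) *\<^sub>R (of_real (s n ^ (r + 1)) * f n (\<theta> n u) * exp (centred_exponent \<phi> (s n) (k n) (\<theta> n u))))"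
  \<comment> \<open>Fourier inversion followed by the substitution \<xi> = \<theta> n u, whose
    Jacobian 1 / (s^d P) accounts for part of the normalization on the left.\<close>
  have step1: "of_real (s n ^ (?d + (r + 1)) * P) * a n (k n) = of_real (inverse ((2 * pi) ^ ?d)) * (LINT u|lborel. I n u)" for n
  proof -
    let ?g = "\<lambda>\<xi>. indicator torus \<xi> *\<^sub>R (exp (centred_exponent \<phi> (s n) (k n) \<xi>) * f n \<xi>)"
    have "class_C 0 (centred_exponent \<phi> (s n) (k n))"
      by (intro class_C_centred_exponent class_C_mono[OF reference_exponent_smooth[OF ref]]) simp
    then have "continuous_on UNIV (\<lambda>\<xi>. exp (centred_exponent \<phi> (s n) (k n) \<xi>) * f n \<xi>)"
      by (intro continuous_intros cont) simp
    then have [measurable]: "(\<lambda>\<xi>. exp (centred_exponent \<phi> (s n) (k n) \<xi>) * f n \<xi>) \<in> borel_measurable borel"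
      by (rule borel_measurable_continuous_onI)
    have "(2 * of_real pi) ^ ?d * a n (k n) = (LINT \<xi>|torus_measure. exp (centred_exponent \<phi> (s n) (k n) \<xi>) * f n \<xi>)"
      unfolding fourier_coefficient[OF a F, of n "k n", symmetric] exp_centred_exponent by (simp add: mult_ac)
    also have "\<dots> = integral\<^sup>L lborel ?g" by (rule integral_torus_measure)
    also have "\<dots> = (\<Prod>j\<in>UNIV. (\<chi> j. 1 / (s n * \<sigma> $ j)) $ j) *\<^sub>R (LINT u|lborel. ?g (0 + (\<chi> j. (\<chi> j. 1 / (s n * \<sigma> $ j)) $ j * u $ j)))"
      by (rule integral_diag_scale) (use sn \<sigma> in auto)
    also have "(\<lambda>u. 0 + (\<chi> j. (\<chi> j. 1 / (s n * \<sigma> $ j)) $ j * u $ j)) = \<theta> n"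
      by (auto simp: vec_eq_iff \<theta>j)
    also have "(\<Prod>j\<in>UNIV. (\<chi> j. 1 / (s n * \<sigma> $ j)) $ j) = inverse (s n ^ ?d * P)"
      by (simp add: P_def prod.distrib divide_inverse power_inverse prod_inversef[symmetric] o_def)
    finally have *: "(2 * of_real pi) ^ ?d * a n (k n) = inverse (s n ^ ?d * P) *\<^sub>R (LINT u|lborel. ?g (\<theta> n u))" .
    have "(LINT u|lborel. I n u) = (LINT u|lborel. of_real (s n ^ (r + 1)) * ?g (\<theta> n u))"
      unfolding I_def by (rule arg_cong[of _ _ "integral\<^sup>L lborel"]) (auto simp: mult_ac)
    also have "\<dots> = of_real (s n ^ (r + 1)) * (LINT u|lborel. ?g (\<theta> n u))"
      by (rule integral_mult_right_zero)
    also have "(LINT u|lborel. ?g (\<theta> n u)) = of_real (s n ^ ?d * P) * ((2 * of_real pi) ^ ?d * a n (k n))"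
    proof -
      have "s n ^ ?d * P * inverse (s n ^ ?d * P) = 1" using sn[of n] P by (intro right_inverse) simp
      then have "of_real (s n ^ ?d * P) * of_real (inverse (s n ^ ?d * P)) = (1 :: complex)"
        unfolding of_real_mult[symmetric] by (simp only: of_real_1)
      then show ?thesis
        unfolding * scaleR_conv_of_real mult.assoc[symmetric] by simp
    qed
    finally show ?thesis
      by (simp add: power_add field_simps)
  qed
  define G where "G = (\<lambda>u. i_poly (r + 1) \<beta> (v u) * of_real (exp (- (norm u)\<^sup>2 / 2)) * exp (- \<i> * of_real (\<Sum>j\<in>UNIV. u $ j * x $ j)))"
  have pointwise: "(\<lambda>n. I n u) \<longlonglongrightarrow> G u" for u
  proof -
    \<comment> \<open>Then \<theta> n u has norm at most 1 < pi, so for fixed u the cut-off to the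
      torus eventually disappears.\<close>
    have "\<forall>\<^sub>F n in sequentially. norm (v u) \<le> s n"
      using s(2) by (auto simp: filterlim_at_top)
    then have ev: "\<forall>\<^sub>F n in sequentially. \<theta> n u \<in> torus"
    proof eventually_elim
      case (elim n)
      have "norm (\<theta> n u) \<le> 1" using elim sn[of n] by (simp add: norm_\<theta>)
      then have "\<bar>\<theta> n u $ j\<bar> \<le> pi" for j
        using component_le_norm_cart[of "\<theta> n u" j] pi_gt3 by linarith
      then show ?case by (simp add: torus_def)
    qed
    have "(\<lambda>n. centred_exponent \<phi> (s n) (k n) (\<theta> n u)) \<longlonglongrightarrow> (\<Sum>j\<in>UNIV. - of_real ((u $ j)\<^sup>2 / 2) - \<i> * of_real (u $ j * x $ j))"
      unfolding centred_exponent_def \<theta>j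
      by (intro tendsto_sum centred_exponent_term_tendsto[OF ref s k])
    then have ex: "(\<lambda>n. exp (centred_exponent \<phi> (s n) (k n) (\<theta> n u)))
       \<longlonglongrightarrow> of_real (exp (- (norm u)\<^sup>2 / 2)) * exp (- \<i> * of_real (\<Sum>j\<in>UNIV. u $ j * x $ j))"
    proof (rule tendsto_eq_rhs[OF tendsto_exp])
      show "exp (\<Sum>j\<in>UNIV. - of_real ((u $ j)\<^sup>2 / 2) - \<i> * of_real (u $ j * x $ j))
        = of_real (exp (- (norm u)\<^sup>2 / 2)) * exp (- \<i> * of_real (\<Sum>j\<in>UNIV. u $ j * x $ j))"
      proof -
        have "(\<Sum>j\<in>UNIV. - of_real ((u $ j)\<^sup>2 / 2) - \<i> * of_real (u $ j * x $ j))
          = complex_of_real (- (norm u)\<^sup>2 / 2) + - \<i> * of_real (\<Sum>j\<in>UNIV. u $ j * x $ j)"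
          by (simp add: norm_cart_power2 sum_subtractf sum_negf sum_distrib_left sum_divide_distrib)
        then show ?thesis by (simp only: exp_add exp_of_real)
      qed
    qed
    have poly: "(\<lambda>n. i_poly (r + 1) (\<beta>\<^sub>n n) (v u)) \<longlonglongrightarrow> i_poly (r + 1) \<beta> (v u)"
      unfolding i_poly_def by (intro tendsto_intros \<beta>) simp
    \<comment> \<open>By homogeneity s^(r + 1) times the leading polynomial at \<theta> is its value
      at v u. The error is at most s^(r + 1) C |\<theta>|^(r + 2), which is of order 1 / s.\<close>
    have "(\<lambda>n. of_real (s n ^ (r + 1)) * f n (\<theta> n u) - i_poly (r + 1) (\<beta>\<^sub>n n) (v u)) \<longlonglongrightarrow> 0"
    proof (rule Lim_null_comparison)
      have "(\<lambda>n. C * norm (v u) ^ (r + 2) * inverse (s n)) \<longlonglongrightarrow> C * norm (v u) ^ (r + 2) * 0"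
        by (intro tendsto_intros inv)
      then show "(\<lambda>n. C * norm (v u) ^ (r + 2) * inverse (s n)) \<longlonglongrightarrow> 0" by simp
      show "\<forall>\<^sub>F n in sequentially. norm (of_real (s n ^ (r + 1)) * f n (\<theta> n u) - i_poly (r + 1) (\<beta>\<^sub>n n) (v u))
         \<le> C * norm (v u) ^ (r + 2) * inverse (s n)"
        using ev
      proof eventually_elim
        case (elim n)
        have "v u = s n *\<^sub>R \<theta> n u" using sn[of n] by (simp add: \<theta>_def)
        then have "i_poly (r + 1) (\<beta>\<^sub>n n) (v u) = of_real (s n ^ (r + 1)) * i_poly (r + 1) (\<beta>\<^sub>n n) (\<theta> n u)"
          using i_poly_scaleR[of "r + 1" "\<beta>\<^sub>n n" "s n" "\<theta> n u"] by simp
        then have "norm (of_real (s n ^ (r + 1)) * f n (\<theta> n u) - i_poly (r + 1) (\<beta>\<^sub>n n) (v u))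
          = s n ^ (r + 1) * norm (f n (\<theta> n u) - i_poly (r + 1) (\<beta>\<^sub>n n) (\<theta> n u))"
          using sn[of n] by (simp only: norm_mult norm_of_real flip: right_diff_distrib) simp
        also have "\<dots> \<le> s n ^ (r + 1) * (C * norm (\<theta> n u) ^ (r + 2))"
          using sn[of n] by (intro mult_left_mono f2[OF elim]) simp
        also have "\<dots> = C * norm (v u) ^ (r + 2) * inverse (s n)"
          using sn[of n] by (simp add: norm_\<theta> power_divide field_simps)
        finally show ?case .
      qed
    qed
    from tendsto_add[OF this poly] have fl: "(\<lambda>n. of_real (s n ^ (r + 1)) * f n (\<theta> n u)) \<longlonglongrightarrow> i_poly (r + 1) \<beta> (v u)"
      by simp
    have "(\<lambda>n. of_real (s n ^ (r + 1)) * f n (\<theta> n u) * exp (centred_exponent \<phi> (s n) (k n) (\<theta> n u))) \<longlonglongrightarrow> G u"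
      unfolding G_def mult.assoc[of "i_poly _ _ _"] by (intro tendsto_mult[OF fl ex])
    moreover have "\<forall>\<^sub>F n in sequentially. of_real (s n ^ (r + 1)) * f n (\<theta> n u) * exp (centred_exponent \<phi> (s n) (k n) (\<theta> n u)) = I n u"
      using ev by eventually_elim (simp add: I_def)
    ultimately show ?thesis by (rule Lim_transform_eventually)
  qed
  \<comment> \<open>Because |v u| = s |\<theta> n u|, evaluating the majorant at v u cancels every
    power of s.\<close>
  let ?w = "\<lambda>y :: real ^ 'd. C * ((1 + norm y) ^ (r + 1) * exp (- c * (norm y)\<^sup>2))"
  have dom: "norm (I n u) \<le> ?w (v u)" for n u
  proof (cases "\<theta> n u \<in> torus")
    case True
    have "norm (I n u) = s n ^ (r + 1) * norm (f n (\<theta> n u)) * exp ((s n)\<^sup>2 * (\<Sum>i\<in>UNIV. Re (\<phi> i (\<theta> n u $ i))))"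
      using True sn[of n] by (simp add: I_def norm_mult norm_exp_centred_exponent norm_power del: norm_exp_eq_Re)
    also have "\<dots> \<le> s n ^ (r + 1) * (C * norm (\<theta> n u) ^ (r + 1)) * exp ((s n)\<^sup>2 * (- c * (norm (\<theta> n u))\<^sup>2))"
    proof (intro mult_mono mult_left_mono f1[OF True])
      have "(s n)\<^sup>2 * (\<Sum>i\<in>UNIV. Re (\<phi> i (\<theta> n u $ i))) \<le> (s n)\<^sup>2 * (- c * (norm (\<theta> n u))\<^sup>2)"
        by (intro mult_left_mono Re[OF True]) simp
      then show "exp ((s n)\<^sup>2 * (\<Sum>i\<in>UNIV. Re (\<phi> i (\<theta> n u $ i)))) \<le> exp ((s n)\<^sup>2 * (- c * (norm (\<theta> n u))\<^sup>2))"
        by (simp only: exp_le_cancel_iff)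
    qed (use sn[of n] C in auto)
    also have "\<dots> = C * (norm (v u) ^ (r + 1) * exp (- c * (norm (v u))\<^sup>2))"
      using sn[of n] by (simp add: norm_\<theta> power_divide)
    also have "\<dots> \<le> ?w (v u)"
      using C by (intro mult_left_mono mult_right_mono power_mono) auto
    finally show ?thesis .
  next
    case False
    then show ?thesis using C by (simp add: I_def)
  qed
  have int_w: "integrable lborel (\<lambda>u. ?w (v u))"
  proof -
    have "integrable lborel ?w" by (intro integrable_mult_right integrable_gaussian_moment_cart c)
    then show ?thesis
      using integrable_diag_scale[of "\<chi> j. inverse (\<sigma> $ j)" ?w 0] \<sigma> by (simp add: v_def)
  qed
  have cont_v: "continuous_on UNIV v" unfolding v_def by (intro continuous_intros)
  then have [measurable]: "v \<in> borel_measurable borel" by (rule borel_measurable_continuous_onI)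
  have [measurable]: "I n \<in> borel_measurable lborel" for n
  proof -
    have "class_C 0 (centred_exponent \<phi> (s n) (k n))"
      by (intro class_C_centred_exponent class_C_mono[OF reference_exponent_smooth[OF ref]]) simp
    then have "continuous_on UNIV (\<lambda>\<xi>. of_real (s n ^ (r + 1)) * f n \<xi> * exp (centred_exponent \<phi> (s n) (k n) \<xi>))"
      by (intro continuous_intros cont) simp
    then have [measurable]: "(\<lambda>\<xi>. of_real (s n ^ (r + 1)) * f n \<xi> * exp (centred_exponent \<phi> (s n) (k n) \<xi>)) \<in> borel_measurable borel"
      by (rule borel_measurable_continuous_onI)
    have "(\<lambda>\<xi>. indicator torus \<xi> *\<^sub>R (of_real (s n ^ (r + 1)) * f n \<xi> * exp (centred_exponent \<phi> (s n) (k n) \<xi>))) \<in> borel_measurable borel"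
      by measurable
    from measurable_compose[OF _ this, of "\<theta> n" lborel] show ?thesis
      unfolding I_def \<theta>_def by measurable
  qed
  have "continuous_on UNIV (\<lambda>u. i_poly (r + 1) \<beta> (v u))"
    by (rule continuous_on_compose2[OF class_C_continuous[OF class_C_i_poly] cont_v]) simp
  then have "continuous_on UNIV G"
    unfolding G_def by (intro continuous_intros) auto
  then have [measurable]: "G \<in> borel_measurable lborel"
    by (simp add: borel_measurable_continuous_onI)
  have lim: "(\<lambda>n. LINT u|lborel. I n u) \<longlonglongrightarrow> (LINT u|lborel. G u)"
    by (rule integral_dominated_convergence[OF _ _ int_w]) (measurable, intro AE_I2 pointwise, intro AE_I2 dom)
  have G: "(LINT u|lborel. G u) = of_real (sqrt (2 * pi) ^ ?d * exp (- (norm x)\<^sup>2 / 2)) *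
      (\<Sum>\<alpha> | mi_abs \<alpha> = r + 1. \<beta> \<alpha> * of_real (mi_hermite \<alpha> x / mi_power \<sigma> \<alpha>))"
  proof -
    let ?e = "\<lambda>\<alpha> u. i_monom u \<alpha> * of_real (exp (- (norm u)\<^sup>2 / 2)) * exp (- \<i> * of_real (\<Sum>j\<in>UNIV. u $ j * x $ j))"
    have mv: "i_monom (v u) \<alpha> = of_real (1 / mi_power \<sigma> \<alpha>) * i_monom u \<alpha>" for u \<alpha>
      unfolding v_def i_monom_diag by (simp add: mi_power_def power_inverse divide_inverse prod_inversef[symmetric] o_def)
    have "G u = (\<Sum>\<alpha> | mi_abs \<alpha> = r + 1. \<beta> \<alpha> * of_real (1 / mi_power \<sigma> \<alpha>) * ?e \<alpha> u)" for u
      unfolding G_def i_poly_def sum_distrib_right by (intro sum.cong refl) (simp only: mv mult_ac)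
    then have "(LINT u|lborel. G u) = (\<Sum>\<alpha> | mi_abs \<alpha> = r + 1. LINT u|lborel. \<beta> \<alpha> * of_real (1 / mi_power \<sigma> \<alpha>) * ?e \<alpha> u)"
      by (simp only:) (intro Bochner_Integration.integral_sum integrable_mult_right integrable_gaussian_i_monom)
    also have "\<dots> = (\<Sum>\<alpha> | mi_abs \<alpha> = r + 1. \<beta> \<alpha> * of_real (1 / mi_power \<sigma> \<alpha>) *
       of_real (sqrt (2 * pi) ^ ?d * mi_hermite \<alpha> x * exp (- (norm x)\<^sup>2 / 2)))"
      by (simp only: integral_mult_right_zero integral_gaussian_mi_hermite)
    finally show ?thesis by (simp add: sum_distrib_left mult_ac)
  qed
  have powr: "(2 * pi) powr (?d / 2) = sqrt (2 * pi) ^ ?d"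
    by (simp add: powr_half_sqrt[symmetric] powr_power)
  have sq: "(2 * pi) ^ ?d = sqrt (2 * pi) ^ ?d * sqrt (2 * pi) ^ ?d"
    unfolding power_mult_distrib[symmetric] real_sqrt_mult_self by simp
  \<comment> \<open>The factor (2 pi)^(-d) of the inversion formula meets (2 pi)^(d / 2) from the
    Gaussian integral.\<close>
  have "sqrt (2 * pi) ^ ?d \<noteq> 0" by simp
  then have const: "inverse ((2 * pi) ^ ?d) * (sqrt (2 * pi) ^ ?d * exp (- (norm x)\<^sup>2 / 2)) = exp (- (norm x)\<^sup>2 / 2) / (2 * pi) powr (?d / 2)"
    unfolding powr sq by (simp only: inverse_mult_distrib divide_inverse mult.assoc) simp
  have "(\<lambda>n. of_real (s n ^ (?d + (r + 1)) * P) * a n (k n)) \<longlonglongrightarrow> of_real (inverse ((2 * pi) ^ ?d)) * (LINT u|lborel. G u)"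
    unfolding step1 by (intro tendsto_intros lim)
  then show ?thesis
    unfolding G mult.assoc[symmetric] of_real_mult[symmetric] const[unfolded mult.assoc[symmetric]] k_def P_def .
qed

section \<open>Convergence in \<open>L\<^sup>1\<close>\<close>

text \<open>On each cell the weight is at most a constant that depends only on the lattice point, so
  the integral reduces to a lattice sum. Expanding that constant leaves just the second moments of
  order l = 0 and l = K.\<close>

lemma weighted_moment_bound:
  fixes a :: "int ^ 'd \<Rightarrow> complex" and \<sigma> :: "real ^ 'd" and m :: "'d \<Rightarrow> real"
  assumes s: "s \<ge> 1" and \<sigma>: "\<And>j. \<sigma> $ j > 0" and D: "D \<ge> 0"
    and M: "\<And>S j l. finite S \<Longrightarrow> l = 0 \<or> l = K \<Longrightarrow>
      (\<Sum>k\<in>S. \<bar>of_int (k $ j - \<lfloor>s\<^sup>2 * m j\<rfloor>)\<bar> ^ (2 * l) * (norm (a k))\<^sup>2) \<le> D * s ^ (2 * l) / s ^ (2 * q + CARD('d))"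
  shows "(\<integral>\<^sup>+x. ennreal ((1 + (\<Sum>j\<in>UNIV. \<bar>x $ j\<bar> ^ (2 * K))) *
      (norm (of_real (s ^ (CARD('d) + q) * (\<Prod>j\<in>UNIV. \<sigma> $ j)) *
        a (lattice_point m \<sigma> s x)))\<^sup>2) \<partial>lborel)
    \<le> ennreal ((\<Prod>j\<in>UNIV. \<sigma> $ j) * D * (1 + 2 * (\<Sum>j\<in>UNIV. (2 / \<sigma> $ j) ^ (2 * K))))"
proof -
  let ?d = "CARD('d)"
  define P where "P = (\<Prod>j\<in>UNIV. \<sigma> $ j)"
  have P: "P > 0" unfolding P_def by (intro prod_pos) (use \<sigma> in auto)
  define k where "k = (\<lambda>x :: real ^ 'd. lattice_point m \<sigma> s x)"
  \<comment> \<open>Rounding costs at most 1, so |s \<sigma>_j x_j| \<le> p + 1 \<le> 2 max(p, 1)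
    with p the distance in lattice units. The factor s^(-2 K) in \<open>t\<close> will cancel the
    s^(2 K) of the moment of order K.\<close>
  define t where "t = (\<lambda>j. (2 / (s * \<sigma> $ j)) ^ (2 * K))"
  have t0: "t j \<ge> 0" for j unfolding t_def using s \<sigma>[of j] by simp
  define w where "w = (\<lambda>k :: int ^ 'd. 1 + (\<Sum>j\<in>UNIV. t j * (\<bar>of_int (k $ j - \<lfloor>s\<^sup>2 * m j\<rfloor>)\<bar> ^ (2 * K) + 1)))"
  have w0: "w k \<ge> 0" for k unfolding w_def using t0 by (intro add_nonneg_nonneg sum_nonneg mult_nonneg_nonneg) auto
  have Ww: "1 + (\<Sum>j\<in>UNIV. \<bar>x $ j\<bar> ^ (2 * K)) \<le> w (k x)" for x
    unfolding w_def
  proof (intro add_left_mono sum_mono)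
    fix j
    define p where "p = \<bar>of_int (k x $ j - \<lfloor>s\<^sup>2 * m j\<rfloor>) :: real\<bar>"
    have "\<bar>s * \<sigma> $ j * x $ j\<bar> \<le> p + 1"
      unfolding p_def k_def floor_vec_def by (simp, linarith)
    also have "\<dots> \<le> 2 * max p 1" by simp
    finally have "\<bar>s * \<sigma> $ j * x $ j\<bar> \<le> 2 * max p 1" .
    then have "\<bar>x $ j\<bar> \<le> 2 / (s * \<sigma> $ j) * max p 1"
      using s \<sigma>[of j] by (simp add: abs_mult field_simps)
    then have "\<bar>x $ j\<bar> ^ (2 * K) \<le> (2 / (s * \<sigma> $ j) * max p 1) ^ (2 * K)"
      by (intro power_mono) auto
    also have "\<dots> = t j * (max p 1) ^ (2 * K)" unfolding t_def by (rule power_mult_distrib)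
    also have "\<dots> \<le> t j * (p ^ (2 * K) + 1)"
      using t0 by (intro mult_left_mono) (auto simp: max_def p_def)
    finally show "\<bar>x $ j\<bar> ^ (2 * K) \<le> t j * (\<bar>of_int (k x $ j - \<lfloor>s\<^sup>2 * m j\<rfloor>)\<bar> ^ (2 * K) + 1)"
      unfolding p_def .
  qed
  define g where "g = (\<lambda>k. w k * (norm (a k))\<^sup>2)"
  have g0: "g k \<ge> 0" for k unfolding g_def using w0 by simp
  define Q where "Q = D / s ^ (2 * q + ?d)"
  have Q0: "Q \<ge> 0" using D s by (simp add: Q_def)
  define R where "R = Q * (1 + 2 * (\<Sum>j\<in>UNIV. (2 / \<sigma> $ j) ^ (2 * K)))"
  have sum_g: "(\<Sum>k\<in>S. g k) \<le> R" if "finite S" for S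
  proof -
    have m0: "(\<Sum>k\<in>S. (norm (a k))\<^sup>2) \<le> Q"
      using M[OF that, of 0] by (simp add: Q_def)
    have mK: "(\<Sum>k\<in>S. \<bar>of_int (k $ j - \<lfloor>s\<^sup>2 * m j\<rfloor>)\<bar> ^ (2 * K) * (norm (a k))\<^sup>2) \<le> s ^ (2 * K) * Q" for j
      using M[OF that, of K j] by (simp add: Q_def mult.commute)
    have tj: "t j * (s ^ (2 * K) * Q + Q) \<le> 2 * (2 / \<sigma> $ j) ^ (2 * K) * Q" for j
    proof -
      have s1: "s ^ (2 * K) \<ge> 1" using s by simp
      have "Q \<le> s ^ (2 * K) * Q" using mult_right_mono[OF s1 Q0] by simp
      then have "s ^ (2 * K) * Q + Q \<le> 2 * (s ^ (2 * K) * Q)" by linarith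
      then have "t j * (s ^ (2 * K) * Q + Q) \<le> t j * (2 * (s ^ (2 * K) * Q))"
        by (rule mult_left_mono[OF _ t0])
      also have "\<dots> = 2 * (t j * s ^ (2 * K)) * Q" by simp
      also have "t j * s ^ (2 * K) = (2 / \<sigma> $ j) ^ (2 * K)"
      proof -
        have "2 / (s * \<sigma> $ j) * s = 2 / \<sigma> $ j" using s by simp
        then show ?thesis unfolding t_def power_mult_distrib[symmetric] by (simp only:)
      qed
      finally show ?thesis .
    qed
    have gk: "g k = (norm (a k))\<^sup>2 + (\<Sum>j\<in>UNIV. t j * (\<bar>of_int (k $ j - \<lfloor>s\<^sup>2 * m j\<rfloor>)\<bar> ^ (2 * K) * (norm (a k))\<^sup>2 + (norm (a k))\<^sup>2))" for k
      unfolding g_def w_def by (simp only: distrib_right sum_distrib_right mult.assoc mult_1_left)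
    have "(\<Sum>k\<in>S. g k) = (\<Sum>k\<in>S. (norm (a k))\<^sup>2) +
       (\<Sum>k\<in>S. \<Sum>j\<in>UNIV. t j * (\<bar>of_int (k $ j - \<lfloor>s\<^sup>2 * m j\<rfloor>)\<bar> ^ (2 * K) * (norm (a k))\<^sup>2 + (norm (a k))\<^sup>2))"
      by (simp only: gk sum.distrib)
    also have "(\<Sum>k\<in>S. \<Sum>j\<in>UNIV. t j * (\<bar>of_int (k $ j - \<lfloor>s\<^sup>2 * m j\<rfloor>)\<bar> ^ (2 * K) * (norm (a k))\<^sup>2 + (norm (a k))\<^sup>2))
      = (\<Sum>j\<in>UNIV. t j * ((\<Sum>k\<in>S. \<bar>of_int (k $ j - \<lfloor>s\<^sup>2 * m j\<rfloor>)\<bar> ^ (2 * K) * (norm (a k))\<^sup>2) + (\<Sum>k\<in>S. (norm (a k))\<^sup>2)))"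
      by (subst sum.swap) (simp only: sum_distrib_left[symmetric] sum.distrib)
    also have "\<dots> \<le> (\<Sum>j\<in>UNIV. t j * (s ^ (2 * K) * Q + Q))"
      using t0 by (intro sum_mono mult_left_mono add_mono mK m0) auto
    also have "\<dots> \<le> (\<Sum>j\<in>UNIV. 2 * (2 / \<sigma> $ j) ^ (2 * K) * Q)"
      by (intro sum_mono tj)
    finally have "(\<Sum>k\<in>S. g k) \<le> (\<Sum>k\<in>S. (norm (a k))\<^sup>2) + (\<Sum>j\<in>UNIV. 2 * (2 / \<sigma> $ j) ^ (2 * K) * Q)"
      by simp
    also have "\<dots> \<le> Q + (\<Sum>j\<in>UNIV. 2 * (2 / \<sigma> $ j) ^ (2 * K) * Q)"
      by (intro add_right_mono m0)
    also have "\<dots> = R"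
      unfolding R_def by (simp add: distrib_left sum_distrib_left sum_distrib_right mult_ac)
    finally show ?thesis .
  qed
  have g_sum: "g summable_on UNIV"
    using g0 sum_g by (intro nonneg_bdd_above_summable_on) (auto simp: bdd_above_def)
  have g_le: "(\<Sum>\<^sub>\<infinity>k. g k) \<le> R"
    using sum_g by (intro infsum_le_finite_sums g_sum) auto
  define c where "c = (\<chi> j. s * \<sigma> $ j)"
  have c: "c $ j > 0" for j using s \<sigma>[of j] by (simp add: c_def)
  have Pc: "(\<Prod>j\<in>UNIV. c $ j) = s ^ ?d * P"
    by (simp add: c_def P_def prod.distrib)
  have gn: "(\<lambda>k. norm (g k)) summable_on UNIV" using g_sum g0 by simp
  have int_g: "integrable lborel (\<lambda>x. g (k x))"
    using integrable_floor_vec[OF c gn, of "\<chi> j. s\<^sup>2 * m j"] by (simp add: k_def c_def)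
  have ig: "s ^ ?d * P * (LINT x|lborel. g (k x)) = (\<Sum>\<^sub>\<infinity>k. g k)"
    using integral_floor_vec[OF c gn, of "\<chi> j. s\<^sup>2 * m j"] unfolding Pc by (simp add: k_def c_def)
  have "(\<integral>\<^sup>+x. ennreal ((1 + (\<Sum>j\<in>UNIV. \<bar>x $ j\<bar> ^ (2 * K))) * (norm (of_real (s ^ (?d + q) * P) * a (k x)))\<^sup>2) \<partial>lborel)
     \<le> (\<integral>\<^sup>+x. ennreal ((s ^ (?d + q) * P)\<^sup>2 * g (k x)) \<partial>lborel)"
  proof (intro nn_integral_mono ennreal_leI)
    fix x
    have "(1 + (\<Sum>j\<in>UNIV. \<bar>x $ j\<bar> ^ (2 * K))) * (norm (of_real (s ^ (?d + q) * P) * a (k x)))\<^sup>2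
       \<le> w (k x) * (norm (of_real (s ^ (?d + q) * P) * a (k x)))\<^sup>2"
      by (intro mult_right_mono Ww) simp
    also have "\<dots> = (s ^ (?d + q) * P)\<^sup>2 * g (k x)"
      by (simp only: g_def norm_mult norm_of_real power_mult_distrib power2_abs) (simp add: mult_ac)
    finally show "(1 + (\<Sum>j\<in>UNIV. \<bar>x $ j\<bar> ^ (2 * K))) * (norm (of_real (s ^ (?d + q) * P) * a (k x)))\<^sup>2 \<le> \<dots>" .
  qed
  also have "\<dots> = ennreal (LINT x|lborel. (s ^ (?d + q) * P)\<^sup>2 * g (k x))"
    using g0 by (intro nn_integral_eq_integral integrable_mult_right int_g) auto
  also have "(LINT x|lborel. (s ^ (?d + q) * P)\<^sup>2 * g (k x)) = (s ^ (?d + q) * P)\<^sup>2 * ((\<Sum>\<^sub>\<infinity>k. g k) / (s ^ ?d * P))"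
    unfolding ig[symmetric] using s P by simp
  also have "ennreal \<dots> \<le> ennreal ((s ^ (?d + q) * P)\<^sup>2 * (R / (s ^ ?d * P)))"
    using s P g_le by (intro ennreal_leI mult_left_mono divide_right_mono) auto
  \<comment> \<open>All powers of s cancel: 2 (d + q) from the normalization, - d from the cell
    volume and - (2 q + d) from the moment bound.\<close>
  also have "(s ^ (?d + q) * P)\<^sup>2 * (R / (s ^ ?d * P)) = P * D * (1 + 2 * (\<Sum>j\<in>UNIV. (2 / \<sigma> $ j) ^ (2 * K)))"
  proof -
    have "(s ^ (?d + q) * P)\<^sup>2 = (s ^ ?d * P) * (P * s ^ (2 * q + ?d))"
      by (simp only: power2_eq_square mult_2 power_add) (simp only: mult_ac)
    then show ?thesis unfolding R_def Q_def using s P by simp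
  qed
  finally show ?thesis unfolding P_def k_def .
qed

text \<open>The analytic core, detached from probability: the coefficients only need to be
  absolutely summable. Having s \<ge> 1 for every n keeps the comparisons of powers of s free of
  case distinctions.\<close>

lemma tendsto_l1_norm:
  fixes \<phi> :: "'d::finite \<Rightarrow> real \<Rightarrow> complex" and m :: "'d \<Rightarrow> real" and \<sigma> :: "real ^ 'd"
    and a :: "nat \<Rightarrow> int ^ 'd \<Rightarrow> complex" and f :: "nat \<Rightarrow> real ^ 'd \<Rightarrow> complex"
  assumes ref: "\<And>j. reference_exponent K (\<phi> j) (m j) (\<sigma> $ j)"
    and K: "2 * K > CARD('d)" "K \<ge> 2" "K \<le> r + 1"
    and s: "\<And>n. s n \<ge> 1" "filterlim s at_top sequentially"
    and a: "\<And>n. (\<lambda>k. norm (a n k)) summable_on UNIV"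
    and F: "\<And>n \<xi>. exp (of_real ((s n)\<^sup>2) * (\<Sum>i\<in>UNIV. \<phi> i (\<xi> $ i))) * f n \<xi> = (\<Sum>\<^sub>\<infinity>k. a n k * lattice_char k \<xi>)"
    and f: "\<And>n. class_C K (f n)" and C: "C \<ge> 0"
    and f1: "\<And>n j l \<xi>. l \<le> K \<Longrightarrow> \<xi> \<in> torus \<Longrightarrow> norm ((partial j ^^ l) (f n) \<xi>) \<le> C * norm \<xi> ^ (r + 1 - l)"
    and f2: "\<And>n \<xi>. \<xi> \<in> torus \<Longrightarrow> norm (f n \<xi> - i_poly (r + 1) (\<beta>\<^sub>n n) \<xi>) \<le> C * norm \<xi> ^ (r + 2)"
    and \<beta>: "\<And>\<alpha>. mi_abs \<alpha> = r + 1 \<Longrightarrow> (\<lambda>n. \<beta>\<^sub>n n \<alpha>) \<longlonglongrightarrow> \<beta> \<alpha>"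
  shows "(\<lambda>n. s n ^ (r + 1) * (\<Sum>\<^sub>\<infinity>k. norm (a n k))) \<longlonglongrightarrow>
    1 / (2 * pi) powr (CARD('d) / 2) * (LINT x|lborel. exp (- (norm x)\<^sup>2 / 2) *
      norm (\<Sum>\<alpha> | mi_abs \<alpha> = r + 1. \<beta> \<alpha> * of_real (mi_hermite \<alpha> x / mi_power \<sigma> \<alpha>)))"
proof -
  let ?d = "CARD('d)"
  have \<sigma>: "\<sigma> $ j > 0" for j using ref[of j] by (simp add: reference_exponent_def)
  have sn: "s n > 0" for n using s(1)[of n] by simp
  define P where "P = (\<Prod>j\<in>UNIV. \<sigma> $ j)"
  have P: "P > 0" unfolding P_def by (intro prod_pos) (use \<sigma> in auto)
  obtain c where c: "c > 0" and Re: "\<And>\<xi> :: real ^ 'd. \<xi> \<in> torus \<Longrightarrow> (\<Sum>i\<in>UNIV. Re (\<phi> i (\<xi> $ i))) \<le> - c * (norm \<xi>)\<^sup>2"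
    using reference_exponents_Re_le[OF ref] by blast
  have "\<forall>j. \<exists>B\<ge>0. \<forall>n \<xi> l. \<xi> \<in> torus \<longrightarrow> l \<le> K \<longrightarrow>
      norm ((partial j ^^ l) (\<lambda>\<xi>. exp (centred_exponent \<phi> (s n) (\<chi> j. \<lfloor>(s n)\<^sup>2 * m j\<rfloor>) \<xi>) * f n \<xi>) \<xi>)
       \<le> B * (s n ^ l / s n ^ (r + 1)) * (1 + s n * norm \<xi>) ^ (r + 1 + K) * exp (- c * (s n * norm \<xi>)\<^sup>2)"
  proof
    fix j
    obtain B where B: "B \<ge> 0" "\<And>s b f \<xi> l. s \<ge> 1 \<Longrightarrow> class_C K f \<Longrightarrow>
      (\<And>l \<xi>. l \<le> K \<Longrightarrow> \<xi> \<in> torus \<Longrightarrow> norm ((partial j ^^ l) f \<xi>) \<le> C * norm \<xi> ^ (r + 1 - l)) \<Longrightarrow>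
      \<bar>s\<^sup>2 * m j - of_int (b $ j)\<bar> \<le> 1 \<Longrightarrow> \<xi> \<in> torus \<Longrightarrow> l \<le> K \<Longrightarrow>
      norm ((partial j ^^ l) (\<lambda>\<xi>. exp (centred_exponent \<phi> s b \<xi>) * f \<xi>) \<xi>)
       \<le> B * (s ^ l / s ^ (r + 1)) * (1 + s * norm \<xi>) ^ (r + 1 + K) * exp (- c * (s * norm \<xi>)\<^sup>2)"
      using modulated_partial_bound[OF ref K(2) C K(3) Re, of j] by blast
    have "\<bar>(s n)\<^sup>2 * m j - of_int ((\<chi> j. \<lfloor>(s n)\<^sup>2 * m j\<rfloor>) $ j)\<bar> \<le> 1" for n
      by (simp, linarith)
    then show "\<exists>B\<ge>0. \<forall>n \<xi> l. \<xi> \<in> torus \<longrightarrow> l \<le> K \<longrightarrow>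
      norm ((partial j ^^ l) (\<lambda>\<xi>. exp (centred_exponent \<phi> (s n) (\<chi> j. \<lfloor>(s n)\<^sup>2 * m j\<rfloor>) \<xi>) * f n \<xi>) \<xi>)
       \<le> B * (s n ^ l / s n ^ (r + 1)) * (1 + s n * norm \<xi>) ^ (r + 1 + K) * exp (- c * (s n * norm \<xi>)\<^sup>2)"
      using B(1) by (intro exI[of _ B] conjI allI impI B(2) s f f1)
  qed
  from choice[OF this] obtain B where B: "\<And>j. B j \<ge> 0" "\<And>j n \<xi> l. \<xi> \<in> torus \<Longrightarrow> l \<le> K \<Longrightarrow>
      norm ((partial j ^^ l) (\<lambda>\<xi>. exp (centred_exponent \<phi> (s n) (\<chi> j. \<lfloor>(s n)\<^sup>2 * m j\<rfloor>) \<xi>) * f n \<xi>) \<xi>)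
       \<le> B j * (s n ^ l / s n ^ (r + 1)) * (1 + s n * norm \<xi>) ^ (r + 1 + K) * exp (- c * (s n * norm \<xi>)\<^sup>2)"
    by blast
  define J where "J = (LINT u|lborel. (1 + norm (u :: real ^ 'd)) ^ (2 * (r + 1 + K)) * exp (- (2 * c) * (norm u)\<^sup>2))"
  have "J \<ge> 0" unfolding J_def by (intro Bochner_Integration.integral_nonneg) simp
  define B0 where "B0 = (\<Sum>j\<in>UNIV. B j)"
  have B0: "B j \<le> B0" for j unfolding B0_def using B(1) by (intro member_le_sum) auto
  define D where "D = B0\<^sup>2 * J / (2 * pi) ^ ?d"
  have D: "D \<ge> 0" unfolding D_def using \<open>J \<ge> 0\<close> by simp
  \<comment> \<open>Squaring the derivative bound gives s^(2 l) / s^(2 (r + 1)), and rescaling the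
    integral contributes the remaining s^(-d).\<close>
  have M: "(\<Sum>k\<in>S. \<bar>of_int (k $ j - \<lfloor>(s n)\<^sup>2 * m j\<rfloor>)\<bar> ^ (2 * l) * (norm (a n k))\<^sup>2)
      \<le> D * s n ^ (2 * l) / s n ^ (2 * (r + 1) + ?d)" if "finite S" "l = 0 \<or> l = K" for S j l n
  proof -
    have l: "l \<le> K" using that by auto
    have "(2 * pi) ^ ?d * (\<Sum>k\<in>S. \<bar>of_int (k $ j - (\<chi> j. \<lfloor>(s n)\<^sup>2 * m j\<rfloor>) $ j)\<bar> ^ (2 * l) * (norm (a n k))\<^sup>2)
      \<le> (B j * (s n ^ l / s n ^ (r + 1)))\<^sup>2 / s n ^ ?d * J"
      unfolding J_def
      by (rule second_moment_bound[OF a F class_C_mono[OF reference_exponent_smooth[OF ref] l] class_C_mono[OF f l] sn c B(2)[OF _ l] \<open>finite S\<close>])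
    also have "\<dots> \<le> (B0 * (s n ^ l / s n ^ (r + 1)))\<^sup>2 / s n ^ ?d * J"
      using B0[of j] B(1)[of j] sn[of n] \<open>J \<ge> 0\<close>
      by (intro mult_right_mono divide_right_mono power_mono) auto
    also have "\<dots> = (2 * pi) ^ ?d * (D * s n ^ (2 * l) / s n ^ (2 * (r + 1) + ?d))"
    proof -
      have "(B0 * (s n ^ l / s n ^ (r + 1)))\<^sup>2 = B0\<^sup>2 * s n ^ (2 * l) / s n ^ (2 * (r + 1))"
        by (simp only: power_mult_distrib power_divide power_mult[symmetric] mult.commute[of _ 2] times_divide_eq_right)
      then show ?thesis by (simp add: D_def power_add mult_ac)
    qed
    finally show ?thesis unfolding vec_lambda_beta by (rule mult_left_le_imp_le) simp
  qed
  define A where "A = (\<lambda>n x. of_real (s n ^ (?d + (r + 1)) * P) *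
      a n (lattice_point m \<sigma> (s n) x))"
  define A' where "A' = (\<lambda>x :: real ^ 'd. of_real (exp (- (norm x)\<^sup>2 / 2) / (2 * pi) powr (?d / 2)) *
        (\<Sum>\<alpha> | mi_abs \<alpha> = r + 1. \<beta> \<alpha> * of_real (mi_hermite \<alpha> x / mi_power \<sigma> \<alpha>)))"
  \<comment> \<open>At order l = 0 no direction is involved, so \<open>j\<close> is instantiated
    with \<open>undefined\<close>.\<close>
  have f0: "norm (f n \<xi>) \<le> C * norm \<xi> ^ (r + 1)" if "\<xi> \<in> torus" for n \<xi>
    using f1[where l = 0 and n = n and j = undefined, OF _ that] by (simp only: funpow.simps id_apply diff_zero le0)
  have lim: "(\<lambda>n. A n x) \<longlonglongrightarrow> A' x" for x
    unfolding A_def A'_def P_def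
    by (rule pointwise_limit[OF ref s a F class_C_continuous[OF f] f0 f2 \<beta> c Re])
  have [measurable]: "A n \<in> borel_measurable lborel" for n
  proof -
    have "(\<lambda>x. (\<chi> j. (s n)\<^sup>2 * m j) + (\<chi> j. (\<chi> j. s n * \<sigma> $ j) $ j * x $ j)) \<in> borel \<rightarrow>\<^sub>M (borel :: (real ^ 'd) measure)"
      by (intro borel_measurable_continuous_onI continuous_intros)
    from measurable_compose[OF this measurable_floor_vec]
    have "(\<lambda>x. lattice_point m \<sigma> (s n) x) \<in> (borel :: (real ^ 'd) measure) \<rightarrow>\<^sub>M count_space UNIV" .
    from measurable_compose[OF this, of "\<lambda>k. of_real (s n ^ (?d + (r + 1)) * P) * a n k" borel]
    show ?thesis unfolding A_def by simp
  qed
  have [measurable]: "A' \<in> borel_measurable lborel"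
    by (rule borel_measurable_LIMSEQ_metric[of A]) (use lim in auto)
  have main: "(\<lambda>n. LINT x|lborel. norm (A n x)) \<longlonglongrightarrow> (LINT x|lborel. norm (A' x))"
  proof (rule tendsto_integral_norm_weighted[where W = "\<lambda>x :: real ^ 'd. 1 + (\<Sum>j\<in>UNIV. \<bar>x $ j\<bar> ^ (2 * K))"])
    show "0 < 1 + (\<Sum>j\<in>UNIV. \<bar>x $ j\<bar> ^ (2 * K))" for x :: "real ^ 'd"
      by (intro add_pos_nonneg sum_nonneg) auto
    show "integrable lborel (\<lambda>x :: real ^ 'd. 1 / (1 + (\<Sum>j\<in>UNIV. \<bar>x $ j\<bar> ^ (2 * K))))"
      by (rule integrable_inverse_weight[OF K(1)])
    show "(\<integral>\<^sup>+x. ennreal ((1 + (\<Sum>j\<in>UNIV. \<bar>x $ j\<bar> ^ (2 * K))) * (norm (A n x))\<^sup>2) \<partial>lborel)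
      \<le> ennreal (P * D * (1 + 2 * (\<Sum>j\<in>UNIV. (2 / \<sigma> $ j) ^ (2 * K))))" for n
      unfolding A_def P_def by (rule weighted_moment_bound[OF s(1) \<sigma> D M])
    show "0 \<le> P * D * (1 + 2 * (\<Sum>j\<in>UNIV. (2 / \<sigma> $ j) ^ (2 * K)))"
      using P D \<sigma> by (intro mult_nonneg_nonneg add_nonneg_nonneg sum_nonneg) (auto simp: less_imp_le)
  qed (use lim in auto)
  \<comment> \<open>The function is constant on cells of volume 1 / (s^d P), so of the normalizing
    factor only s^(r + 1) remains.\<close>
  have "(LINT x|lborel. norm (A n x)) = s n ^ (r + 1) * (\<Sum>\<^sub>\<infinity>k. norm (a n k))" for n
  proof -
    have c0: "(\<chi> j. s n * \<sigma> $ j) $ j > 0" for j using sn[of n] \<sigma>[of j] by simp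
    have "(\<lambda>k. norm (norm (a n k))) summable_on UNIV" using a[of n] by simp
    from integral_floor_vec[OF c0 this, of "\<chi> j. (s n)\<^sup>2 * m j"]
    have *: "(\<Sum>\<^sub>\<infinity>k. norm (a n k)) = s n ^ ?d * P * (LINT x|lborel. norm (a n (lattice_point m \<sigma> (s n) x)))"
      by (simp add: P_def prod.distrib)
    have "norm (A n x) = s n ^ (?d + (r + 1)) * P * norm (a n (lattice_point m \<sigma> (s n) x))" for x
      unfolding A_def norm_mult norm_of_real using sn[of n] P by (simp add: abs_mult)
    then have "(LINT x|lborel. norm (A n x)) = s n ^ (?d + (r + 1)) * P *
        (LINT x|lborel. norm (a n (lattice_point m \<sigma> (s n) x)))"
      by (simp only: integral_mult_right_zero)
    then show ?thesis unfolding * by (simp add: power_add mult_ac)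
  qed
  moreover have "(LINT x|lborel. norm (A' x)) = 1 / (2 * pi) powr (?d / 2) * (LINT x|lborel. exp (- (norm x)\<^sup>2 / 2) *
      norm (\<Sum>\<alpha> | mi_abs \<alpha> = r + 1. \<beta> \<alpha> * of_real (mi_hermite \<alpha> x / mi_power \<sigma> \<alpha>)))"
  proof -
    have "norm (A' x) = 1 / (2 * pi) powr (?d / 2) * (exp (- (norm x)\<^sup>2 / 2) *
      norm (\<Sum>\<alpha> | mi_abs \<alpha> = r + 1. \<beta> \<alpha> * of_real (mi_hermite \<alpha> x / mi_power \<sigma> \<alpha>)))" for x
      unfolding A'_def norm_mult norm_of_real by simp
    then show ?thesis by (simp only: integral_mult_right_zero)
  qed
  ultimately show ?thesis using main by (simp only:)
qed

section \<open>Absolute summability of the point masses\<close>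

lemma signed_measure_summable_nonneg:
  fixes \<nu> :: "(int ^ 'd) set \<Rightarrow> real"
  assumes "signed_measure \<nu>"
  shows "(\<lambda>k. \<nu> {k}) summable_on {k. \<nu> {k} \<ge> 0}"
proof (rule nonneg_bdd_above_summable_on)
  let ?B = "{k. \<nu> {k} \<ge> 0}"
  have sums: "(\<lambda>i. \<nu> (A i)) sums \<nu> (\<Union>i. A i)" if "disjoint_family A" for A :: "nat \<Rightarrow> (int ^ 'd) set"
    using assms that unfolding signed_measure_def by blast
  \<comment> \<open>A constant series converges only if its term is 0, which yields \<nu> {} =
    0.\<close>
  have "disjoint_family (\<lambda>_ :: nat. {} :: (int ^ 'd) set)" by (simp add: disjoint_family_on_def)
  from sums_summable[OF sums[OF this]] have empty: "\<nu> {} = 0"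
    by (simp add: summable_const_iff)
  \<comment> \<open>The countable lattice is laid out as a sequence in which each \<open>A i\<close>
    is empty or a singleton of nonnegative mass. Additivity along this sequence bounds all finite
    sums.\<close>
  define A where "A = (\<lambda>i. {k \<in> ?B. to_nat k = i})"
  have "disjoint_family A" by (auto simp: disjoint_family_on_def A_def)
  from sums_summable[OF sums[OF this]] have summable: "summable (\<lambda>i. \<nu> (A i))" .
  have A_to_nat: "A (to_nat k) = {k}" if "k \<in> ?B" for k
    using that by (auto simp: A_def)
  have A_nonneg: "\<nu> (A i) \<ge> 0" for i
  proof (cases "A i = {}")
    case False
    then obtain k where "k \<in> ?B" "to_nat k = i" by (auto simp: A_def)
    then show ?thesis using A_to_nat by auto
  qed (simp add: empty)
  show "bdd_above (sum (\<lambda>k. \<nu> {k}) ` {F. F \<subseteq> ?B \<and> finite F})"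
  proof (rule bdd_aboveI2)
    fix F assume F: "F \<in> {F. F \<subseteq> ?B \<and> finite F}"
    have "(\<Sum>k\<in>F. \<nu> {k}) = (\<Sum>i\<in>to_nat ` F. \<nu> (A i))"
      using F A_to_nat by (subst sum.reindex) (auto simp: inj_on_def intro!: sum.cong)
    also have "\<dots> \<le> (\<Sum>i. \<nu> (A i))"
      using F by (intro sum_le_suminf summable A_nonneg) auto
    finally show "(\<Sum>k\<in>F. \<nu> {k}) \<le> (\<Sum>i. \<nu> (A i))" .
  qed
qed auto

text \<open>The nonnegative and the negative masses are treated separately, the latter through -
  \<nu>.\<close>

lemma signed_measure_abs_summable:
  fixes \<nu> :: "(int ^ 'd) set \<Rightarrow> real"
  assumes "signed_measure \<nu>"
  shows "(\<lambda>k. \<bar>\<nu> {k}\<bar>) summable_on UNIV"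
proof -
  have "signed_measure (\<lambda>A. - \<nu> A)"
    using assms unfolding signed_measure_def by (auto intro: sums_minus)
  from signed_measure_summable_nonneg[OF this]
  have "(\<lambda>k. - \<nu> {k}) summable_on {k. \<nu> {k} < 0}"
    by (rule summable_on_subset_banach) auto
  then have neg: "(\<lambda>k. \<bar>\<nu> {k}\<bar>) summable_on {k. \<nu> {k} < 0}"
    by (rule summable_on_cong[THEN iffD1, rotated]) auto
  have "(\<lambda>k. \<bar>\<nu> {k}\<bar>) summable_on {k. \<nu> {k} \<ge> 0}"
    by (rule summable_on_cong[THEN iffD1, OF _ signed_measure_summable_nonneg[OF assms]]) auto
  moreover have "{k. \<nu> {k} \<ge> 0} \<inter> {k. \<nu> {k} < 0} = {}" by auto
  ultimately have "(\<lambda>k. \<bar>\<nu> {k}\<bar>) summable_on {k. \<nu> {k} \<ge> 0} \<union> {k. \<nu> {k} < 0}"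
    using neg by (intro summable_on_Un_disjoint)
  also have "{k. \<nu> {k} \<ge> 0} \<union> {k. \<nu> {k} < 0} = UNIV" by auto
  finally show ?thesis .
qed

lemma measure_singleton_summable:
  fixes M :: "'k measure"
  assumes "finite_measure M" "sets M = UNIV"
  shows "(\<lambda>k. measure M {k}) summable_on UNIV"
proof (rule nonneg_bdd_above_summable_on)
  interpret finite_measure M by fact
  show "bdd_above (sum (\<lambda>k. measure M {k}) ` {F. F \<subseteq> UNIV \<and> finite F})"
  proof (rule bdd_aboveI2)
    fix F :: "'k set" assume "F \<in> {F. F \<subseteq> UNIV \<and> finite F}"
    then have "(\<Sum>k\<in>F. measure M {k}) = measure M F"
      using assms by (intro finite_measure_eq_sum_singleton[symmetric]) auto
    also have "\<dots> \<le> measure M (space M)" by (rule bounded_measure)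
    finally show "(\<Sum>k\<in>F. measure M {k}) \<le> measure M (space M)" .
  qed
qed simp

theorem theorem5p9:
  fixes \<phi> :: "'d::finite \<Rightarrow> real \<Rightarrow> complex"
    and m :: "'d \<Rightarrow> real" and \<sigma> :: "real ^ 'd"
    and lam :: "nat \<Rightarrow> real"
    and M :: "nat \<Rightarrow> 'a measure" and X :: "nat \<Rightarrow> 'a \<Rightarrow> int ^ 'd"
    and \<mu> :: "nat \<Rightarrow> (int ^ 'd) measure" and \<nu> :: "nat \<Rightarrow> (int ^ 'd) set \<Rightarrow> real"
    and \<psi>\<^sub>n chi\<^sub>n :: "nat \<Rightarrow> real ^ 'd \<Rightarrow> complex" and \<psi> chi :: "real ^ 'd \<Rightarrow> complex"
    and \<beta>\<^sub>n \<gamma>\<^sub>n :: "nat \<Rightarrow> nat ^ 'd \<Rightarrow> complex" and \<beta> \<gamma> :: "nat ^ 'd \<Rightarrow> complex"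
    and K r :: nat
  assumes d: "CARD('d) \<ge> 2"
    and K: "K = CARD('d) div 2 + 1"
    and r: "r \<ge> CARD('d) div 2"
    and ref: "\<And>j. reference_exponent K (\<phi> j) (m j) (\<sigma> $ j)"
    and prob: "\<And>n. prob_space (M n)"
    and rv: "\<And>n. X n \<in> M n \<rightarrow>\<^sub>M count_space UNIV"
    and law: "\<And>n. \<mu> n = distr (M n) (count_space UNIV) (X n)"
    and mod_phi: "mod_convergent (\<lambda>\<xi>. \<Sum>j\<in>UNIV. \<phi> j (\<xi> $ j)) lam (\<lambda>n. measure (\<mu> n)) \<psi>\<^sub>n \<psi>"
    and signed: "\<And>n. signed_measure (\<nu> n)"
    and scheme: "mod_convergent (\<lambda>\<xi>. \<Sum>j\<in>UNIV. \<phi> j (\<xi> $ j)) lam \<nu> chi\<^sub>n chi"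
    and chi_0: "\<And>n. chi\<^sub>n n 0 = 1" "chi 0 = 1"
    and smooth_n: "\<And>n. class_C K (\<psi>\<^sub>n n)" "\<And>n. class_C K (chi\<^sub>n n)"
    and smooth: "class_C K \<psi>" "class_C K chi"
    and vanish_n: "\<And>n \<delta>. mi_abs \<delta> < K \<Longrightarrow> mi_partial \<delta> (\<lambda>\<xi>. \<psi>\<^sub>n n \<xi> - chi\<^sub>n n \<xi>) 0 = 0"
    and vanish: "\<And>\<delta>. mi_abs \<delta> < K \<Longrightarrow> mi_partial \<delta> (\<lambda>\<xi>. \<psi> \<xi> - chi \<xi>) 0 = 0"
    and beta: "\<And>\<alpha>. mi_abs \<alpha> = r + 1 \<Longrightarrow> (\<lambda>n. \<beta>\<^sub>n n \<alpha>) \<longlonglongrightarrow> \<beta> \<alpha>"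
    and gamma: "\<And>\<alpha>. mi_abs \<alpha> = r + 2 \<Longrightarrow> (\<lambda>n. \<gamma>\<^sub>n n \<alpha>) \<longlonglongrightarrow> \<gamma> \<alpha>"
    and expansion_n: "deriv_expansion K r (\<lambda>n \<xi>. \<psi>\<^sub>n n \<xi> - chi\<^sub>n n \<xi>) \<beta>\<^sub>n \<gamma>\<^sub>n"
    and expansion: "deriv_expansion K r (\<lambda>_::unit. \<lambda>\<xi>. \<psi> \<xi> - chi \<xi>) (\<lambda>_. \<beta>) (\<lambda>_. \<gamma>)"
  shows "(\<lambda>n. d_TV (measure (\<mu> n)) (\<nu> n) -
             1 / ((2 * pi) powr (CARD('d) / 2) * lam n powr ((r + 1) / 2)) *
             (LINT x|lborel. exp (- (norm x)\<^sup>2 / 2) *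
                norm (\<Sum>\<alpha> | mi_abs \<alpha> = r + 1.
                        \<beta> \<alpha> * of_real (mi_hermite \<alpha> x / mi_power \<sigma> \<alpha>))))
         \<in> o(\<lambda>n. 1 / lam n powr ((r + 1) / 2))"
proof -
  let ?f = "\<lambda>n \<xi>. \<psi>\<^sub>n n \<xi> - chi\<^sub>n n \<xi>"
  let ?I = "1 / (2 * pi) powr (CARD('d) / 2) * (LINT x|lborel. exp (- (norm x)\<^sup>2 / 2) *
      norm (\<Sum>\<alpha> | mi_abs \<alpha> = r + 1. \<beta> \<alpha> * of_real (mi_hermite \<alpha> x / mi_power \<sigma> \<alpha>)))"
  have lam: "filterlim lam at_top sequentially"
    and \<mu>F: "\<And>n \<xi>. fourier (measure (\<mu> n)) \<xi> = exp (of_real (lam n) * (\<Sum>j\<in>UNIV. \<phi> j (\<xi> $ j))) * \<psi>\<^sub>n n \<xi>"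
    and \<nu>F: "\<And>n \<xi>. fourier (\<nu> n) \<xi> = exp (of_real (lam n) * (\<Sum>j\<in>UNIV. \<phi> j (\<xi> $ j))) * chi\<^sub>n n \<xi>"
    using mod_phi scheme unfolding mod_convergent_def by blast+
  \<comment> \<open>The three places where the value of K is used: K \<le> r + 1 comes from r \<ge>
    d div 2, K \<ge> 2 from d \<ge> 2, and 2 K > d from rounding d / 2 down before adding 1.\<close>
  have Kr: "K \<le> r + 1" "K \<ge> 2" "2 * K > CARD('d)" using K r d by auto
  have f: "class_C K (?f n)" for n by (intro class_C_diff smooth_n)
  have "Bseq (\<lambda>n. \<beta>\<^sub>n n \<alpha>)" if "mi_abs \<alpha> = r + 1" for \<alpha>
    using beta[OF that] by (intro convergent_imp_Bseq convergentI)
  moreover have "Bseq (\<lambda>n. \<gamma>\<^sub>n n \<alpha>)" if "mi_abs \<alpha> = r + 2" for \<alpha>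
    using gamma[OF that] by (intro convergent_imp_Bseq convergentI)
  ultimately obtain C where C: "C \<ge> 0"
    "\<And>n w \<xi>. length w \<le> K \<Longrightarrow> \<xi> \<in> torus \<Longrightarrow> norm (foldr partial w (?f n) \<xi>) \<le> C * norm \<xi> ^ (r + 1 - length w)"
    "\<And>n \<xi>. \<xi> \<in> torus \<Longrightarrow> norm (?f n \<xi> - i_poly (r + 1) (\<beta>\<^sub>n n) \<xi>) \<le> C * norm \<xi> ^ (r + 2)"
    using deriv_expansion_bounds[OF Kr(1) f vanish_n expansion_n] by blast
  define a where "a = (\<lambda>n k. of_real (measure (\<mu> n) {k} - \<nu> n {k}) :: complex)"
  have \<mu>_sum: "(\<lambda>k. measure (\<mu> n) {k}) summable_on UNIV" for n
  proof (rule measure_singleton_summable)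
    interpret prob_space "M n" by (rule prob)
    have "prob_space (\<mu> n)" unfolding law by (rule prob_space_distr[OF rv])
    then show "finite_measure (\<mu> n)" by (rule prob_space.finite_measure)
  qed (simp add: law)
  have \<nu>_sum: "(\<lambda>k. \<bar>\<nu> n {k}\<bar>) summable_on UNIV" for n
    by (rule signed_measure_abs_summable[OF signed])
  have a_sum: "(\<lambda>k. norm (a n k)) summable_on UNIV" for n
  proof (rule summable_on_comparison_test[OF summable_on_add[OF \<mu>_sum[of n] \<nu>_sum[of n]]])
    show "norm (a n k) \<le> measure (\<mu> n) {k} + \<bar>\<nu> n {k}\<bar>" for k
      unfolding a_def norm_of_real using abs_triangle_ineq4[of "measure (\<mu> n) {k}" "\<nu> n {k}"] by simp
  qed simp
  have dTV: "d_TV (measure (\<mu> n)) (\<nu> n) = (\<Sum>\<^sub>\<infinity>k. norm (a n k))" for n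
    unfolding d_TV_def a_def norm_of_real ..
  have F: "exp (of_real (lam n) * (\<Sum>j\<in>UNIV. \<phi> j (\<xi> $ j))) * ?f n \<xi> = (\<Sum>\<^sub>\<infinity>k. a n k * lattice_char k \<xi>)" for n \<xi>
  proof -
    have s1: "(\<lambda>k. of_real (measure (\<mu> n) {k}) * lattice_char k \<xi>) summable_on UNIV"
      by (rule abs_summable_summable, rule summable_norm_mult_bounded[where B = 1]) (use \<mu>_sum[of n] in simp_all)
    have s2: "(\<lambda>k. of_real (\<nu> n {k}) * lattice_char k \<xi>) summable_on UNIV"
      by (rule abs_summable_summable, rule summable_norm_mult_bounded[where B = 1]) (use \<nu>_sum[of n] in simp_all)
    have "exp (of_real (lam n) * (\<Sum>j\<in>UNIV. \<phi> j (\<xi> $ j))) * ?f n \<xi> = fourier (measure (\<mu> n)) \<xi> - fourier (\<nu> n) \<xi>"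
      unfolding \<mu>F \<nu>F by (simp add: right_diff_distrib)
    also have "\<dots> = (\<Sum>\<^sub>\<infinity>k. of_real (measure (\<mu> n) {k}) * lattice_char k \<xi> - of_real (\<nu> n {k}) * lattice_char k \<xi>)"
      unfolding fourier_def using infsum_add[OF s1 summable_on_uminus[THEN iffD2, OF s2]] by (simp add: infsum_uminus)
    finally show ?thesis by (simp add: a_def left_diff_distrib)
  qed
  \<comment> \<open>The index is shifted so that s \<ge> 1 holds from the start;
    \<open>LIMSEQ_offset\<close> removes the shift again.\<close>
  obtain N where N: "\<And>n. n \<ge> N \<Longrightarrow> lam n \<ge> 1"
    using lam unfolding filterlim_at_top eventually_sequentially by blast
  define s where "s = (\<lambda>n. sqrt (lam (n + N)))"
  have s1: "s n \<ge> 1" for n using N[of "n + N"] by (simp add: s_def)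
  have s2: "(s n)\<^sup>2 = lam (n + N)" for n using N[of "n + N"] by (simp add: s_def)
  have s_lim: "filterlim s at_top sequentially"
    unfolding s_def
    by (intro filterlim_compose[OF sqrt_at_top] filterlim_compose[OF lam] filterlim_add_const_nat_at_top)
  have "(\<lambda>n. s n ^ (r + 1) * (\<Sum>\<^sub>\<infinity>k. norm (a (n + N) k))) \<longlonglongrightarrow> ?I"
  proof (rule tendsto_l1_norm[OF ref Kr(3,2,1) s1 s_lim a_sum _ f C(1)])
    show "exp (of_real ((s n)\<^sup>2) * (\<Sum>i\<in>UNIV. \<phi> i (\<xi> $ i))) * ?f (n + N) \<xi> = (\<Sum>\<^sub>\<infinity>k. a (n + N) k * lattice_char k \<xi>)" for n \<xi>
      unfolding s2 by (rule F)
    show "norm ((partial j ^^ l) (?f (n + N)) \<xi>) \<le> C * norm \<xi> ^ (r + 1 - l)" if "l \<le> K" "\<xi> \<in> torus" for n j l \<xi>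
      using C(2)[of "replicate l j" \<xi> "n + N"] that unfolding funpow_partial_eq_foldr by simp
    show "norm (?f (n + N) \<xi> - i_poly (r + 1) (\<beta>\<^sub>n (n + N)) \<xi>) \<le> C * norm \<xi> ^ (r + 2)" if "\<xi> \<in> torus" for n \<xi>
      by (rule C(3)[OF that])
    show "(\<lambda>n. \<beta>\<^sub>n (n + N) \<alpha>) \<longlonglongrightarrow> \<beta> \<alpha>" if "mi_abs \<alpha> = r + 1" for \<alpha>
      by (rule LIMSEQ_ignore_initial_segment[OF beta[OF that]])
  qed
  then have "(\<lambda>n. sqrt (lam n) ^ (r + 1) * d_TV (measure (\<mu> n)) (\<nu> n)) \<longlonglongrightarrow> ?I"
    unfolding s_def dTV by (rule LIMSEQ_offset)
  then have lim: "(\<lambda>n. sqrt (lam n) ^ (r + 1) * d_TV (measure (\<mu> n)) (\<nu> n) - ?I) \<longlonglongrightarrow> 0"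
    by (rule LIM_zero)
  have ev: "\<forall>\<^sub>F n in sequentially. lam n > 0"
    using lam by (auto simp: filterlim_at_top_dense)
  have pw: "lam n powr ((r + 1) / 2) = sqrt (lam n) ^ (r + 1)" if "lam n > 0" for n
    using that by (simp only: powr_half_sqrt[symmetric] powr_power less_imp_le) (simp add: mult.commute)
  show ?thesis
  proof (rule smalloI_tendsto)
    show "\<forall>\<^sub>F n in sequentially. 1 / lam n powr ((r + 1) / 2) \<noteq> 0"
      using ev by eventually_elim simp
    show "(\<lambda>n. (d_TV (measure (\<mu> n)) (\<nu> n) -
             1 / ((2 * pi) powr (CARD('d) / 2) * lam n powr ((r + 1) / 2)) *
             (LINT x|lborel. exp (- (norm x)\<^sup>2 / 2) *
                norm (\<Sum>\<alpha> | mi_abs \<alpha> = r + 1. \<beta> \<alpha> * of_real (mi_hermite \<alpha> x / mi_power \<sigma> \<alpha>))))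
           / (1 / lam n powr ((r + 1) / 2))) \<longlonglongrightarrow> 0"
    proof (rule Lim_transform_eventually[OF lim])
      show "\<forall>\<^sub>F n in sequentially. sqrt (lam n) ^ (r + 1) * d_TV (measure (\<mu> n)) (\<nu> n) - ?I =
          (d_TV (measure (\<mu> n)) (\<nu> n) -
             1 / ((2 * pi) powr (CARD('d) / 2) * lam n powr ((r + 1) / 2)) *
             (LINT x|lborel. exp (- (norm x)\<^sup>2 / 2) *
                norm (\<Sum>\<alpha> | mi_abs \<alpha> = r + 1. \<beta> \<alpha> * of_real (mi_hermite \<alpha> x / mi_power \<sigma> \<alpha>))))
           / (1 / lam n powr ((r + 1) / 2))"
        using ev
      proof eventually_elim
        case (elim n)
        have "lam n powr ((r + 1) / 2) > 0" using elim by simp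
        then show ?case unfolding pw[OF elim, symmetric] by (simp add: field_simps)
      qed
    qed
  qed
qed

end
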